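(* Let $H$ satisfy the embedding conditions below with constant $C_H$ and $h$ a strictly positive probability density w.r.t. $\mu$, and let $f\in H$. Let $0<\alpha<1$, $w=\alpha w_m+(1-\alpha)h$, $\nu=w\mu$, $r\in\mathbb N$, $\bar n>m$, $n=\bar nr$, and $\mathbf x\sim(\gamma_{\bar n}^\nu)^{\otimes r}$, using weighted least squares with weight $w$. Let $0<\delta<1$ and $S_\delta=\{\lambda_{\min}(\mathbf G^w(\mathbf x))\ge1-\delta\}$. Then with probability at least $\mathbb P(S_\delta)$, $$\|f-\hat P_{V_m}f\|\le\big(C_H+(1-\delta)^{-1/2}(1-\alpha)^{-1/2}\big)\inf_{g\in V_m}\|f-g\|_H.$$ Moreover, if $\bar n\ge m+c_\delta^{-1}\alpha^{-1}m\log(nm^2)$, then $$\mathbb E(\|f-\hat P_{V_m}f\|^2)\le\Big(2C_H^2+2(1-\alpha)^{-1}r\big(1+(1-\tfrac m{\bar n})^{-1}(1-\delta)^{-1}\big)\Big)\inf_{g\in V_m}\|f-g\|_H^2.$$ (Convention $\|v\|_H=+\infty$ for $v\notin H$.)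
   Context: $\mathcal X$ is a Polish space with Borel probability measure $\mu$; $\|\cdot\|$ is the $L^2_\mu$ norm. $V_m\subset L^2_\mu$ has $L^2_\mu$-orthonormal basis $\varphi_1,\dots,\varphi_m$, $\boldsymbol\varphi=(\varphi_1,\dots,\varphi_m)^T$, $w_m(x)=\frac1m\|\boldsymbol\varphi(x)\|_2^2$. For points $\mathbf x=(x_1,\dots,x_n)$ and weight $w$: $\|f\|_n^2=\frac1n\sum_iw(x_i)^{-1}f(x_i)^2$, $\Phi^w(\mathbf x)$ has rows $w(x_i)^{-1/2}\boldsymbol\varphi(x_i)^T$, $\mathbf G^w(\mathbf x)=\frac1n\Phi^w(\mathbf x)^T\Phi^w(\mathbf x)$, $\hat P_{V_m}f$ is the unique minimizer over $V_m$ of $\|f-g\|_n$. $\gamma_{\bar n}^\nu$ is the probability measure on $\mathcal X^{\bar n}$ with $d\gamma_{\bar n}^\nu(\mathbf x)=\frac{(\bar n-m)!}{\bar n!}\det(\Phi^w(\mathbf x)^T\Phi^w(\mathbf x))\,d\nu^{\otimes\bar n}(\mathbf x)$. $c_\delta=\delta+(1-\delta)\log(1-\delta)$. $H$ is a normed vector space of functions on $\mathcal X$ with $\|f\|\le C_H\|f\|_H$ and $\operatorname{ess\,sup}_xh(x)^{-1/2}|f(x)|\le\|f\|_H$ for all $f\in H$. *)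

theory Defs
  imports "HOL-Probability.Probability" "Jordan_Normal_Form.Char_Poly"
begin

definition L2norm :: "'a measure \<Rightarrow> ('a \<Rightarrow> real) \<Rightarrow> real" where
  "L2norm M f = sqrt (\<integral>x. (f x)^2 \<partial>M)"

text \<open>V_m = span of phi_0,...,phi_(m-1) (0-based indexing of phi_1..phi_m).\<close>
definition Vm :: "(nat \<Rightarrow> 'a \<Rightarrow> real) \<Rightarrow> nat \<Rightarrow> ('a \<Rightarrow> real) set" where
  "Vm \<phi> m = {g. \<exists>c::nat \<Rightarrow> real. g = (\<lambda>x. \<Sum>j<m. c j * \<phi> j x)}"

definition wm :: "(nat \<Rightarrow> 'a \<Rightarrow> real) \<Rightarrow> nat \<Rightarrow> 'a \<Rightarrow> real" where
  "wm \<phi> m x = (1 / real m) * (\<Sum>j<m. (\<phi> j x)^2)"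

definition normn :: "('a \<Rightarrow> real) \<Rightarrow> nat \<Rightarrow> (nat \<Rightarrow> 'a) \<Rightarrow> ('a \<Rightarrow> real) \<Rightarrow> real" where
  "normn w n x f = sqrt ((1 / real n) * (\<Sum>i<n. (f (x i))^2 / w (x i)))"

definition PhiMat :: "(nat \<Rightarrow> 'a \<Rightarrow> real) \<Rightarrow> nat \<Rightarrow> ('a \<Rightarrow> real) \<Rightarrow> nat \<Rightarrow> (nat \<Rightarrow> 'a) \<Rightarrow> real mat" where
  "PhiMat \<phi> m w n x = mat n m (\<lambda>(i, j). \<phi> j (x i) / sqrt (w (x i)))"

definition GramMat :: "(nat \<Rightarrow> 'a \<Rightarrow> real) \<Rightarrow> nat \<Rightarrow> ('a \<Rightarrow> real) \<Rightarrow> nat \<Rightarrow> (nat \<Rightarrow> 'a) \<Rightarrow> real mat" where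
  "GramMat \<phi> m w n x = (1 / real n) \<cdot>\<^sub>m (transpose_mat (PhiMat \<phi> m w n x) * PhiMat \<phi> m w n x)"

definition lambda_min :: "real mat \<Rightarrow> real" where
  "lambda_min A = Min {k. eigenvalue A k}"

text \<open>Weighted least-squares projection: the unique minimizer over V_m of ||f - g||_n
  (an arbitrary element if the minimizer is not unique).\<close>
definition wls :: "(nat \<Rightarrow> 'a \<Rightarrow> real) \<Rightarrow> nat \<Rightarrow> ('a \<Rightarrow> real) \<Rightarrow> nat \<Rightarrow> (nat \<Rightarrow> 'a)
    \<Rightarrow> ('a \<Rightarrow> real) \<Rightarrow> ('a \<Rightarrow> real)" where
  "wls \<phi> m w n x f = (THE g. g \<in> Vm \<phi> m \<and>
      (\<forall>g' \<in> Vm \<phi> m. normn w n x (\<lambda>y. f y - g y) \<le> normn w n x (\<lambda>y. f y - g' y)))"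

definition gammaDPP :: "'a measure \<Rightarrow> (nat \<Rightarrow> 'a \<Rightarrow> real) \<Rightarrow> nat \<Rightarrow> ('a \<Rightarrow> real) \<Rightarrow> nat
    \<Rightarrow> (nat \<Rightarrow> 'a) measure" where
  "gammaDPP M \<phi> m w nbar =
     density (PiM {..<nbar} (\<lambda>_. density M (\<lambda>x. ennreal (w x))))
       (\<lambda>x. ennreal (fact (nbar - m) / fact nbar *
              det (transpose_mat (PhiMat \<phi> m w nbar x) * PhiMat \<phi> m w nbar x)))"

text \<open>(gamma_nbar^nu)^{\<otimes> r}, viewed as a distribution on X^(nbar r): block j consists of
  points with indices j*nbar, ..., (j+1)*nbar - 1.\<close>
definition gammaProd :: "'a measure \<Rightarrow> (nat \<Rightarrow> 'a \<Rightarrow> real) \<Rightarrow> nat \<Rightarrow> ('a \<Rightarrow> real) \<Rightarrow> nat \<Rightarrow> nat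
    \<Rightarrow> (nat \<Rightarrow> 'a) measure" where
  "gammaProd M \<phi> m w nbar r =
     distr (PiM {..<r} (\<lambda>_. gammaDPP M \<phi> m w nbar)) (PiM {..<nbar * r} (\<lambda>_. M))
       (\<lambda>y. restrict (\<lambda>i. y (i div nbar) (i mod nbar)) {..<nbar * r})"

definition c_delta :: "real \<Rightarrow> real" where
  "c_delta \<delta> = \<delta> + (1 - \<delta>) * ln (1 - \<delta>)"

definition normHe :: "('a \<Rightarrow> real) set \<Rightarrow> (('a \<Rightarrow> real) \<Rightarrow> real) \<Rightarrow> ('a \<Rightarrow> real) \<Rightarrow> ennreal" where
  "normHe H nH v = (if v \<in> H then ennreal (nH v) else \<infinity>)"

end

theory Submission
  imports Defs "HOL-Real_Asymp.Real_Asymp"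
begin

text \<open>
  Write \<open>v(x) = w(x)\<^sup>-\<^sup>1\<^sup>/\<^sup>2 \<phi>(x)\<close>, so that \<open>v\<close> is isotropic under \<open>\<nu>\<close> and \<open>|v|\<^sup>2 \<le> m/\<alpha>\<close>. Whenever
  \<open>|c|\<^sup>2 \<le> b \<Sum>\<^sub>i (v(x\<^sub>i) \<cdot> c)\<^sup>2\<close> for all \<open>c\<close>, the least-squares error is at most
  \<open>\<parallel>f - g\<parallel> + (b n/(1 - \<alpha>))\<^sup>1\<^sup>/\<^sup>2 \<parallel>f - g\<parallel>\<^sub>H\<close>, because \<open>w \<ge> (1 - \<alpha>) h\<close>. On \<open>S\<^sub>\<delta>\<close> one takes
  \<open>b = 1/(n (1 - \<delta>))\<close>, which is the first claim. For the second, only the first block of points is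
  used: with \<open>Y\<close> its Gram matrix, either \<open>c\<^sup>T Y c \<ge> t |c|\<^sup>2\<close>, where \<open>t = (n' - m) (1 - \<delta>)\<close> and \<open>n'\<close> is the
  block length, or \<open>|c|\<^sup>2 det Y \<le> tr (adj Y) c\<^sup>T Y c\<close>.
  The factor \<open>det Y\<close> cancels against the density of volume sampling, and by Cauchy--Binet each
  principal minor of \<open>Y\<close> is a sum of squared determinants that involve only \<open>m - 1\<close> points. The other
  points are independent of these, so a matrix Chernoff bound for them makes the second
  case negligible. That bound uses, in place of matrix exponentials, the trace of a power \<open>2\<^sup>j\<close> of
  \<open>B\<^sub>N \<dots> B\<^sub>1 B\<^sub>1 \<dots> B\<^sub>N\<close> with \<open>B\<^sub>i = I - \<epsilon> v(x\<^sub>i) v(x\<^sub>i)\<^sup>T\<close>; its expectation is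
  controlled by the Lieb--Thirring trace inequality, which for such powers follows from cyclicity
  and the arithmetic-geometric mean inequality.
\<close>

section \<open>Trace inequalities and the Chernoff potential\<close>

text \<open>The mean in the second claim is not conditioned on \<open>S\<close>, so the Gram matrix
  may be arbitrarily close to singular and its inverse has to be averaged; this works because 1 /
  det Y is the only singularity of adj Y / det Y. With K = m / \<alpha> and N = n' - m, the choice
  \<theta> = - ln (1 - \<delta>) / K makes the Chernoff exponent exactly c_\<delta> N / K. Replacing
  an exponential by a finite power costs a factor 2, uniformly over all families of at most n'
  points once j is large.

  In the constant, the first case gives n / (N (1 - \<delta>)). The second gives n * 2 m^2 / (n' - m
  + 1) * exp (- c_\<delta> N / K), which the logarithmic condition and n' - m + 1 >= 2 push below 1
  <= r. The factor r is the price of using one block out of r; the other blocks only add positive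
  semidefinite terms.

  The sup bound for f - g holds off a null set that depends on g, and V_m is uncountable. The
  infimum is therefore approached along one sequence, whose exceptional sets have a null
  union.\<close>

text \<open>
  Matrices are unrestricted functions and only products sum over indices below the dimension, so
  multiplication is associative without side conditions.
\<close>

type_synonym fmat = "nat \<Rightarrow> nat \<Rightarrow> real"

context
  fixes m :: nat
begin

definition mmul :: "fmat \<Rightarrow> fmat \<Rightarrow> fmat" (infixl "\<diamondop>" 70) where
  "A \<diamondop> B = (\<lambda>i j. \<Sum>k<m. A i k * B k j)"

definition mtr :: "fmat \<Rightarrow> real" where
  "mtr A = (\<Sum>i<m. A i i)"

definition mtp :: "fmat \<Rightarrow> fmat" where
  "mtp A = (\<lambda>i j. A j i)"

definition qform :: "fmat \<Rightarrow> (nat \<Rightarrow> real) \<Rightarrow> real" where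
  "qform A c = (\<Sum>i<m. \<Sum>j<m. c i * A i j * c j)"

definition nrm2 :: "(nat \<Rightarrow> real) \<Rightarrow> real" where
  "nrm2 c = (\<Sum>i<m. (c i)\<^sup>2)"

definition ip :: "(nat \<Rightarrow> real) \<Rightarrow> (nat \<Rightarrow> real) \<Rightarrow> real" where
  "ip c d = (\<Sum>i<m. c i * d i)"

definition mapp :: "fmat \<Rightarrow> (nat \<Rightarrow> real) \<Rightarrow> nat \<Rightarrow> real" where
  "mapp A c = (\<lambda>i. \<Sum>j<m. A i j * c j)"

text \<open>The power \<open>A^(2^j)\<close>, by repeated squaring. Exponents start at 1 because the
  product has no unit: it discards the entries outside the dimension.\<close>

fun msq :: "nat \<Rightarrow> fmat \<Rightarrow> fmat" where
  "msq 0 A = A"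
| "msq (Suc j) A = msq j A \<diamondop> msq j A"

lemma mmul_assoc: "(A \<diamondop> B) \<diamondop> C = A \<diamondop> (B \<diamondop> C)"
proof (intro ext)
  fix i j
  have "((A \<diamondop> B) \<diamondop> C) i j = (\<Sum>l<m. \<Sum>k<m. A i k * B k l * C l j)"
    by (simp add: mmul_def sum_distrib_right)
  also have "\<dots> = (\<Sum>k<m. \<Sum>l<m. A i k * B k l * C l j)"
    by (rule sum.swap)
  finally show "((A \<diamondop> B) \<diamondop> C) i j = (A \<diamondop> (B \<diamondop> C)) i j"
    by (simp add: mmul_def sum_distrib_left mult.assoc)
qed

lemma mtr_comm: "mtr (A \<diamondop> B) = mtr (B \<diamondop> A)"
  unfolding mtr_def mmul_def by (subst sum.swap) (simp add: mult.commute)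

lemma mtp_mmul [simp]: "mtp (A \<diamondop> B) = mtp B \<diamondop> mtp A"
  by (simp add: mtp_def mmul_def mult.commute)

lemma mtp_mtp [simp]: "mtp (mtp A) = A"
  by (simp add: mtp_def)

lemma mtp_msq: "mtp (msq j A) = msq j (mtp A)"
  by (induction j) auto

lemma msq_Suc': "msq (Suc j) A = msq j (A \<diamondop> A)"
  by (induction j) auto

text \<open>With k = 2^j the witness is R = B (A B)^(k - 1). Carrying both factorizations together
  closes the induction, and \<open>mtr_comm\<close> then swaps the two factors.\<close>

lemma msq_cyclic: "\<exists>R. msq j (A \<diamondop> B) = A \<diamondop> R \<and> msq j (B \<diamondop> A) = R \<diamondop> A"
proof (induction j)
  case (Suc j)
  then obtain R where "msq j (A \<diamondop> B) = A \<diamondop> R" "msq j (B \<diamondop> A) = R \<diamondop> A" by blast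
  then show ?case by (auto intro!: exI[of _ "R \<diamondop> A \<diamondop> R"] simp: mmul_assoc)
qed auto

lemma mtr_msq_comm: "mtr (msq j (A \<diamondop> B)) = mtr (msq j (B \<diamondop> A))"
  using msq_cyclic[of j A B] by (metis mtr_comm)

text \<open>Entrywise arithmetic-geometric mean: the additive form of Cauchy--Schwarz for the
  Frobenius inner product.\<close>

lemma mtr_mmul_le: "mtr (A \<diamondop> B) \<le> (mtr (A \<diamondop> mtp A) + mtr (B \<diamondop> mtp B)) / 2"
proof -
  have "mtr (A \<diamondop> B) = (\<Sum>i<m. \<Sum>k<m. A i k * B k i)"
    by (simp add: mtr_def mmul_def)
  also have "\<dots> \<le> (\<Sum>i<m. \<Sum>k<m. ((A i k)\<^sup>2 + (B k i)\<^sup>2) / 2)"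
  proof (intro sum_mono)
    fix i k
    show "A i k * B k i \<le> ((A i k)\<^sup>2 + (B k i)\<^sup>2) / 2"
      using sum_squares_bound[of "A i k" "B k i"] by simp
  qed
  also have "\<dots> = ((\<Sum>i<m. \<Sum>k<m. (A i k)\<^sup>2) + (\<Sum>i<m. \<Sum>k<m. (B k i)\<^sup>2)) / 2"
    by (simp add: sum.distrib sum_divide_distrib[symmetric])
  also have "(\<Sum>i<m. \<Sum>k<m. (B k i)\<^sup>2) = (\<Sum>k<m. \<Sum>i<m. (B k i)\<^sup>2)"
    by (rule sum.swap)
  finally show ?thesis
    by (simp add: mtr_def mmul_def mtp_def power2_eq_square)
qed

text \<open>
  Simultaneous induction: \<open>weyl_trace\<close> for \<open>X = P Q\<close> turns \<open>tr (P Q)\<^sup>2\<^sup>p\<close> into \<open>tr (P\<^sup>2 Q\<^sup>2)\<^sup>p\<close>, and \<open>lieb_thirring\<close>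
  for \<open>X\<^sup>T X\<close> and \<open>X X\<^sup>T\<close>, which have the same traces of powers, advances \<open>weyl_trace\<close>.
\<close>

lemma trace_inequalities:
  shows lieb_thirring:
      "\<And>P Q. mtp P = P \<Longrightarrow> mtp Q = Q \<Longrightarrow> mtr (msq j (P \<diamondop> Q)) \<le> mtr (msq j P \<diamondop> msq j Q)"
    and weyl_trace: "\<And>X. mtr (msq (Suc j) X) \<le> mtr (msq j (X \<diamondop> mtp X))"
proof (induction j)
  case 0
  {
    case 1
    then show ?case by simp
  next
    case (2 X)
    then show ?case
      using mtr_mmul_le[of X X] by simp
  }
next
  case (Suc j)
  {
    case (1 P Q)
    have "mtr (msq (Suc j) (P \<diamondop> Q)) \<le> mtr (msq j ((P \<diamondop> Q) \<diamondop> mtp (P \<diamondop> Q)))"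
      by (rule Suc.IH(2))
    also have "\<dots> = mtr (msq j (P \<diamondop> (Q \<diamondop> Q \<diamondop> P)))"
      using 1 by (simp add: mmul_assoc)
    also have "\<dots> = mtr (msq j ((Q \<diamondop> Q) \<diamondop> (P \<diamondop> P)))"
      by (subst mtr_msq_comm) (simp add: mmul_assoc)
    also have "\<dots> \<le> mtr (msq j (Q \<diamondop> Q) \<diamondop> msq j (P \<diamondop> P))"
      using 1 by (intro Suc.IH(1)) auto
    also have "\<dots> = mtr (msq (Suc j) P \<diamondop> msq (Suc j) Q)"
      by (subst mtr_comm) (simp only: msq_Suc')
    finally show ?case .
  next
    case (2 X)
    have "mtr (msq (Suc (Suc j)) X) = mtr (msq (Suc j) (X \<diamondop> X))"
      by (simp only: msq_Suc')
    also have "\<dots> \<le> mtr (msq j ((X \<diamondop> X) \<diamondop> mtp (X \<diamondop> X)))"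
      by (rule Suc.IH(2))
    also have "\<dots> = mtr (msq j (X \<diamondop> (X \<diamondop> mtp X \<diamondop> mtp X)))"
      by (simp add: mmul_assoc)
    also have "\<dots> = mtr (msq j ((X \<diamondop> mtp X) \<diamondop> (mtp X \<diamondop> X)))"
      by (subst mtr_msq_comm) (simp add: mmul_assoc)
    also have "\<dots> \<le> mtr (msq j (X \<diamondop> mtp X) \<diamondop> msq j (mtp X \<diamondop> X))"
      by (intro Suc.IH(1)) auto
    also have "\<dots> \<le> (mtr (msq (Suc j) (X \<diamondop> mtp X)) + mtr (msq (Suc j) (mtp X \<diamondop> X))) / 2"
      using mtr_mmul_le[of "msq j (X \<diamondop> mtp X)" "msq j (mtp X \<diamondop> X)"]
      by (simp add: mtp_msq)
    also have "\<dots> = mtr (msq (Suc j) (X \<diamondop> mtp X))"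
      by (subst mtr_msq_comm[of _ "mtp X"]) simp
    finally show ?case .
  }
qed

section \<open>Quadratic forms and traces of squares of symmetric matrices\<close>

lemma qform_mmul_sym:
  assumes R: "mtp R = R"
  shows "qform (R \<diamondop> R) c = nrm2 (mapp R c)"
proof -
  have *: "R i k = R k i" for i k
    using fun_cong[OF fun_cong[OF R], of k i] by (simp add: mtp_def)
  have "qform (R \<diamondop> R) c = (\<Sum>i<m. \<Sum>j<m. \<Sum>k<m. (R k i * c i) * (R k j * c j))"
    unfolding qform_def mmul_def sum_distrib_left sum_distrib_right
    by (intro sum.cong refl) (metis * mult.commute mult.assoc)
  also have "\<dots> = (\<Sum>i<m. \<Sum>k<m. \<Sum>j<m. (R k i * c i) * (R k j * c j))"
    by (intro sum.cong refl sum.swap)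
  also have "\<dots> = (\<Sum>k<m. \<Sum>i<m. \<Sum>j<m. (R k i * c i) * (R k j * c j))"
    by (rule sum.swap)
  also have "\<dots> = nrm2 (mapp R c)"
    unfolding nrm2_def mapp_def power2_eq_square
    by (simp add: sum_product)
  finally show ?thesis .
qed

lemma nrm2_nonneg [simp]: "0 \<le> nrm2 c"
  by (simp add: nrm2_def sum_nonneg)

lemma ip_cs: "(ip c d)\<^sup>2 \<le> nrm2 c * nrm2 d"
  unfolding ip_def nrm2_def by (rule Cauchy_Schwarz_ineq_sum)

text \<open>Cauchy--Schwarz row by row: |R c|^2 is at most the sum of the squared row norms. Writing
  the matrix as a square encodes its positive semidefiniteness.\<close>

lemma qform_le_mtr:
  assumes R: "mtp R = R" and "nrm2 c = 1"
  shows "qform (R \<diamondop> R) c \<le> mtr (R \<diamondop> R)"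
proof -
  have *: "R i k = R k i" for i k
    using fun_cong[OF fun_cong[OF R], of k i] by (simp add: mtp_def)
  have "qform (R \<diamondop> R) c = (\<Sum>k<m. (ip (R k) c)\<^sup>2)"
    using assms by (simp add: qform_mmul_sym nrm2_def mapp_def ip_def)
  also have "\<dots> \<le> (\<Sum>k<m. nrm2 (R k))"
    using ip_cs[of "R k" c for k] assms by (intro sum_mono) auto
  also have "\<dots> = mtr (R \<diamondop> R)"
    unfolding mtr_def mmul_def nrm2_def power2_eq_square
    by (intro sum.cong refl) (metis *)
  finally show ?thesis .
qed

lemma qform_eq_ip: "qform A c = ip c (mapp A c)"
  by (simp add: qform_def ip_def mapp_def sum_distrib_left mult_ac)

text \<open>Jensen's inequality for matrix powers, one squaring at a time: (c^T M c)^2 <= |M c|^2 =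
  c^T M^2 c for a unit vector \<open>c\<close>.\<close>

lemma qform_msq_ge:
  assumes "mtp A = A" "nrm2 c = 1" "0 \<le> qform A c"
  shows "qform A c ^ (2 ^ j) \<le> qform (msq j A) c"
proof (induction j)
  case (Suc j)
  have sym: "mtp (msq j A) = msq j A"
    using assms by (simp add: mtp_msq)
  have "qform A c ^ (2 ^ Suc j) = (qform A c ^ (2 ^ j))\<^sup>2"
    by (simp only: power_Suc2 power_mult)
  also have "\<dots> \<le> (qform (msq j A) c)\<^sup>2"
    using Suc assms by (intro power_mono) auto
  also have "\<dots> \<le> nrm2 c * nrm2 (mapp (msq j A) c)"
    unfolding qform_eq_ip by (rule ip_cs)
  also have "\<dots> = qform (msq (Suc j) A) c"
    using assms sym by (simp add: qform_mmul_sym)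
  finally show ?case .
qed simp

section \<open>Products of factors I - s v v^T and their traces\<close>

definition rk1 :: "(nat \<Rightarrow> real) \<Rightarrow> real \<Rightarrow> fmat" where
  "rk1 v s = (\<lambda>i j. if i < m \<and> j < m then (if i = j then 1 else 0) - s * v i * v j else 0)"

lemma mtp_rk1 [simp]: "mtp (rk1 v s) = rk1 v s"
  by (auto simp: mtp_def rk1_def fun_eq_iff)

text \<open>Because (v v^T)^2 = |v|^2 v v^T. Since \<open>rk1\<close> is cut off to the m by m
  corner, this is an equality of functions and not only of entries inside the dimension.\<close>

lemma rk1_mmul: "rk1 v s \<diamondop> rk1 v s' = rk1 v (s + s' - s * s' * nrm2 v)"
proof (intro ext)
  fix i j
  show "(rk1 v s \<diamondop> rk1 v s') i j = rk1 v (s + s' - s * s' * nrm2 v) i j"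
  proof (cases "i < m \<and> j < m")
    case True
    have "(rk1 v s \<diamondop> rk1 v s') i j =
       (\<Sum>k<m. (if k = i then if i = j then 1 else 0 else 0) - (if k = i then s' * v i * v j else 0) -
           (if k = j then s * v i * v j else 0) + s * s' * v i * v j * (v k)\<^sup>2)"
      unfolding mmul_def using True
      by (intro sum.cong) (auto simp: rk1_def algebra_simps power2_eq_square)
    also have "\<dots> = rk1 v (s + s' - s * s' * nrm2 v) i j"
      using True
      by (simp add: sum.distrib sum_subtractf sum_distrib_left[symmetric] nrm2_def rk1_def algebra_simps)
    finally show ?thesis .
  qed (auto simp: mmul_def rk1_def)
qed

lemma sum_lessThan_add: "(\<Sum>i<a + b. f i) = (\<Sum>i<a. f i) + (\<Sum>i<b. f (a + i :: nat) :: real)"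
  by (induction b) auto

text \<open>On the line of \<open>v\<close> the matrix multiplies by q = 1 - s |v|^2, so with k =
  2^j the new coefficient is (1 - q^k) / |v|^2. Written as a geometric sum it also covers v =
  0.\<close>

lemma msq_rk1:
  "msq j (rk1 v s) = rk1 v (s * (\<Sum>i<2^j. (1 - s * nrm2 v) ^ i))"
proof (induction j)
  case (Suc j)
  define q where "q = 1 - s * nrm2 v"
  define S where "S = (\<Sum>i<2^j. q ^ i)"
  have geo: "q ^ (2^j) = 1 - s * nrm2 v * S"
    using one_diff_power_eq[of q "2^j"] by (simp add: S_def q_def)
  have "(\<Sum>i<2 ^ Suc j. q ^ i) = S + q ^ (2^j) * S"
  proof -
    have "(\<Sum>i<2 ^ Suc j. q ^ i) = (\<Sum>i<2^j + 2^j. q ^ i)"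
      by (simp add: mult_2)
    also have "\<dots> = S + (\<Sum>i<2^j. q ^ (2^j + i))"
      unfolding S_def by (rule sum_lessThan_add)
    finally show ?thesis by (simp add: power_add S_def sum_distrib_left)
  qed
  then have "s * (\<Sum>i<2 ^ Suc j. q ^ i) = s * S + s * S - s * S * (s * S) * nrm2 v"
    by (simp only: geo) (simp add: algebra_simps)
  with Suc show ?case
    by (simp add: rk1_mmul S_def q_def)
qed simp

lemma mtr_rk1_mmul: "mtr (A \<diamondop> rk1 v s) = mtr A - s * qform A v"
proof -
  have "mtr (A \<diamondop> rk1 v s) = (\<Sum>i<m. \<Sum>k<m. (if k = i then A i i else 0) - s * (v i * A i k * v k))"
    unfolding mtr_def mmul_def
    by (intro sum.cong refl) (auto simp: rk1_def algebra_simps)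
  then show ?thesis
    by (simp add: sum_subtractf sum_distrib_left[symmetric] mtr_def qform_def)
qed

text \<open>The head of the list is the outermost factor on both sides, so that removing it
  corresponds to integrating out one point. The base case is the identity matrix.\<close>

fun cprod :: "real \<Rightarrow> (nat \<Rightarrow> real) list \<Rightarrow> fmat" where
  "cprod e [] = rk1 (\<lambda>_. 0) 0"
| "cprod e (v # vs) = rk1 v e \<diamondop> cprod e vs \<diamondop> rk1 v e"

lemma mtp_cprod [simp]: "mtp (cprod e vs) = cprod e vs"
  by (induction vs) (auto simp: mmul_assoc)

lemma mtr_cprod_Nil [simp]: "mtr (msq j (cprod e [])) = real m"
  unfolding cprod.simps msq_rk1 by (simp add: mtr_def rk1_def)

text \<open>Cyclicity joins the two outer factors B into B^2, and Lieb--Thirring separates their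
  power from \<open>Q\<close>. As B^(2^(j+1)) = I - s v v^T, the bound is affine in v v^T, so that
  isotropy will evaluate its mean. The scaling of \<open>e\<close> makes 2^(j+1) e = \<theta>; since
  s decreases in |v|^2 <= K, it is at least (1 - exp (- \<theta> K)) / K.\<close>

lemma mtr_cprod_Cons_le:
  fixes vs :: "(nat \<Rightarrow> real) list"
  assumes j: "0 < j" and K: "0 < K" "nrm2 v \<le> K" and th: "0 < \<theta>" "\<theta> * K \<le> 2 ^ Suc j"
  defines "e \<equiv> \<theta> / 2 ^ Suc j"
  defines "Q \<equiv> msq j (cprod e vs)"
  shows "mtr (msq j (cprod e (v # vs))) \<le> mtr Q - (1 - exp (- \<theta> * K)) / K * qform Q v"
proof -
  define p :: nat where "p = 2 ^ Suc j"
  have e0: "0 < e" and eK: "e * K \<le> 1"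
    using th by (auto simp: e_def field_simps)
  define s where "s = e * (\<Sum>i<p. (1 - e * nrm2 v) ^ i)"
  have "(1 - e * K) ^ p \<le> exp (- \<theta> * K)"
  proof -
    have "(1 - e * K) ^ p \<le> exp (- e * K) ^ p"
      using eK exp_ge_add_one_self[of "- e * K"] by (intro power_mono) auto
    also have "\<dots> = exp (- \<theta> * K)"
      by (subst exp_of_nat_mult[symmetric]) (simp add: e_def p_def)
    finally show ?thesis .
  qed
  then have "(1 - exp (- \<theta> * K)) / K \<le> (1 - (1 - e * K) ^ p) / K"
    using K by (simp add: divide_right_mono)
  also have "\<dots> = e * (\<Sum>i<p. (1 - e * K) ^ i)"
    using one_diff_power_eq[of "1 - e * K" p] K by (simp add: field_simps)
  also have "\<dots> \<le> s"
    unfolding s_def using e0 eK K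
    by (intro mult_left_mono sum_mono power_mono) (auto intro: mult_left_mono)
  finally have s: "(1 - exp (- \<theta> * K)) / K \<le> s" .
  \<comment> \<open>\<open>0 < j\<close> makes \<open>Q\<close> a square of a symmetric matrix,
    hence positive semidefinite.\<close>
  obtain i where i: "j = Suc i" using j by (cases j) auto
  have "0 \<le> qform Q v"
    unfolding Q_def i by (simp add: qform_mmul_sym mtp_msq)
  note * = mult_right_mono[OF s this]
  have "mtr (msq j (cprod e (v # vs))) = mtr (msq j (cprod e vs \<diamondop> (rk1 v e \<diamondop> rk1 v e)))"
  proof -
    have "mtr (msq j (rk1 v e \<diamondop> (cprod e vs \<diamondop> rk1 v e)))
        = mtr (msq j ((cprod e vs \<diamondop> rk1 v e) \<diamondop> rk1 v e))"
      by (rule mtr_msq_comm)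
    then show ?thesis by (simp add: mmul_assoc)
  qed
  also have "\<dots> \<le> mtr (Q \<diamondop> msq j (rk1 v e \<diamondop> rk1 v e))"
    unfolding Q_def by (rule lieb_thirring) auto
  also have "\<dots> = mtr Q - s * qform Q v"
    unfolding msq_Suc'[symmetric] msq_rk1 mtr_rk1_mmul s_def p_def ..
  finally show ?thesis using * by simp
qed

lemma mtr_msq_cprod_nonneg: "0 < j \<Longrightarrow> 0 \<le> mtr (msq j (cprod e vs))"
proof -
  assume "0 < j"
  then obtain i where i: "j = Suc i" by (cases j) auto
  define R where "R = msq i (cprod e vs)"
  have "mtp R = R" by (simp add: R_def mtp_msq)
  then have *: "R a b = R b a" for a b
    using fun_cong[OF fun_cong[of "mtp R" R b], of a] by (simp add: mtp_def)
  have "mtr (R \<diamondop> R) = (\<Sum>a<m. \<Sum>b<m. R a b * R a b)"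
    unfolding mtr_def mmul_def by (intro sum.cong refl) (metis *)
  then show ?thesis
    by (simp add: i R_def sum_nonneg)
qed

lemma qform_cong: "(\<And>i. i < m \<Longrightarrow> c i = d i) \<Longrightarrow> qform A c = qform A d"
  by (simp add: qform_def)

section \<open>Lower bound for the potential along a poorly covered direction\<close>

definition vstep :: "real \<Rightarrow> (nat \<Rightarrow> real) \<Rightarrow> (nat \<Rightarrow> real) \<Rightarrow> nat \<Rightarrow> real" where
  "vstep e v y = (\<lambda>i. y i - e * v i * ip v y)"

lemma mapp_mmul: "mapp (A \<diamondop> B) c = mapp A (mapp B c)"
proof
  fix i
  have "mapp (A \<diamondop> B) c i = (\<Sum>j<m. \<Sum>k<m. A i k * B k j * c j)"
    by (simp add: mapp_def mmul_def sum_distrib_right)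
  also have "\<dots> = (\<Sum>k<m. \<Sum>j<m. A i k * B k j * c j)"
    by (rule sum.swap)
  finally show "mapp (A \<diamondop> B) c i = mapp A (mapp B c) i"
    by (simp add: mapp_def sum_distrib_left mult.assoc)
qed

lemma ip_mapp: "ip c (mapp A d) = ip (mapp (mtp A) c) d"
proof -
  have "ip c (mapp A d) = (\<Sum>i<m. \<Sum>j<m. c i * A i j * d j)"
    by (simp add: ip_def mapp_def sum_distrib_left mult.assoc)
  also have "\<dots> = (\<Sum>j<m. \<Sum>i<m. c i * A i j * d j)"
    by (rule sum.swap)
  finally show ?thesis
    by (simp add: ip_def mapp_def mtp_def sum_distrib_left sum_distrib_right mult_ac)
qed

lemma qform_congruence: "qform (mtp B \<diamondop> A \<diamondop> B) c = qform A (mapp B c)"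
  by (simp add: qform_eq_ip mapp_mmul ip_mapp)

lemma mapp_rk1: "i < m \<Longrightarrow> mapp (rk1 v e) c i = vstep e v c i"
proof -
  assume i: "i < m"
  have "mapp (rk1 v e) c i = (\<Sum>j<m. (if j = i then c i else 0) - e * v i * (v j * c j))"
    unfolding mapp_def using i by (intro sum.cong refl) (auto simp: rk1_def algebra_simps)
  then show ?thesis
    using i by (simp add: sum_subtractf sum_distrib_left[symmetric] vstep_def ip_def)
qed

lemma qform_cprod_Cons: "qform (cprod e (v # vs)) c = qform (cprod e vs) (vstep e v c)"
  using qform_congruence[of "rk1 v e" "cprod e vs" c]
  by (simp add: qform_cong[of "mapp (rk1 v e) c" "vstep e v c"] mapp_rk1)

lemma qform_cprod_Nil [simp]: "qform (cprod e []) c = nrm2 c"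
  by (simp add: qform_eq_ip ip_def mapp_rk1 nrm2_def power2_eq_square)
     (simp add: vstep_def)

lemma nrm2_vstep: "nrm2 (vstep e v y) = nrm2 y - (2 * e - e\<^sup>2 * nrm2 v) * (ip v y)\<^sup>2"
proof -
  have "nrm2 (vstep e v y) = (\<Sum>i<m. (y i)\<^sup>2 - 2 * e * ip v y * (v i * y i) + e\<^sup>2 * (ip v y)\<^sup>2 * (v i)\<^sup>2)"
    unfolding nrm2_def vstep_def by (intro sum.cong refl) (simp add: power2_eq_square algebra_simps)
  also have "\<dots> = nrm2 y - 2 * e * ip v y * ip v y + e\<^sup>2 * (ip v y)\<^sup>2 * nrm2 v"
    by (simp add: sum.distrib sum_subtractf sum_distrib_left nrm2_def ip_def)
  finally show ?thesis by (simp add: power2_eq_square algebra_simps)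
qed

lemma sqrt_nrm2_triangle: "sqrt (nrm2 (\<lambda>i. x i + y i)) \<le> sqrt (nrm2 x) + sqrt (nrm2 y)"
  using L2_set_triangle_ineq[of x y "{..<m}"] by (simp add: L2_set_def nrm2_def)

lemma abs_ip_le: "\<bar>ip x y\<bar> \<le> sqrt (nrm2 x) * sqrt (nrm2 y)"
  using real_sqrt_le_mono[OF ip_cs[of x y]] by (simp add: real_sqrt_mult)

text \<open>\<open>y\<close> is what the factors already applied have made of \<open>c\<close>. One
  factor moves it by at most e K and lowers its squared norm by at most 2 e (v . y)^2.
  \<open>D\<close> bounds the total drift, and replacing y by c in (v . y)^2 costs at most 2 K D.
  With e of order 1 / k and D of order e, the accumulated error has order 1 / k^2.\<close>

lemma qform_cprod_ge:
  assumes "\<And>v. v \<in> set vs \<Longrightarrow> nrm2 v \<le> K" and e: "0 \<le> e" "e * K \<le> 1"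
    and "nrm2 c \<le> 1" "nrm2 y \<le> 1"
    and "sqrt (nrm2 (\<lambda>i. y i - c i)) + real (length vs) * (e * K) \<le> D"
  shows "nrm2 y - 2 * e * (\<Sum>v\<leftarrow>vs. (ip v c)\<^sup>2) - real (length vs) * (4 * e * K * D)
    \<le> qform (cprod e vs) y"
  using assms
proof (induction vs arbitrary: y)
  case (Cons v vs)
  define y' where "y' = vstep e v y"
  have vK: "nrm2 v \<le> K" using Cons.prems by simp
  have K0: "0 \<le> K" using vK nrm2_nonneg[of v] by linarith
  have sv: "sqrt (nrm2 v) * sqrt (nrm2 v) \<le> K" using vK by simp
  have ev: "e * nrm2 v \<le> 1" using vK e by (meson mult_left_mono order_trans)
  have "0 \<le> e * (2 - e * nrm2 v)" using ev e by simp
  then have c1: "0 \<le> 2 * e - e\<^sup>2 * nrm2 v"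
    by (simp add: power2_eq_square algebra_simps)
  have y'1: "nrm2 y' \<le> 1"
    unfolding y'_def nrm2_vstep
    using Cons.prems(5) mult_nonneg_nonneg[OF c1 zero_le_power2[of "ip v y"]] by linarith
  have "0 \<le> e\<^sup>2 * nrm2 v * (ip v y)\<^sup>2" by simp
  then have low: "nrm2 y - 2 * e * (ip v y)\<^sup>2 \<le> nrm2 y'"
    unfolding y'_def nrm2_vstep by (simp add: algebra_simps)
  have "nrm2 (\<lambda>i. - e * ip v y * v i) = (e * ip v y)\<^sup>2 * nrm2 v"
    by (simp add: nrm2_def sum_distrib_left power_mult_distrib mult_ac)
  then have "sqrt (nrm2 (\<lambda>i. - e * ip v y * v i)) = e * \<bar>ip v y\<bar> * sqrt (nrm2 v)"
    using e by (simp add: real_sqrt_mult abs_mult)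
  also have "\<dots> \<le> e * (sqrt (nrm2 v) * 1) * sqrt (nrm2 v)"
    using abs_ip_le[of v y] Cons.prems(5) e
    by (intro mult_right_mono mult_left_mono order_trans[OF abs_ip_le]) auto
  also have "\<dots> \<le> e * K"
    using mult_left_mono[OF sv e(1)] by (simp add: mult_ac)
  finally have "sqrt (nrm2 (\<lambda>i. - e * ip v y * v i)) \<le> e * K" .
  moreover have "(\<lambda>i. y' i - c i) = (\<lambda>i. (y i - c i) + - e * ip v y * v i)"
    by (simp add: y'_def vstep_def fun_eq_iff algebra_simps)
  ultimately have dist: "sqrt (nrm2 (\<lambda>i. y' i - c i)) \<le> sqrt (nrm2 (\<lambda>i. y i - c i)) + e * K"
    using sqrt_nrm2_triangle[of "\<lambda>i. y i - c i" "\<lambda>i. - e * ip v y * v i"] by simp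
  have D0: "sqrt (nrm2 (\<lambda>i. y i - c i)) \<le> D"
  proof -
    have "0 \<le> real (length (v # vs)) * (e * K)" using e K0 by simp
    then show ?thesis using Cons.prems(6) by linarith
  qed
  have s2: "sqrt (nrm2 (\<lambda>i. y i + c i)) \<le> 2"
    using sqrt_nrm2_triangle[of y c] Cons.prems(4,5) real_sqrt_le_1_iff
    by (smt (verit))
  \<comment> \<open>Difference of squares: y - c is small by \<open>D0\<close>, and y + c has norm
    at most 2.\<close>
  have "(ip v y)\<^sup>2 - (ip v c)\<^sup>2 = ip v (\<lambda>i. y i - c i) * ip v (\<lambda>i. y i + c i)"
    by (simp add: ip_def algebra_simps sum_subtractf sum.distrib power2_eq_square)
  also have "\<dots> \<le> \<bar>ip v (\<lambda>i. y i - c i)\<bar> * \<bar>ip v (\<lambda>i. y i + c i)\<bar>"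
    by (metis abs_ge_self abs_mult)
  also have "\<dots> \<le> (sqrt (nrm2 v) * D) * (sqrt (nrm2 v) * 2)"
    using D0 s2 order_trans[OF real_sqrt_ge_zero[OF nrm2_nonneg] D0]
    by (intro mult_mono order_trans[OF abs_ip_le] mult_left_mono mult_nonneg_nonneg) auto
  also have "\<dots> = (sqrt (nrm2 v) * sqrt (nrm2 v)) * (2 * D)"
    by simp
  also have "\<dots> \<le> K * (2 * D)"
    using sv D0 order_trans[OF _ D0, of 0] by (intro mult_right_mono) auto
  finally have "2 * e * (ip v y)\<^sup>2 \<le> 2 * e * (ip v c)\<^sup>2 + 4 * e * K * D"
    using mult_left_mono[of "(ip v y)\<^sup>2" "(ip v c)\<^sup>2 + K * (2 * D)" "2 * e"] e
    by (simp add: algebra_simps)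
  moreover have "nrm2 y' - 2 * e * (\<Sum>v\<leftarrow>vs. (ip v c)\<^sup>2) - real (length vs) * (4 * e * K * D)
     \<le> qform (cprod e vs) y'"
    using Cons.prems dist y'1 by (intro Cons.IH) (auto simp: algebra_simps)
  ultimately show ?case
    using low by (simp add: qform_cprod_Cons y'_def[symmetric] algebra_simps del: cprod.simps)
qed (simp del: cprod.simps)

end

text \<open>Shifting the exponent by ln 2 / 2 makes room for b / k^2, while exp (- a - ln 2 / 2)
  stays above exp (- a) / 2.\<close>

lemma exp_limit_perturbed:
  fixes a b :: real
  assumes "0 \<le> a" "0 \<le> b"
  shows "\<forall>\<^sub>F k in sequentially. exp (-a) / 2 \<le> (1 - a / real k - b / (real k)\<^sup>2) ^ k
           \<and> 0 \<le> 1 - a / real k - b / (real k)\<^sup>2"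
proof -
  have "((\<lambda>k. (1 + (- a - ln 2 / 2) / real k) ^ k) \<longlonglongrightarrow> exp (- a - ln 2 / 2))"
    by (rule tendsto_exp_limit_sequentially)
  moreover have "exp (- a) / 2 < exp (- a - ln 2 / 2)"
  proof -
    have "exp (-a) / 2 = exp (- a - ln 2)" by (simp add: exp_diff)
    then show ?thesis by simp
  qed
  ultimately have "\<forall>\<^sub>F k in sequentially. exp (-a) / 2 < (1 + (- a - ln 2 / 2) / real k) ^ k"
    by (rule order_tendstoD)
  moreover have "\<forall>\<^sub>F k in sequentially. real k > 2 * b / ln 2"
    by real_asymp
  moreover have "\<forall>\<^sub>F k in sequentially. real k > a + ln 2 / 2"
    by real_asymp
  ultimately show ?thesis
  proof eventually_elim
    case (elim k)
    have k: "0 < real k" using elim(3) assms by (smt (verit) ln_gt_zero divide_pos_pos)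
    have "b / (real k)\<^sup>2 \<le> (ln 2 / 2) / real k"
      using elim(2) k by (simp add: field_simps power2_eq_square)
    then have "1 + (- a - ln 2 / 2) / real k \<le> 1 - a / real k - b / (real k)\<^sup>2"
      unfolding diff_divide_distrib by simp
    moreover have "0 \<le> 1 + (- a - ln 2 / 2) / real k"
      using elim(3) k by (simp add: field_simps)
    ultimately show ?case
      using elim(1) power_mono[of "1 + (- a - ln 2 / 2) / real k" _ k] by fastforce
  qed
qed

text \<open>If a unit vector \<open>c\<close> has a small sum of (v . c)^2, its quadratic form under
  the product stays close to 1, and the 2^j-th power keeps about exp (- \<theta> t) of it. One
  \<open>j\<close> serves all such lists because the error depends only on \<open>N\<close>,
  \<open>K\<close> and \<theta>; the factor 2 pays for stopping at a finite power.\<close>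

lemma chernoff_potential_ge:
  fixes K \<theta> t :: real
  assumes "0 < K" "0 < \<theta>" "0 \<le> t"
  obtains j where "0 < j" "\<theta> * K \<le> 2 ^ Suc j"
    "\<And>vs c. \<lbrakk>length vs \<le> N; \<And>v. v \<in> set vs \<Longrightarrow> nrm2 m v \<le> K; nrm2 m c = 1;
        (\<Sum>v\<leftarrow>vs. (ip m v c)\<^sup>2) \<le> t\<rbrakk>
      \<Longrightarrow> exp (- \<theta> * t) / 2 \<le> mtr m (msq m j (cprod m (\<theta> / 2 ^ Suc j) vs))"
proof -
  define a where "a = \<theta> * t"
  define b where "b = (real N * \<theta> * K)\<^sup>2"
  have "\<forall>\<^sub>F k in sequentially. \<theta> * K \<le> real k" by real_asymp
  then have "\<forall>\<^sub>F k in sequentially. \<theta> * K \<le> real k \<and> exp (-a) / 2 \<le> (1 - a / real k - b / (real k)\<^sup>2) ^ k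
           \<and> 0 \<le> 1 - a / real k - b / (real k)\<^sup>2"
    using exp_limit_perturbed[of a b] assms by (auto simp: a_def b_def eventually_conj_iff)
  then obtain k0 where k0: "\<And>k. k \<ge> k0 \<Longrightarrow> \<theta> * K \<le> real k \<and>
      exp (-a) / 2 \<le> (1 - a / real k - b / (real k)\<^sup>2) ^ k \<and> 0 \<le> 1 - a / real k - b / (real k)\<^sup>2"
    by (auto simp: eventually_sequentially)
  define j where "j = Suc k0"
  define k :: nat where "k = 2 ^ j"
  have "k0 \<le> k" unfolding k_def j_def using less_exp[of "Suc k0"] by simp
  note k = k0[OF this]
  define e where "e = \<theta> / 2 ^ Suc j"
  have ek: "e = \<theta> / (2 * real k)" by (simp add: e_def k_def)
  have kp: "0 < real k" by (simp add: k_def)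
  have eK: "0 \<le> e" "e * K \<le> 1"
    using k kp assms by (auto simp: ek field_simps)
  show thesis
  proof (rule that[of j])
    show "0 < j" by (simp add: j_def)
    have "real k \<le> 2 ^ Suc j" by (simp add: k_def)
    then show "\<theta> * K \<le> 2 ^ Suc j" using k by linarith
  next
    fix vs :: "(nat \<Rightarrow> real) list" and c
    assume len: "length vs \<le> N" and vK: "\<And>v. v \<in> set vs \<Longrightarrow> nrm2 m v \<le> K" and c: "nrm2 m c = 1"
      and le: "(\<Sum>v\<leftarrow>vs. (ip m v c)\<^sup>2) \<le> t"
    define D where "D = real N * (e * K)"
    \<comment> \<open>Here e = \<theta> / (2 k), so 2 e t = a / k and 4 (N e K)^2 = b / k^2.\<close>
    have "1 - a / real k - b / (real k)\<^sup>2 = 1 - 2 * e * t - real N * (4 * e * K * D)"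
      using kp by (simp add: ek a_def b_def D_def field_simps power2_eq_square)
    also have "\<dots> \<le> nrm2 m c - 2 * e * (\<Sum>v\<leftarrow>vs. (ip m v c)\<^sup>2) - real (length vs) * (4 * e * K * D)"
    proof -
      have "2 * e * (\<Sum>v\<leftarrow>vs. (ip m v c)\<^sup>2) \<le> 2 * e * t"
        using le eK by (intro mult_left_mono) auto
      moreover have "real (length vs) * (4 * e * K * D) \<le> real N * (4 * e * K * D)"
        using len eK assms by (intro mult_right_mono) (auto simp: D_def)
      ultimately show ?thesis using c by simp
    qed
    also have "\<dots> \<le> qform m (cprod m e vs) c"
      using vK eK c len assms
      by (intro qform_cprod_ge) (auto simp: D_def nrm2_def intro!: mult_right_mono)
    finally have q: "1 - a / real k - b / (real k)\<^sup>2 \<le> qform m (cprod m e vs) c" .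
    have "exp (- \<theta> * t) / 2 \<le> (1 - a / real k - b / (real k)\<^sup>2) ^ k"
      using k by (simp add: a_def)
    also have "\<dots> \<le> qform m (cprod m e vs) c ^ k"
      using q k by (intro power_mono) auto
    also have "\<dots> \<le> qform m (msq m j (cprod m e vs)) c"
      unfolding k_def using q k c by (intro qform_msq_ge) auto
    also have "\<dots> \<le> mtr m (msq m j (cprod m e vs))"
      unfolding j_def msq.simps using c by (intro qform_le_mtr) (auto simp: mtp_msq)
    finally show "exp (- \<theta> * t) / 2 \<le> mtr m (msq m j (cprod m (\<theta> / 2 ^ Suc j) vs))"
      by (simp add: e_def)
  qed
qed

section \<open>Determinants of Gram matrices\<close>

definition gram_mat :: "nat \<Rightarrow> nat \<Rightarrow> (nat \<Rightarrow> nat \<Rightarrow> real) \<Rightarrow> real mat" where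
  "gram_mat k n a = mat k k (\<lambda>(p, q). \<Sum>i<n. a i p * a i q)"

definition row_sel :: "nat \<Rightarrow> (nat \<Rightarrow> nat \<Rightarrow> real) \<Rightarrow> (nat \<Rightarrow> nat) \<Rightarrow> real mat" where
  "row_sel k a \<iota> = mat k k (\<lambda>(p, q). a (\<iota> p) q)"

lemma gram_mat_carrier [simp]: "gram_mat k n a \<in> carrier_mat k k"
  by (simp add: gram_mat_def)

lemma row_sel_carrier [simp]: "row_sel k a \<iota> \<in> carrier_mat k k"
  by (simp add: row_sel_def)

lemma det_row_sel:
  "det (row_sel k a \<iota>) = (\<Sum>\<sigma> | \<sigma> permutes {0..<k}. signof \<sigma> * (\<Prod>i=0..<k. a (\<iota> i) (\<sigma> i)))"
  unfolding det_def'[OF row_sel_carrier]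
proof (intro sum.cong refl arg_cong2[of _ _ _ _ "(*)"] prod.cong)
  fix \<sigma> i assume "\<sigma> \<in> {\<sigma>. \<sigma> permutes {0..<k}}" "i \<in> {0..<k}"
  then show "row_sel k a \<iota> $$ (i, \<sigma> i) = a (\<iota> i) (\<sigma> i)"
    using permutes_in_image[of \<sigma> "{0..<k}" i] by (simp add: row_sel_def)
qed

lemma det_row_sel_transpose:
  "det (row_sel k a \<iota>) = (\<Sum>\<sigma> | \<sigma> permutes {0..<k}. signof \<sigma> * (\<Prod>i=0..<k. a (\<iota> (\<sigma> i)) i))"
proof -
  have "det (row_sel k a \<iota>) = det (transpose_mat (row_sel k a \<iota>))"
    by (simp add: det_transpose[OF row_sel_carrier])
  also have "\<dots> = (\<Sum>\<sigma> | \<sigma> permutes {0..<k}. signof \<sigma> * (\<Prod>i=0..<k. transpose_mat (row_sel k a \<iota>) $$ (i, \<sigma> i)))"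
    by (rule det_def') simp
  also have "\<dots> = (\<Sum>\<sigma> | \<sigma> permutes {0..<k}. signof \<sigma> * (\<Prod>i=0..<k. a (\<iota> (\<sigma> i)) i))"
  proof (intro sum.cong refl arg_cong2[of _ _ _ _ "(*)"] prod.cong)
    fix \<sigma> i assume "\<sigma> \<in> {\<sigma>. \<sigma> permutes {0..<k}}" "i \<in> {0..<k}"
    then show "transpose_mat (row_sel k a \<iota>) $$ (i, \<sigma> i) = a (\<iota> (\<sigma> i)) i"
      using permutes_in_image[of \<sigma> "{0..<k}" i] by (simp add: row_sel_def)
  qed
  finally show ?thesis .
qed

lemma det_row_sel_permute:
  assumes "\<tau> permutes {0..<k}" and "\<And>i. i < k \<Longrightarrow> \<kappa> i = \<iota> (\<tau> i)"
  shows "det (row_sel k a \<kappa>) = signof \<tau> * det (row_sel k a \<iota>)"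
proof -
  have "row_sel k a \<kappa> = mat k k (\<lambda>(i, j). row_sel k a \<iota> $$ (\<tau> i, j))"
    using assms permutes_in_image[OF assms(1)] by (intro eq_matI) (auto simp: row_sel_def)
  then show ?thesis
    using det_permute_rows[OF row_sel_carrier assms(1), of a \<iota>] by simp
qed

lemma det_row_sel_not_inj:
  assumes "\<not> inj_on \<iota> {0..<k}"
  shows "det (row_sel k a \<iota>) = 0"
proof -
  obtain i j where ij: "i < k" "j < k" "i \<noteq> j" "\<iota> i = \<iota> j"
    using assms by (auto simp: inj_on_def)
  then show ?thesis
    by (intro det_identical_rows[OF row_sel_carrier, of i j]) (auto simp: row_sel_def)
qed

text \<open>The sum runs over all index functions instead of subsets: non-injective ones contribute
  0 and each k-subset is counted k! times. This form can be integrated term by term.\<close>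

theorem cauchy_binet:
  "det (gram_mat k n a) = (\<Sum>\<iota>\<in>{0..<k} \<rightarrow>\<^sub>E {0..<n}. (det (row_sel k a \<iota>))\<^sup>2) / fact k"
proof -
  define I where "I = {0..<k} \<rightarrow>\<^sub>E {0..<n}"
  define Perm where "Perm = {\<sigma>. \<sigma> permutes {0..<k}}"
  \<comment> \<open>Multilinear expansion: \<iota> picks one summand in each row.\<close>
  have "det (gram_mat k n a) = (\<Sum>\<sigma>\<in>Perm. signof \<sigma> * (\<Prod>i=0..<k. \<Sum>l\<in>{0..<n}. a l i * a l (\<sigma> i)))"
    unfolding det_def'[OF gram_mat_carrier] Perm_def
  proof (intro sum.cong refl arg_cong2[of _ _ _ _ "(*)"] prod.cong)
    fix \<sigma> i assume "\<sigma> \<in> {\<sigma>. \<sigma> permutes {0..<k}}" "i \<in> {0..<k}"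
    then show "gram_mat k n a $$ (i, \<sigma> i) = (\<Sum>l\<in>{0..<n}. a l i * a l (\<sigma> i))"
      using permutes_in_image[of \<sigma> "{0..<k}" i] by (simp add: gram_mat_def lessThan_atLeast0)
  qed
  also have "\<dots> = (\<Sum>\<sigma>\<in>Perm. \<Sum>\<iota>\<in>I. signof \<sigma> * ((\<Prod>i=0..<k. a (\<iota> i) i) * (\<Prod>i=0..<k. a (\<iota> i) (\<sigma> i))))"
    unfolding I_def by (subst prod_sum_PiE) (auto simp: sum_distrib_left prod.distrib)
  also have "\<dots> = (\<Sum>\<iota>\<in>I. (\<Prod>i=0..<k. a (\<iota> i) i) * det (row_sel k a \<iota>))"
    by (subst sum.swap) (simp add: det_row_sel Perm_def sum_distrib_left mult_ac)
  finally have det_eq: "det (gram_mat k n a) = (\<Sum>\<iota>\<in>I. (\<Prod>i=0..<k. a (\<iota> i) i) * det (row_sel k a \<iota>))" .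
  \<comment> \<open>Renaming the selection by \<tau> changes its determinant only by a sign; summing
    over all \<tau> rebuilds the second determinant of the square.\<close>
  have sym: "det (gram_mat k n a) = (\<Sum>\<iota>\<in>I. (\<Prod>i=0..<k. a (\<iota> (\<tau> i)) i) * (signof \<tau> * det (row_sel k a \<iota>)))"
    if "\<tau> \<in> Perm" for \<tau>
  proof -
    have \<tau>: "\<tau> permutes {0..<k}" using that by (simp add: Perm_def)
    define \<tau>' where "\<tau>' = inv_into UNIV \<tau>"
    have \<tau>': "\<tau>' permutes {0..<k}" and \<tau>inv: "\<tau> (\<tau>' i) = i" "\<tau>' (\<tau> i) = i" for i
      using permutes_inv[OF \<tau>] permutes_inverses[OF \<tau>] by (simp_all add: \<tau>'_def)
    have \<tau>in: "\<tau> i < k" "\<tau>' i < k" if "i < k" for i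
      using permutes_in_image[OF \<tau>, of i] permutes_in_image[OF \<tau>', of i] that by auto
    have "(\<Sum>\<iota>\<in>I. (\<Prod>i=0..<k. a (\<iota> i) i) * det (row_sel k a \<iota>))
      = (\<Sum>\<iota>\<in>I. (\<Prod>i=0..<k. a (\<iota> (\<tau> i)) i) * (signof \<tau> * det (row_sel k a \<iota>)))"
    proof (rule sum.reindex_bij_witness[where j="\<lambda>\<iota>. restrict (\<lambda>i. \<iota> (\<tau>' i)) {0..<k}"
            and i="\<lambda>\<iota>. restrict (\<lambda>i. \<iota> (\<tau> i)) {0..<k}"])
      fix \<iota> assume \<iota>: "\<iota> \<in> I"
      show "restrict (\<lambda>i. restrict (\<lambda>i. \<iota> (\<tau>' i)) {0..<k} (\<tau> i)) {0..<k} = \<iota>"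
        using \<iota> \<tau>in \<tau>inv by (intro ext) (auto simp: I_def restrict_def PiE_def extensional_def)
      show "restrict (\<lambda>i. restrict (\<lambda>i. \<iota> (\<tau> i)) {0..<k} (\<tau>' i)) {0..<k} = \<iota>"
        using \<iota> \<tau>in \<tau>inv by (intro ext) (auto simp: I_def restrict_def PiE_def extensional_def)
      show "restrict (\<lambda>i. \<iota> (\<tau> i)) {0..<k} \<in> I" "restrict (\<lambda>i. \<iota> (\<tau>' i)) {0..<k} \<in> I"
        using \<iota> \<tau>in by (auto simp: I_def PiE_def Pi_def)
      have "det (row_sel k a \<iota>) = signof \<tau> * det (row_sel k a (restrict (\<lambda>i. \<iota> (\<tau>' i)) {0..<k}))"
        using \<tau>in \<tau>inv by (intro det_row_sel_permute[OF \<tau>]) auto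
      then show "(\<Prod>i=0..<k. a (restrict (\<lambda>i. \<iota> (\<tau>' i)) {0..<k} (\<tau> i)) i) *
          (signof \<tau> * det (row_sel k a (restrict (\<lambda>i. \<iota> (\<tau>' i)) {0..<k})))
        = (\<Prod>i=0..<k. a (\<iota> i) i) * det (row_sel k a \<iota>)"
        using \<tau>in \<tau>inv by simp
    qed
    then show ?thesis by (simp add: det_eq)
  qed
  have "fact k * det (gram_mat k n a) = (\<Sum>\<tau>\<in>Perm. det (gram_mat k n a))"
    by (simp add: Perm_def card_permutations[of _ k])
  also have "\<dots> = (\<Sum>\<tau>\<in>Perm. \<Sum>\<iota>\<in>I. (\<Prod>i=0..<k. a (\<iota> (\<tau> i)) i) * (signof \<tau> * det (row_sel k a \<iota>)))"
    using sym by (intro sum.cong) auto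
  also have "\<dots> = (\<Sum>\<iota>\<in>I. det (row_sel k a \<iota>) * (\<Sum>\<tau>\<in>Perm. signof \<tau> * (\<Prod>i=0..<k. a (\<iota> (\<tau> i)) i)))"
    by (subst sum.swap) (simp add: sum_distrib_left mult_ac)
  also have "\<dots> = (\<Sum>\<iota>\<in>I. (det (row_sel k a \<iota>))\<^sup>2)"
    unfolding Perm_def det_row_sel_transpose[symmetric] by (simp add: power2_eq_square)
  finally show ?thesis by (simp add: I_def field_simps)
qed

section \<open>The adjugate bound and the smallest eigenvalue\<close>

abbreviation mat_qf :: "nat \<Rightarrow> real mat \<Rightarrow> (nat \<Rightarrow> real) \<Rightarrow> real" where
  "mat_qf m A \<equiv> qform m (\<lambda>i j. A $$ (i, j))"

definition bform :: "nat \<Rightarrow> fmat \<Rightarrow> (nat \<Rightarrow> real) \<Rightarrow> (nat \<Rightarrow> real) \<Rightarrow> real" where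
  "bform m A b c = (\<Sum>i<m. \<Sum>j<m. b i * A i j * c j)"

text \<open>The quadratic polynomial in s given by the form at c + s b is nonnegative. The form is
  only semidefinite, so its value at b may be 0; then the polynomial is affine and the mixed term
  has to vanish.\<close>

lemma bform_cs:
  assumes sym: "\<And>i j. i < m \<Longrightarrow> j < m \<Longrightarrow> A i j = A j i" and psd: "\<And>c. 0 \<le> qform m A c"
  shows "(bform m A b c)\<^sup>2 \<le> bform m A b b * bform m A c c"
proof -
  define \<beta> where "\<beta> = bform m A b c"
  define x where "x = bform m A c c"
  define y where "y = bform m A b b"
  have "bform m A c b = (\<Sum>j<m. \<Sum>i<m. c i * A i j * b j)"
    unfolding bform_def by (rule sum.swap)
  also have "\<dots> = \<beta>"
    unfolding \<beta>_def bform_def using sym by (intro sum.cong refl) auto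
  finally have cb: "bform m A c b = \<beta>" .
  have nn: "0 \<le> x + 2 * s * \<beta> + s\<^sup>2 * y" for s
  proof -
    have "qform m A (\<lambda>i. c i + s * b i) = x + s * bform m A c b + s * \<beta> + s\<^sup>2 * y"
      unfolding qform_def bform_def x_def y_def \<beta>_def
      by (simp add: algebra_simps sum.distrib sum_distrib_left power2_eq_square)
    then show ?thesis using psd[of "\<lambda>i. c i + s * b i"] cb by (simp add: algebra_simps)
  qed
  have y0: "0 \<le> y" using psd[of b] by (simp add: y_def bform_def qform_def)
  show ?thesis
  proof (cases "y = 0")
    case True
    have "\<beta> = 0"
    proof (rule ccontr)
      assume "\<beta> \<noteq> 0"
      then show False using nn[of "- (x + 1) / (2 * \<beta>)"] True by (simp add: field_simps)
    qed
    then show ?thesis using True by (simp add: \<beta>_def y_def)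
  next
    case False
    have "0 \<le> (x + 2 * (- \<beta> / y) * \<beta> + (- \<beta> / y)\<^sup>2 * y) * y"
      using nn[of "- \<beta> / y"] y0 by simp
    also have "\<dots> = x * y - \<beta>\<^sup>2"
      using False by (simp add: field_simps power2_eq_square)
    finally show ?thesis by (simp add: x_def y_def \<beta>_def mult.commute)
  qed
qed

text \<open>
  The \<open>j\<close>-th row \<open>b\<close> of the adjugate satisfies \<open>b\<^sup>T A = det A e\<^sub>j\<^sup>T\<close>; apply Cauchy--Schwarz for the form \<open>A\<close> to
  \<open>b\<^sup>T A c\<close>.
\<close>

lemma adjugate_qform_bound:
  assumes A: "A \<in> carrier_mat m m" and sym: "\<And>i j. i < m \<Longrightarrow> j < m \<Longrightarrow> A $$ (i, j) = A $$ (j, i)"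
    and psd: "\<And>c. 0 \<le> mat_qf m A c" and j: "j < m"
  shows "(c j)\<^sup>2 * (det A)\<^sup>2 \<le> mat_qf m A c * det A * det (mat_delete A j j)"
proof -
  define a where "a = (\<lambda>i j. A $$ (i, j))"
  define b where "b k = adj_mat A $$ (j, k)" for k
  have bj: "b j = det (mat_delete A j j)"
    using A j by (simp add: b_def adj_mat_def cofactor_def)
  have ba: "(\<Sum>k<m. b k * a k l) = (if l = j then det A else 0)" if "l < m" for l
  proof -
    have "(\<Sum>k<m. b k * a k l) = (adj_mat A * A) $$ (j, l)"
      using A adj_mat(1)[OF A] j that
      by (simp add: scalar_prod_def b_def a_def lessThan_atLeast0)
    then show ?thesis using adj_mat(3)[OF A] j that by simp
  qed
  have bf: "bform m a b d = det A * d j" for d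
  proof -
    have "bform m a b d = (\<Sum>l<m. (\<Sum>k<m. b k * a k l) * d l)"
      unfolding bform_def sum_distrib_right by (rule sum.swap)
    also have "\<dots> = (\<Sum>l<m. if l = j then det A * d l else 0)"
      by (intro sum.cong) (auto simp: ba)
    finally show ?thesis using j by simp
  qed
  have "(bform m a b c)\<^sup>2 \<le> bform m a b b * bform m a c c"
    using sym psd by (intro bform_cs) (auto simp: a_def)
  moreover have "bform m a c c = mat_qf m A c"
    by (simp add: bform_def qform_def a_def)
  ultimately show ?thesis
    by (simp add: bf bj power_mult_distrib mult_ac)
qed

text \<open>Summing over \<open>j\<close> turns the principal minors into the trace of the adjugate.
  The determinant stays on both sides, so singular matrices are included.\<close>

lemma nrm2_det_bound:
  assumes A: "A \<in> carrier_mat m m" and sym: "\<And>i j. i < m \<Longrightarrow> j < m \<Longrightarrow> A $$ (i, j) = A $$ (j, i)"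
    and psd: "\<And>c. 0 \<le> mat_qf m A c"
  shows "nrm2 m c * (det A)\<^sup>2 \<le> mat_qf m A c * det A * (\<Sum>j<m. det (mat_delete A j j))"
  unfolding nrm2_def sum_distrib_left sum_distrib_right
  using adjugate_qform_bound[OF assms] by (intro sum_mono) auto

lemma qform_ge_of_unit:
  assumes "\<And>c. nrm2 m c = 1 \<Longrightarrow> l \<le> b * qform m A c"
  shows "l * nrm2 m c \<le> b * qform m A c"
proof (cases "nrm2 m c = 0")
  case True
  then have "c i = 0" if "i < m" for i
    using that by (simp add: nrm2_def sum_nonneg_eq_0_iff)
  then show ?thesis using True by (simp add: qform_def)
next
  case False
  define s where "s = sqrt (nrm2 m c)"
  have s: "s\<^sup>2 = nrm2 m c" "s \<noteq> 0" using False by (auto simp: s_def)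
  have "nrm2 m (\<lambda>i. c i / s) = nrm2 m c / s\<^sup>2"
    by (simp add: nrm2_def power_divide sum_divide_distrib)
  then have "l \<le> b * qform m A (\<lambda>i. c i / s)" using s False by (intro assms) simp
  also have "qform m A (\<lambda>i. c i / s) = qform m A c / s\<^sup>2"
    by (simp add: qform_def sum_divide_distrib power2_eq_square)
  finally show ?thesis using s False nrm2_nonneg[of m c] by (simp add: field_simps)
qed

text \<open>\<open>l\<close> is the infimum of the Rayleigh quotient, and no compactness is used: if
  A - l I were invertible, \<open>nrm2_det_bound\<close> for this semidefinite matrix would keep the
  quotient a fixed distance above \<open>l\<close>.\<close>

lemma symmetric_min_eigenvalue:
  assumes m: "0 < m" and A: "(A :: real mat) \<in> carrier_mat m m"
    and sym: "\<And>i j. i < m \<Longrightarrow> j < m \<Longrightarrow> A $$ (i, j) = A $$ (j, i)"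
  obtains l where "eigenvalue A l" "\<And>c. l * nrm2 m c \<le> mat_qf m A c"
proof -
  define R where "R = mat_qf m A ` {c. nrm2 m c = 1}"
  define l where "l = Inf R"
  have ne: "R \<noteq> {}"
  proof -
    have "nrm2 m (\<lambda>i. if i = 0 then 1 else 0) = (\<Sum>i<m. if i = 0 then 1 else 0)"
      unfolding nrm2_def by (intro sum.cong) auto
    then have "nrm2 m (\<lambda>i. if i = 0 then 1 else 0) = 1" using m by simp
    then show ?thesis unfolding R_def by blast
  qed
  have bdd: "bdd_below R"
  proof (rule bdd_belowI)
    fix x assume "x \<in> R"
    then obtain c where c: "nrm2 m c = 1" "x = mat_qf m A c" by (auto simp: R_def)
    have c1: "\<bar>c i\<bar> \<le> 1" if "i < m" for i
    proof -
      have "(c i)\<^sup>2 \<le> nrm2 m c"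
        unfolding nrm2_def using that by (intro member_le_sum) auto
      then show ?thesis using c by (simp add: abs_square_le_1)
    qed
    have "\<bar>x\<bar> \<le> (\<Sum>i<m. \<Sum>j<m. \<bar>c i * A $$ (i, j) * c j\<bar>)"
      unfolding c qform_def by (intro order_trans[OF sum_abs] sum_mono sum_abs)
    also have "\<dots> \<le> (\<Sum>i<m. \<Sum>j<m. \<bar>A $$ (i, j)\<bar>)"
    proof (intro sum_mono)
      fix i j assume "i \<in> {..<m}" "j \<in> {..<m}"
      then have "\<bar>c i\<bar> * \<bar>A $$ (i, j)\<bar> * \<bar>c j\<bar> \<le> 1 * \<bar>A $$ (i, j)\<bar> * 1"
        using c1 by (intro mult_mono) auto
      then show "\<bar>c i * A $$ (i, j) * c j\<bar> \<le> \<bar>A $$ (i, j)\<bar>" by (simp add: abs_mult)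
    qed
    finally show "- (\<Sum>i<m. \<Sum>j<m. \<bar>A $$ (i, j)\<bar>) \<le> x" by simp
  qed
  have unit: "l \<le> mat_qf m A c" if "nrm2 m c = 1" for c
    unfolding l_def using that bdd by (intro cInf_lower) (auto simp: R_def)
  have low: "l * nrm2 m c \<le> mat_qf m A c" for c
    using qform_ge_of_unit[of m l 1 "\<lambda>i j. A $$ (i, j)" c] unit by simp
  have "eigenvalue A l"
  proof (rule ccontr)
    assume "\<not> eigenvalue A l"
    define M where "M = char_matrix A l"
    have dM: "det M \<noteq> 0" using \<open>\<not> eigenvalue A l\<close> eigenvalue_det[OF A] by (simp add: M_def)
    have M: "M \<in> carrier_mat m m" using A by (simp add: M_def)
    have Me: "M $$ (i, j) = A $$ (i, j) - (if i = j then l else 0)" if "i < m" "j < m" for i j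
      using that A by (auto simp: M_def char_matrix_def)
    have qM: "mat_qf m M c = mat_qf m A c - l * nrm2 m c" for c
    proof -
      have "mat_qf m M c = (\<Sum>i<m. \<Sum>j<m. c i * A $$ (i, j) * c j - (if j = i then l * (c i)\<^sup>2 else 0))"
        unfolding qform_def by (intro sum.cong refl) (auto simp: Me algebra_simps power2_eq_square)
      then show ?thesis
        by (simp add: sum_subtractf qform_def nrm2_def sum_distrib_left)
    qed
    define C where "C = det M * (\<Sum>j<m. det (mat_delete M j j))"
    have bnd: "(det M)\<^sup>2 \<le> (mat_qf m A c - l) * C" if "nrm2 m c = 1" for c
      using nrm2_det_bound[OF M, of c] that sym low by (simp add: Me qM C_def mult.assoc)
    obtain c0 where c0: "nrm2 m c0 = 1" using ne by (auto simp: R_def)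
    have "0 < (mat_qf m A c0 - l) * C" using bnd[OF c0] dM by (meson less_le_trans zero_less_power2)
    then have C: "0 < C" using unit[OF c0] by (simp add: zero_less_mult_iff)
    have "l + (det M)\<^sup>2 / C \<le> Inf R"
      using ne bnd C by (intro cInf_greatest) (auto simp: R_def field_simps)
    then show False using dM C by (simp add: l_def field_simps)
  qed
  with low show thesis by (rule that[rotated])
qed

text \<open>The eigenvalues are the roots of a nonzero polynomial, so \<open>Min\<close> is taken
  over a finite set and lies below the eigenvalue that bounds the form.\<close>

lemma lambda_min_le_qform:
  assumes m: "0 < m" and A: "(A :: real mat) \<in> carrier_mat m m"
    and sym: "\<And>i j. i < m \<Longrightarrow> j < m \<Longrightarrow> A $$ (i, j) = A $$ (j, i)"
  shows "lambda_min A * nrm2 m c \<le> mat_qf m A c"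
proof -
  obtain l where l: "eigenvalue A l" "\<And>c. l * nrm2 m c \<le> mat_qf m A c"
    using symmetric_min_eigenvalue[OF assms] by blast
  have "char_poly A \<noteq> 0"
    using degree_monic_char_poly[OF A] m by auto
  then have "finite {k. eigenvalue A k}"
    using poly_roots_finite[of "char_poly A"] by (simp add: eigenvalue_root_char_poly[OF A])
  then have "lambda_min A \<le> l"
    unfolding lambda_min_def using l by (intro Min_le) auto
  then have "lambda_min A * nrm2 m c \<le> l * nrm2 m c"
    by (simp add: mult_right_mono)
  with l(2)[of c] show ?thesis by linarith
qed

section \<open>Expectation of the potential\<close>

lemma integral_double_sum:
  fixes F :: "'b \<Rightarrow> 'c \<Rightarrow> 'a \<Rightarrow> real"
  assumes "\<And>i j. i \<in> A \<Longrightarrow> j \<in> B \<Longrightarrow> integrable M (F i j)"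
  shows "integrable M (\<lambda>x. \<Sum>i\<in>A. \<Sum>j\<in>B. c i j * F i j x)"
    "(\<integral>x. (\<Sum>i\<in>A. \<Sum>j\<in>B. c i j * F i j x) \<partial>M) = (\<Sum>i\<in>A. \<Sum>j\<in>B. c i j * (\<integral>x. F i j x \<partial>M))"
proof -
  have 1: "integrable M (\<lambda>x. c i j * F i j x)" if "i \<in> A" "j \<in> B" for i j
    using assms[OF that] by (rule integrable_mult_right)
  have 2: "integrable M (\<lambda>x. \<Sum>j\<in>B. c i j * F i j x)" if "i \<in> A" for i
    using 1 that by (intro Bochner_Integration.integrable_sum)
  show "integrable M (\<lambda>x. \<Sum>i\<in>A. \<Sum>j\<in>B. c i j * F i j x)"
    by (rule Bochner_Integration.integrable_sum) (rule 2)
  have "(\<integral>x. (\<Sum>i\<in>A. \<Sum>j\<in>B. c i j * F i j x) \<partial>M) = (\<Sum>i\<in>A. \<integral>x. (\<Sum>j\<in>B. c i j * F i j x) \<partial>M)"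
    using 2 by (intro Bochner_Integration.integral_sum)
  also have "\<dots> = (\<Sum>i\<in>A. \<Sum>j\<in>B. \<integral>x. c i j * F i j x \<partial>M)"
    using 1 by (intro sum.cong refl Bochner_Integration.integral_sum)
  finally show "(\<integral>x. (\<Sum>i\<in>A. \<Sum>j\<in>B. c i j * F i j x) \<partial>M) = (\<Sum>i\<in>A. \<Sum>j\<in>B. c i j * (\<integral>x. F i j x \<partial>M))"
    by simp
qed

text \<open>The second-moment matrix of the random vector \<open>v\<close> is the identity;
  \<open>K\<close> will be m / \<alpha>.\<close>

locale isotropic = prob_space \<nu>
  for \<nu> :: "'a measure" +
  fixes v :: "'a \<Rightarrow> nat \<Rightarrow> real" and m :: nat and K :: real
  assumes v_measurable: "i < m \<Longrightarrow> (\<lambda>x. v x i) \<in> borel_measurable \<nu>"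
    and v_integrable: "i < m \<Longrightarrow> j < m \<Longrightarrow> integrable \<nu> (\<lambda>x. v x i * v x j)"
    and v_integral: "i < m \<Longrightarrow> j < m \<Longrightarrow> (\<integral>x. v x i * v x j \<partial>\<nu>) = (if i = j then 1 else 0)"
    and K_pos: "0 < K"
    and v_bound: "nrm2 m (v x) \<le> K"
begin

lemma \<nu>_space [simp]: "measure \<nu> (space \<nu>) = 1" "emeasure \<nu> (space \<nu>) = 1"
  by (rule prob_space, rule emeasure_space_1)

sublocale product_prob_space "\<lambda>_ :: nat. \<nu>" UNIV
  by unfold_locales

lemma measurable_v_component:
  assumes "a < m" "i \<in> I"
  shows "(\<lambda>x. v (x i) a) \<in> borel_measurable (PiM I (\<lambda>_. \<nu>))"
  using measurable_compose[OF measurable_component_singleton[OF assms(2), of "\<lambda>_. \<nu>"] v_measurable[OF assms(1)]] .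

lemma measurable_mmul:
  assumes "\<And>a b. (\<lambda>x. A x a b) \<in> borel_measurable M" "\<And>a b. (\<lambda>x. B x a b) \<in> borel_measurable M"
  shows "(\<lambda>x. mmul m (A x) (B x) a b) \<in> borel_measurable M"
  using assms unfolding mmul_def by measurable

lemma measurable_rk1:
  assumes "i \<in> I"
  shows "(\<lambda>x. rk1 m (v (x i)) s a b) \<in> borel_measurable (PiM I (\<lambda>_. \<nu>))"
proof (cases "a < m \<and> b < m")
  case True
  then have [measurable]: "(\<lambda>x. v (x i) a) \<in> borel_measurable (PiM I (\<lambda>_. \<nu>))"
     "(\<lambda>x. v (x i) b) \<in> borel_measurable (PiM I (\<lambda>_. \<nu>))"
    using assms by (auto intro: measurable_v_component)
  show ?thesis using True unfolding rk1_def by simp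
next
  case False
  have "(\<lambda>x. rk1 m (v (x i)) s a b) = (\<lambda>x. 0)"
    using False by (auto simp: rk1_def)
  then show ?thesis by simp
qed

lemma measurable_cprod:
  assumes "set xs \<subseteq> I"
  shows "(\<lambda>x. cprod m e (map (\<lambda>i. v (x i)) xs) a b) \<in> borel_measurable (PiM I (\<lambda>_. \<nu>))"
  using assms
proof (induction xs arbitrary: a b)
  case Nil
  then show ?case by simp
next
  case (Cons i xs)
  then show ?case
    by (auto intro!: measurable_mmul measurable_rk1)
qed

lemma measurable_msq:
  assumes "\<And>a b. (\<lambda>x. A x a b) \<in> borel_measurable M"
  shows "(\<lambda>x. msq m j (A x) a b) \<in> borel_measurable M"
  using assms by (induction j arbitrary: a b) (auto intro!: measurable_mmul)

lemma measurable_potential: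
  assumes "set xs \<subseteq> I"
  shows "(\<lambda>x. mtr m (msq m j (cprod m e (map (\<lambda>i. v (x i)) xs)))) \<in> borel_measurable (PiM I (\<lambda>_. \<nu>))"
  unfolding mtr_def using measurable_cprod[OF assms]
  by (intro borel_measurable_sum measurable_msq)

lemma integral_qform:
  "integrable \<nu> (\<lambda>y. qform m Q (v y))" "(\<integral>y. qform m Q (v y) \<partial>\<nu>) = mtr m Q"
proof -
  have eq: "qform m Q (v y) = (\<Sum>i<m. \<Sum>j<m. Q i j * (v y i * v y j))" for y
    by (simp add: qform_def mult_ac)
  show "integrable \<nu> (\<lambda>y. qform m Q (v y))"
    unfolding eq using v_integrable by (intro integral_double_sum) auto
  have "(\<integral>y. qform m Q (v y) \<partial>\<nu>) = (\<Sum>i<m. \<Sum>j<m. Q i j * (\<integral>y. v y i * v y j \<partial>\<nu>))"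
    unfolding eq using v_integrable by (intro integral_double_sum) auto
  also have "\<dots> = (\<Sum>i<m. \<Sum>j<m. if j = i then Q i i else 0)"
    by (intro sum.cong refl) (auto simp: v_integral)
  finally show "(\<integral>y. qform m Q (v y) \<partial>\<nu>) = mtr m Q"
    by (simp add: mtr_def)
qed

text \<open>One point is integrated out per step: by \<open>mtr_cprod_Cons_le\<close> and isotropy
  this multiplies the trace by at most 1 - \<kappa> <= exp (- \<kappa>). The weight \<open>G\<close>
  does not see the points of \<open>xs\<close> and passes through; the empty list leaves tr I =
  m.\<close>

lemma nn_integral_potential_le:
  fixes G :: "(nat \<Rightarrow> 'a) \<Rightarrow> ennreal"
  assumes "finite I" "distinct xs" "set xs \<subseteq> I"
    and "G \<in> borel_measurable (PiM I (\<lambda>_. \<nu>))"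
    and indep: "\<And>x y. (\<And>i. i \<notin> set xs \<Longrightarrow> x i = y i) \<Longrightarrow> G x = G y"
    and j: "0 < j" and th: "0 < \<theta>" "\<theta> * K \<le> 2 ^ Suc j"
  defines "e \<equiv> \<theta> / 2 ^ Suc j" and "\<kappa> \<equiv> (1 - exp (- \<theta> * K)) / K"
  shows "(\<integral>\<^sup>+x. G x * ennreal (mtr m (msq m j (cprod m e (map (\<lambda>i. v (x i)) xs)))) \<partial>PiM I (\<lambda>_. \<nu>))
    \<le> ennreal (real m * exp (- \<kappa>) ^ length xs) * (\<integral>\<^sup>+x. G x \<partial>PiM I (\<lambda>_. \<nu>))"
  using assms(2-5)
proof (induction xs)
  case Nil
  have "mtr m (msq m j (cprod m e [])) = real m" by (rule mtr_cprod_Nil)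
  then show ?case using Nil(3) by (simp add: nn_integral_multc mult.commute del: cprod.simps)
next
  case (Cons i xs)
  define J where "J = I - {i}"
  have I: "I = insert i J" "finite J" "i \<notin> J" using Cons.prems(2) assms(1) by (auto simp: J_def)
  have xsJ: "set xs \<subseteq> J" "set xs \<subseteq> I" "i \<notin> set xs" using Cons.prems(1,2) by (auto simp: J_def)
  define Q where "Q x = msq m j (cprod m e (map (\<lambda>l. v (x l)) xs))" for x
  have Qupd: "Q (x(i := y)) = Q x" for x y
    unfolding Q_def using xsJ(3) by (intro arg_cong[of _ _ "\<lambda>l. msq m j (cprod m e l)"] map_cong) auto
  have Gupd: "G (x(i := y)) = G x" for x y
    by (rule Cons.prems(4)) auto
  have Q0: "0 \<le> mtr m (Q x)" for x
    unfolding Q_def using j by (rule mtr_msq_cprod_nonneg)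
  have inner: "(\<integral>\<^sup>+y. ennreal (mtr m (msq m j (cprod m e (v y # map (\<lambda>l. v (x l)) xs)))) \<partial>\<nu>)
      \<le> ennreal (exp (- \<kappa>) * mtr m (Q x))" for x
  proof -
    have le: "mtr m (msq m j (cprod m e (v y # map (\<lambda>l. v (x l)) xs)))
        \<le> mtr m (Q x) - \<kappa> * qform m (Q x) (v y)" for y
      unfolding Q_def e_def \<kappa>_def using j K_pos v_bound th by (rule mtr_cprod_Cons_le)
    have "(\<integral>\<^sup>+y. ennreal (mtr m (msq m j (cprod m e (v y # map (\<lambda>l. v (x l)) xs)))) \<partial>\<nu>)
      \<le> (\<integral>\<^sup>+y. ennreal (mtr m (Q x) - \<kappa> * qform m (Q x) (v y)) \<partial>\<nu>)"
      using le by (intro nn_integral_mono ennreal_leI)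
    \<comment> \<open>The integrand dominates the nonnegative trace, so both kinds of integral
      agree.\<close>
    also have "\<dots> = ennreal (\<integral>y. mtr m (Q x) - \<kappa> * qform m (Q x) (v y) \<partial>\<nu>)"
      using order_trans[OF mtr_msq_cprod_nonneg[OF j] le]
      by (intro nn_integral_eq_integral AE_I2) (auto simp: integral_qform)
    also have "(\<integral>y. mtr m (Q x) - \<kappa> * qform m (Q x) (v y) \<partial>\<nu>) = (1 - \<kappa>) * mtr m (Q x)"
      by (simp add: integral_qform algebra_simps)
    also have "ennreal \<dots> \<le> ennreal (exp (- \<kappa>) * mtr m (Q x))"
      using exp_ge_add_one_self[of "- \<kappa>"] Q0 by (intro ennreal_leI mult_right_mono) auto
    finally show ?thesis .
  qed
  define T where "T x = mtr m (msq m j (cprod m e (map (\<lambda>l. v (x l)) (i # xs))))" for x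
  have T_upd: "T (x(i := y)) = mtr m (msq m j (cprod m e (v y # map (\<lambda>l. v (x l)) xs)))" for x y
  proof -
    have "map (\<lambda>l. v ((x(i := y)) l)) (i # xs) = v y # map (\<lambda>l. v (x l)) xs"
      using xsJ(3) by auto
    then show ?thesis unfolding T_def by (rule arg_cong)
  qed
  have T_meas: "T \<in> borel_measurable (PiM I (\<lambda>_. \<nu>))"
    unfolding T_def by (rule measurable_potential[OF Cons.prems(2)])
  have Q_meas: "(\<lambda>x. mtr m (Q x)) \<in> borel_measurable (PiM I (\<lambda>_. \<nu>))"
    unfolding Q_def by (rule measurable_potential[OF xsJ(2)])
  note G_meas = Cons.prems(3)
  have GT: "(\<lambda>x. G x * ennreal (T x)) \<in> borel_measurable (PiM (insert i J) (\<lambda>_. \<nu>))"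
    and GQ: "(\<lambda>x. G x * ennreal (exp (- \<kappa>) * mtr m (Q x))) \<in> borel_measurable (PiM (insert i J) (\<lambda>_. \<nu>))"
    using G_meas T_meas Q_meas unfolding I(1)[symmetric] by measurable
  have "(\<integral>\<^sup>+x. G x * ennreal (T x) \<partial>PiM I (\<lambda>_. \<nu>))
      = (\<integral>\<^sup>+x. \<integral>\<^sup>+y. G (x(i := y)) * ennreal (T (x(i := y))) \<partial>\<nu> \<partial>PiM J (\<lambda>_. \<nu>))"
    unfolding I(1) by (rule product_nn_integral_insert[OF I(2,3) GT])
  also have "\<dots> \<le> (\<integral>\<^sup>+x. \<integral>\<^sup>+y. G (x(i := y)) * ennreal (exp (- \<kappa>) * mtr m (Q (x(i := y)))) \<partial>\<nu> \<partial>PiM J (\<lambda>_. \<nu>))"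
  proof (rule nn_integral_mono)
    fix x assume x: "x \<in> space (PiM J (\<lambda>_. \<nu>))"
    have "(\<lambda>y. x(i := y)) \<in> measurable \<nu> (PiM I (\<lambda>_. \<nu>))"
      unfolding I(1) using x I(3) by (rule measurable_component_update)
    then have m: "(\<lambda>y. T (x(i := y))) \<in> borel_measurable \<nu>"
      using T_meas by (rule measurable_compose)
    have "(\<integral>\<^sup>+y. G (x(i := y)) * ennreal (T (x(i := y))) \<partial>\<nu>) = G x * (\<integral>\<^sup>+y. ennreal (T (x(i := y))) \<partial>\<nu>)"
      unfolding Gupd using m by (intro nn_integral_cmult) measurable
    also have "\<dots> \<le> G x * ennreal (exp (- \<kappa>) * mtr m (Q x))"
      unfolding T_upd by (intro mult_left_mono inner) simp
    also have "\<dots> = (\<integral>\<^sup>+y. G (x(i := y)) * ennreal (exp (- \<kappa>) * mtr m (Q (x(i := y)))) \<partial>\<nu>)"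
      unfolding Gupd Qupd by simp
    finally show "(\<integral>\<^sup>+y. G (x(i := y)) * ennreal (T (x(i := y))) \<partial>\<nu>)
       \<le> (\<integral>\<^sup>+y. G (x(i := y)) * ennreal (exp (- \<kappa>) * mtr m (Q (x(i := y)))) \<partial>\<nu>)" .
  qed
  also have "\<dots> = (\<integral>\<^sup>+x. G x * ennreal (exp (- \<kappa>) * mtr m (Q x)) \<partial>PiM I (\<lambda>_. \<nu>))"
    unfolding I(1) by (rule product_nn_integral_insert[OF I(2,3) GQ, symmetric])
  also have "\<dots> = (\<integral>\<^sup>+x. ennreal (exp (- \<kappa>)) * (G x * ennreal (mtr m (Q x))) \<partial>PiM I (\<lambda>_. \<nu>))"
    using Q0 by (intro nn_integral_cong) (simp add: ennreal_mult mult.left_commute)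
  also have "\<dots> = ennreal (exp (- \<kappa>)) * (\<integral>\<^sup>+x. G x * ennreal (mtr m (Q x)) \<partial>PiM I (\<lambda>_. \<nu>))"
    using Q_meas G_meas
    by (intro nn_integral_cmult borel_measurable_times_ennreal measurable_compose[OF Q_meas measurable_ennreal])
  also have "\<dots> \<le> ennreal (exp (- \<kappa>)) * (ennreal (real m * exp (- \<kappa>) ^ length xs) * (\<integral>\<^sup>+x. G x \<partial>PiM I (\<lambda>_. \<nu>)))"
    unfolding Q_def
  proof (intro mult_left_mono Cons.IH)
    show "distinct xs" "set xs \<subseteq> I" using Cons.prems(1) xsJ by auto
    show "G x = G y" if "\<And>l. l \<notin> set xs \<Longrightarrow> x l = y l" for x y
      by (rule Cons.prems(4)) (use that in auto)
  qed (use Cons.prems(3) in auto)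
  also have "\<dots> = ennreal (real m * exp (- \<kappa>) ^ length (i # xs)) * (\<integral>\<^sup>+x. G x \<partial>PiM I (\<lambda>_. \<nu>))"
  proof -
    have "ennreal (real m * exp (- \<kappa>) ^ length (i # xs)) = ennreal (exp (- \<kappa>)) * ennreal (real m * exp (- \<kappa>) ^ length xs)"
      by (simp add: mult_ac flip: ennreal_mult)
    then show ?thesis by (simp add: mult.assoc)
  qed
  finally show ?case unfolding T_def .
qed

section \<open>Second moments of determinants with independent rows\<close>

lemma prod_reindex_inj:
  fixes F :: "nat \<Rightarrow> 'a \<Rightarrow> real" and \<iota> :: "nat \<Rightarrow> nat"
  assumes "inj_on \<iota> {0..<k}" "\<iota> ` {0..<k} \<subseteq> {..<n}"
  shows "(\<Prod>i=0..<k. F i (x (\<iota> i)))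
    = (\<Prod>l<n. (if l \<in> \<iota> ` {0..<k} then F (the_inv_into {0..<k} \<iota> l) else (\<lambda>_. 1)) (x l))"
proof -
  have "(\<Prod>i=0..<k. F i (x (\<iota> i))) = (\<Prod>l\<in>\<iota> ` {0..<k}. F (the_inv_into {0..<k} \<iota> l) (x l))"
    using assms by (simp add: prod.reindex the_inv_into_f_f)
  also have "\<dots> = (\<Prod>l<n. (if l \<in> \<iota> ` {0..<k} then F (the_inv_into {0..<k} \<iota> l) else (\<lambda>_. 1)) (x l))"
    using assms by (intro prod.mono_neutral_cong_left) auto
  finally show ?thesis .
qed

text \<open>Distinct points are independent. The product is padded with the constant 1 at the points
  outside the range of \<iota>, so that it factorizes over all \<open>n\<close> coordinates.\<close>

lemma integral_prod_inj:
  fixes F :: "nat \<Rightarrow> 'a \<Rightarrow> real" and \<iota> :: "nat \<Rightarrow> nat"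
  assumes \<iota>: "inj_on \<iota> {0..<k}" "\<iota> ` {0..<k} \<subseteq> {..<n}" and F: "\<And>i. i < k \<Longrightarrow> integrable \<nu> (F i)"
  shows "integrable (PiM {..<n} (\<lambda>_. \<nu>)) (\<lambda>x. \<Prod>i=0..<k. F i (x (\<iota> i)))"
    "(\<integral>x. (\<Prod>i=0..<k. F i (x (\<iota> i))) \<partial>PiM {..<n} (\<lambda>_. \<nu>)) = (\<Prod>i=0..<k. \<integral>y. F i y \<partial>\<nu>)"
proof -
  let ?G = "\<lambda>l. if l \<in> \<iota> ` {0..<k} then F (the_inv_into {0..<k} \<iota> l) else (\<lambda>_. 1)"
  have int: "integrable \<nu> (?G l)" for l
    using F the_inv_into_into[OF \<iota>(1), of l "{0..<k}"] by auto
  show "integrable (PiM {..<n} (\<lambda>_. \<nu>)) (\<lambda>x. \<Prod>i=0..<k. F i (x (\<iota> i)))"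
    unfolding prod_reindex_inj[OF \<iota>] by (intro product_integrable_prod int finite_lessThan)
  have "(\<integral>x. (\<Prod>i=0..<k. F i (x (\<iota> i))) \<partial>PiM {..<n} (\<lambda>_. \<nu>)) = (\<Prod>l<n. \<integral>y. ?G l y \<partial>\<nu>)"
    unfolding prod_reindex_inj[OF \<iota>] by (intro product_integral_prod int finite_lessThan)
  also have "\<dots> = (\<Prod>l\<in>\<iota> ` {0..<k}. \<integral>y. F (the_inv_into {0..<k} \<iota> l) y \<partial>\<nu>)"
    using \<iota> by (intro prod.mono_neutral_cong_right) auto
  also have "\<dots> = (\<Prod>i=0..<k. \<integral>y. F i y \<partial>\<nu>)"
    using \<iota> by (simp add: prod.reindex the_inv_into_f_f)
  finally show "(\<integral>x. (\<Prod>i=0..<k. F i (x (\<iota> i))) \<partial>PiM {..<n} (\<lambda>_. \<nu>)) = (\<Prod>i=0..<k. \<integral>y. F i y \<partial>\<nu>)" .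
qed

text \<open>After expanding both determinants, orthonormality gives the pair \<sigma>, \<tau> mean 1
  if they agree and 0 otherwise, so k! terms survive. \<epsilon> selects the columns, which makes
  the lemma apply to minors.\<close>

lemma nn_integral_det_row_sel:
  fixes \<iota> \<epsilon> :: "nat \<Rightarrow> nat"
  assumes \<iota>: "inj_on \<iota> {0..<k}" "\<iota> ` {0..<k} \<subseteq> {..<n}"
    and \<epsilon>: "inj_on \<epsilon> {0..<k}" "\<epsilon> ` {0..<k} \<subseteq> {..<m}"
  shows "(\<integral>\<^sup>+x. ennreal ((det (row_sel k (\<lambda>i q. v (x i) (\<epsilon> q)) \<iota>))\<^sup>2) \<partial>PiM {..<n} (\<lambda>_. \<nu>)) = fact k"
proof -
  define Perm where "Perm = {\<sigma>. \<sigma> permutes {0..<k}}"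
  have [simp]: "finite Perm" by (simp add: Perm_def finite_permutations)
  let ?F = "\<lambda>\<sigma> \<tau> i y. v y (\<epsilon> (\<sigma> i)) * v y (\<epsilon> (\<tau> i))"
  have sq: "(det (row_sel k (\<lambda>i q. v (x i) (\<epsilon> q)) \<iota>))\<^sup>2
     = (\<Sum>\<sigma>\<in>Perm. \<Sum>\<tau>\<in>Perm. signof \<sigma> * signof \<tau> * (\<Prod>i=0..<k. ?F \<sigma> \<tau> i (x (\<iota> i))))" for x
    unfolding det_row_sel power2_eq_square Perm_def sum_product
    by (intro sum.cong refl) (simp add: prod.distrib mult_ac)
  have in': "\<epsilon> (\<sigma> i) < m" "\<sigma> i < k" if "\<sigma> \<in> Perm" "i < k" for \<sigma> i
    using that permutes_in_image[of \<sigma> "{0..<k}" i] \<epsilon>(2) by (auto simp: Perm_def image_subset_iff)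
  have int: "integrable \<nu> (?F \<sigma> \<tau> i)" if "\<sigma> \<in> Perm" "\<tau> \<in> Perm" "i < k" for \<sigma> \<tau> i
    using in' that by (intro v_integrable) auto
  have one: "(\<Prod>i=0..<k. \<integral>y. ?F \<sigma> \<tau> i y \<partial>\<nu>) = (if \<tau> = \<sigma> then 1 else 0)"
    if "\<sigma> \<in> Perm" "\<tau> \<in> Perm" for \<sigma> \<tau>
  proof -
    have "(\<Prod>i=0..<k. \<integral>y. ?F \<sigma> \<tau> i y \<partial>\<nu>) = (\<Prod>i=0..<k. if \<sigma> i = \<tau> i then 1 else 0)"
      using in' that inj_onD[OF \<epsilon>(1)] by (intro prod.cong refl) (auto simp: v_integral)
    moreover have "\<tau> = \<sigma>" if "\<forall>i<k. \<sigma> i = \<tau> i"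
    proof
      fix i
      show "\<tau> i = \<sigma> i"
        using that \<open>\<sigma> \<in> Perm\<close> \<open>\<tau> \<in> Perm\<close> by (cases "i < k") (auto simp: Perm_def permutes_def)
    qed
    ultimately show ?thesis by (auto simp: prod_zero_iff)
  qed
  have "integrable (PiM {..<n} (\<lambda>_. \<nu>)) (\<lambda>x. (det (row_sel k (\<lambda>i q. v (x i) (\<epsilon> q)) \<iota>))\<^sup>2)"
    unfolding sq using int by (intro integral_double_sum(1) integral_prod_inj(1)[OF \<iota>])
  then have "(\<integral>\<^sup>+x. ennreal ((det (row_sel k (\<lambda>i q. v (x i) (\<epsilon> q)) \<iota>))\<^sup>2) \<partial>PiM {..<n} (\<lambda>_. \<nu>))
     = ennreal (\<integral>x. (det (row_sel k (\<lambda>i q. v (x i) (\<epsilon> q)) \<iota>))\<^sup>2 \<partial>PiM {..<n} (\<lambda>_. \<nu>))"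
    by (intro nn_integral_eq_integral) auto
  also have "(\<integral>x. (det (row_sel k (\<lambda>i q. v (x i) (\<epsilon> q)) \<iota>))\<^sup>2 \<partial>PiM {..<n} (\<lambda>_. \<nu>))
     = (\<Sum>\<sigma>\<in>Perm. \<Sum>\<tau>\<in>Perm. signof \<sigma> * signof \<tau> * (\<Prod>i=0..<k. \<integral>y. ?F \<sigma> \<tau> i y \<partial>\<nu>))"
  proof -
    have "(\<integral>x. (\<Prod>i=0..<k. ?F \<sigma> \<tau> i (x (\<iota> i))) \<partial>PiM {..<n} (\<lambda>_. \<nu>)) = (\<Prod>i=0..<k. \<integral>y. ?F \<sigma> \<tau> i y \<partial>\<nu>)"
      if "\<sigma> \<in> Perm" "\<tau> \<in> Perm" for \<sigma> \<tau>
      using int that by (intro integral_prod_inj(2)[OF \<iota>]) auto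
    then show ?thesis
      unfolding sq using int
      by (subst integral_double_sum(2)) (auto intro!: integral_prod_inj(1)[OF \<iota>] sum.cong)
  qed
  also have "\<dots> = (\<Sum>\<sigma>\<in>Perm. \<Sum>\<tau>\<in>Perm. if \<tau> = \<sigma> then signof \<sigma> * signof \<sigma> else 0)"
    by (intro sum.cong refl) (simp add: one)
  also have "\<dots> = (\<Sum>\<sigma>\<in>Perm. 1)"
    by (intro sum.cong refl) (simp add: sign_def)
  also have "\<dots> = fact k"
    by (simp add: Perm_def card_permutations[of _ k])
  finally show ?thesis by (metis ennreal_of_nat_eq_real_of_nat of_nat_fact)
qed

end

section \<open>Volume sampling\<close>

lemma gram_mat_sym: "i < k \<Longrightarrow> j < k \<Longrightarrow> gram_mat k n a $$ (i, j) = gram_mat k n a $$ (j, i)"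
  by (simp add: gram_mat_def mult.commute)

lemma mat_qf_gram_mat: "mat_qf k (gram_mat k n a) c = (\<Sum>i<n. (ip k (a i) c)\<^sup>2)"
proof -
  have "mat_qf k (gram_mat k n a) c = (\<Sum>p<k. \<Sum>q<k. \<Sum>i<n. (a i p * c p) * (a i q * c q))"
    unfolding qform_def
    by (intro sum.cong refl) (simp add: gram_mat_def sum_distrib_left sum_distrib_right mult_ac)
  also have "\<dots> = (\<Sum>p<k. \<Sum>i<n. \<Sum>q<k. (a i p * c p) * (a i q * c q))"
    by (intro sum.cong refl sum.swap)
  also have "\<dots> = (\<Sum>i<n. \<Sum>p<k. \<Sum>q<k. (a i p * c p) * (a i q * c q))"
    by (rule sum.swap)
  also have "\<dots> = (\<Sum>i<n. (ip k (a i) c)\<^sup>2)"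
    by (simp add: ip_def power2_eq_square sum_product)
  finally show ?thesis .
qed

lemma mat_qf_gram_mat_nonneg: "0 \<le> mat_qf k (gram_mat k n a) c"
  by (simp add: mat_qf_gram_mat sum_nonneg)

lemma det_gram_mat_nonneg: "0 \<le> det (gram_mat k n a)"
  by (simp add: cauchy_binet sum_nonneg)

lemma mat_delete_gram_mat:
  assumes "j < k"
  shows "mat_delete (gram_mat k n a) j j = gram_mat (k - 1) n (\<lambda>i q. a i (insert_index j q))"
  using assms by (intro eq_matI) (auto simp: mat_delete_def gram_mat_def insert_index_def)

lemma card_inj_funcset:
  assumes "k \<le> n"
  shows "real (card {\<iota> \<in> {0..<k} \<rightarrow>\<^sub>E {0..<n}. inj_on \<iota> {0..<k}}) = fact n / fact (n - k)"
proof -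
  have "fact n = fact (n - k) * prod ((-) n) {0..<k}"
    using assms
  proof (induction k)
    case (Suc k)
    have "(fact (n - k) :: nat) = (n - k) * fact (n - Suc k)"
      using Suc.prems by (metis Suc_diff_Suc Suc_le_lessD fact_Suc of_nat_id)
    then show ?case using Suc by simp
  qed simp
  then have "real (fact n) = real (fact (n - k) * prod ((-) n) {0..<k})" by (rule arg_cong)
  then show ?thesis
    by (simp add: card_inj_on_subset_funcset field_simps)
qed

context isotropic
begin

lemma measurable_det_row_sel:
  assumes "\<iota> ` {0..<k} \<subseteq> {..<n}" "\<epsilon> ` {0..<k} \<subseteq> {..<m}"
  shows "(\<lambda>x. det (row_sel k (\<lambda>i q. v (x i) (\<epsilon> q)) \<iota>)) \<in> borel_measurable (PiM {..<n} (\<lambda>_. \<nu>))"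
  unfolding det_row_sel
proof (intro borel_measurable_sum borel_measurable_times borel_measurable_prod borel_measurable_const)
  fix \<sigma> i assume "\<sigma> \<in> {\<sigma>. \<sigma> permutes {0..<k}}" "i \<in> {0..<k}"
  then show "(\<lambda>x. v (x (\<iota> i)) (\<epsilon> (\<sigma> i))) \<in> borel_measurable (PiM {..<n} (\<lambda>_. \<nu>))"
    using permutes_in_image[of \<sigma> "{0..<k}" i] assms
    by (intro measurable_v_component) (auto simp: image_subset_iff)
qed

lemma measurable_det_gram_mat:
  assumes "\<epsilon> ` {0..<k} \<subseteq> {..<m}"
  shows "(\<lambda>x. det (gram_mat k n (\<lambda>i q. v (x i) (\<epsilon> q)))) \<in> borel_measurable (PiM {..<n} (\<lambda>_. \<nu>))"
  unfolding cauchy_binet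
proof (intro borel_measurable_divide borel_measurable_sum borel_measurable_power borel_measurable_const)
  fix \<iota> assume "\<iota> \<in> {0..<k} \<rightarrow>\<^sub>E {0..<n}"
  then show "(\<lambda>x. det (row_sel k (\<lambda>i q. v (x i) (\<epsilon> q)) \<iota>)) \<in> borel_measurable (PiM {..<n} (\<lambda>_. \<nu>))"
    using assms by (intro measurable_det_row_sel) auto
qed

text \<open>Each of the n! / (n - k)! injective selections contributes k!, which cancels the 1 / k!
  of Cauchy--Binet. k = m gives the normalization of volume sampling, k = m - 1 the mean of a
  principal minor.\<close>

lemma nn_integral_det_gram_mat:
  assumes "k \<le> n" and \<epsilon>: "inj_on \<epsilon> {0..<k}" "\<epsilon> ` {0..<k} \<subseteq> {..<m}"
  shows "(\<integral>\<^sup>+x. ennreal (det (gram_mat k n (\<lambda>i q. v (x i) (\<epsilon> q)))) \<partial>PiM {..<n} (\<lambda>_. \<nu>))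
    = ennreal (fact n / fact (n - k))"
proof -
  define Idx where "Idx = {0..<k} \<rightarrow>\<^sub>E {0..<n}"
  have fin: "finite Idx" by (simp add: Idx_def finite_PiE)
  have fact_e: "(fact k :: ennreal) = ennreal (fact k)"
    by (metis ennreal_of_nat_eq_real_of_nat of_nat_fact)
  let ?d = "\<lambda>\<iota> x. (det (row_sel k (\<lambda>i q. v (x i) (\<epsilon> q)) \<iota>))\<^sup>2"
  have meas: "(\<lambda>x. ennreal (?d \<iota> x)) \<in> borel_measurable (PiM {..<n} (\<lambda>_. \<nu>))" if "\<iota> \<in> Idx" for \<iota>
  proof -
    have "\<iota> ` {0..<k} \<subseteq> {..<n}" using that by (auto simp: Idx_def)
    from measurable_det_row_sel[OF this \<epsilon>(2)] show ?thesis by measurable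
  qed
  have int: "(\<integral>\<^sup>+x. ennreal (?d \<iota> x) \<partial>PiM {..<n} (\<lambda>_. \<nu>)) = (if inj_on \<iota> {0..<k} then fact k else 0)"
    if "\<iota> \<in> Idx" for \<iota>
  proof (cases "inj_on \<iota> {0..<k}")
    case True
    have "\<iota> ` {0..<k} \<subseteq> {..<n}" using that by (auto simp: Idx_def)
    with True show ?thesis using \<epsilon> by (simp add: nn_integral_det_row_sel)
  qed (simp add: det_row_sel_not_inj)
  have "(\<integral>\<^sup>+x. ennreal (det (gram_mat k n (\<lambda>i q. v (x i) (\<epsilon> q)))) \<partial>PiM {..<n} (\<lambda>_. \<nu>))
    = (\<integral>\<^sup>+x. ennreal (1 / fact k) * (\<Sum>\<iota>\<in>Idx. ennreal (?d \<iota> x)) \<partial>PiM {..<n} (\<lambda>_. \<nu>))"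
    unfolding cauchy_binet Idx_def[symmetric]
    by (intro nn_integral_cong) (simp add: sum_ennreal ennreal_mult'[symmetric])
  also have "\<dots> = ennreal (1 / fact k) * (\<Sum>\<iota>\<in>Idx. \<integral>\<^sup>+x. ennreal (?d \<iota> x) \<partial>PiM {..<n} (\<lambda>_. \<nu>))"
  proof -
    have "(\<lambda>x. \<Sum>\<iota>\<in>Idx. ennreal (?d \<iota> x)) \<in> borel_measurable (PiM {..<n} (\<lambda>_. \<nu>))"
      using meas by (intro borel_measurable_sum)
    then show ?thesis by (simp only: nn_integral_cmult nn_integral_sum[OF meas])
  qed
  also have "(\<Sum>\<iota>\<in>Idx. \<integral>\<^sup>+x. ennreal (?d \<iota> x) \<partial>PiM {..<n} (\<lambda>_. \<nu>))
     = (\<Sum>\<iota>\<in>Idx. if inj_on \<iota> {0..<k} then fact k else 0)"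
    by (intro sum.cong refl int)
  also have "\<dots> = (\<Sum>\<iota>\<in>{\<iota>\<in>Idx. inj_on \<iota> {0..<k}}. fact k)"
    by (rule sum.inter_filter[OF fin, symmetric])
  also have "\<dots> = ennreal (real (card {\<iota>\<in>Idx. inj_on \<iota> {0..<k}}) * fact k)"
    by (simp add: ennreal_mult ennreal_of_nat_eq_real_of_nat fact_e)
  also have "\<dots> = ennreal (fact n / fact (n - k) * fact k)"
    using card_inj_funcset[OF assms(1)] by (simp add: Idx_def)
  finally show ?thesis by (simp add: ennreal_mult'[symmetric])
qed

end

text \<open>This \<theta> is the Chernoff optimum for the threshold N (1 - \<delta>), characterized
  by exp (- \<theta> K) = 1 - \<delta>.\<close>

lemma chernoff_exponent:
  assumes "0 < K" "\<delta> < 1"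
  shows "(- ln (1 - \<delta>) / K) * (N * (1 - \<delta>)) + - ((1 - exp (- (- ln (1 - \<delta>) / K) * K)) / K) * N
     = - (c_delta \<delta> * N / K)"
  using assms by (simp add: c_delta_def field_simps)

section \<open>Inverse of the Gram matrix of one block under volume sampling\<close>

locale volume_sample = isotropic +
  fixes nb :: nat
  assumes m_pos: "0 < m" and m_less: "m < nb"
begin

definition gram :: "(nat \<Rightarrow> 'a) \<Rightarrow> real mat" where
  "gram x = gram_mat m nb (\<lambda>i. v (x i))"

text \<open>One Cauchy--Binet term of the principal minor without row and column \<open>l\<close>;
  \<open>insert_index l\<close> is the enumeration that skips \<open>l\<close>.\<close>

definition minor_sel :: "nat \<Rightarrow> (nat \<Rightarrow> nat) \<Rightarrow> (nat \<Rightarrow> 'a) \<Rightarrow> real" where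
  "minor_sel l \<iota> x = (det (row_sel (m - 1) (\<lambda>i q. v (x i) (insert_index l q)) \<iota>))\<^sup>2 / fact (m - 1)"

definition rest :: "(nat \<Rightarrow> nat) \<Rightarrow> nat list" where
  "rest \<iota> = sorted_list_of_set ({..<nb} - \<iota> ` {0..<m-1})"

definition potential :: "nat \<Rightarrow> real \<Rightarrow> nat list \<Rightarrow> (nat \<Rightarrow> 'a) \<Rightarrow> real" where
  "potential j \<theta> xs x = mtr m (msq m j (cprod m (\<theta> / 2 ^ Suc j) (map (\<lambda>i. v (x i)) xs)))"

text \<open>The trace of the adjugate of \<open>gram\<close>, expanded by Cauchy--Binet, with each
  term weighted by the potential of the points it does not involve. Under the product measure the
  two factors are independent.\<close>

definition tail :: "nat \<Rightarrow> real \<Rightarrow> (nat \<Rightarrow> 'a) \<Rightarrow> real" where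
  "tail j \<theta> x = (\<Sum>l<m. \<Sum>\<iota>\<in>{0..<m-1} \<rightarrow>\<^sub>E {0..<nb}. minor_sel l \<iota> x * potential j \<theta> (rest \<iota>) x)"

lemma gram_carrier: "gram x \<in> carrier_mat m m"
  by (simp add: gram_def)

lemma det_gram_nonneg: "0 \<le> det (gram x)"
  by (simp add: gram_def det_gram_mat_nonneg)

lemma potential_nonneg: "0 < j \<Longrightarrow> 0 \<le> potential j \<theta> xs x"
  unfolding potential_def by (rule mtr_msq_cprod_nonneg)

lemma minor_sel_nonneg: "0 \<le> minor_sel l \<iota> x"
  by (simp add: minor_sel_def)

lemma tail_nonneg: "0 < j \<Longrightarrow> 0 \<le> tail j \<theta> x"
  unfolding tail_def by (intro sum_nonneg mult_nonneg_nonneg minor_sel_nonneg potential_nonneg)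

lemma det_minor: "l < m \<Longrightarrow>
  det (mat_delete (gram x) l l) = (\<Sum>\<iota>\<in>{0..<m-1} \<rightarrow>\<^sub>E {0..<nb}. minor_sel l \<iota> x)"
  by (simp add: gram_def mat_delete_gram_mat cauchy_binet minor_sel_def sum_divide_distrib)

lemma set_rest: "set (rest \<iota>) = {..<nb} - \<iota> ` {0..<m-1}"
  and distinct_rest: "distinct (rest \<iota>)"
  by (simp_all add: rest_def)

lemma length_rest_le: "length (rest \<iota>) \<le> nb"
  by (metis card_lessThan card_mono distinct_card distinct_rest Diff_subset finite_lessThan set_rest)

text \<open>At least nb - m + 1 points remain; the count nb - m is the one that matches the
  condition on the block length.\<close>

lemma length_rest_ge: "nb - m \<le> length (rest \<iota>)"
proof -
  have "card (\<iota> ` {0..<m-1}) \<le> m"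
    using card_image_le[of "{0..<m-1}" \<iota>] by simp
  then have "nb - m \<le> card {..<nb} - card (\<iota> ` {0..<m-1})" by simp
  also have "\<dots> \<le> card ({..<nb} - \<iota> ` {0..<m-1})"
    by (rule diff_card_le_card_Diff) simp
  finally show ?thesis
    by (metis distinct_card distinct_rest set_rest)
qed

text \<open>If c^T Y c < t for a unit vector, every subfamily of points inherits this, so every
  potential in \<open>tail\<close> is at least exp (- \<theta> t) / 2 and tr (adj Y) <= 2 exp
  (\<theta> t) tail. The bound is multiplied through by det Y because Y may be singular.\<close>

lemma nrm2_gram_bound:
  assumes j: "0 < j" and t: "0 < t"
    and pot: "\<And>vs c. \<lbrakk>length vs \<le> nb; \<And>v. v \<in> set vs \<Longrightarrow> nrm2 m v \<le> K; nrm2 m c = 1;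
        (\<Sum>v\<leftarrow>vs. (ip m v c)\<^sup>2) \<le> t\<rbrakk>
      \<Longrightarrow> exp (- \<theta> * t) / 2 \<le> mtr m (msq m j (cprod m (\<theta> / 2 ^ Suc j) vs))"
  shows "det (gram x) * nrm2 m c \<le> (det (gram x) / t + 2 * exp (\<theta> * t) * tail j \<theta> x) * mat_qf m (gram x) c"
proof (rule qform_ge_of_unit)
  fix c assume c: "nrm2 m c = 1"
  define q where "q = mat_qf m (gram x) c"
  have q_eq: "q = (\<Sum>i<nb. (ip m (v (x i)) c)\<^sup>2)"
    unfolding q_def gram_def by (rule mat_qf_gram_mat)
  have q0: "0 \<le> q" unfolding q_eq by (simp add: sum_nonneg)
  have tail0: "0 \<le> 2 * exp (\<theta> * t) * tail j \<theta> x * q" using tail_nonneg[OF j] q0 by simp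
  show "det (gram x) \<le> (det (gram x) / t + 2 * exp (\<theta> * t) * tail j \<theta> x) * q"
  proof (cases "t \<le> q")
    case True
    have "det (gram x) * t \<le> det (gram x) * q" using True det_gram_nonneg by (rule mult_left_mono)
    then have "det (gram x) \<le> det (gram x) / t * q" using t by (simp add: field_simps)
    then show ?thesis using tail0 by (simp add: algebra_simps)
  next
    case False
    have pot1: "1 \<le> 2 * exp (\<theta> * t) * potential j \<theta> (rest \<iota>) x" for \<iota>
    proof -
      have "(\<Sum>u\<leftarrow>map (\<lambda>i. v (x i)) (rest \<iota>). (ip m u c)\<^sup>2) = (\<Sum>i\<in>set (rest \<iota>). (ip m (v (x i)) c)\<^sup>2)"
        using distinct_rest[of \<iota>] by (simp add: comp_def sum_list_distinct_conv_sum_set)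
      also have "\<dots> \<le> q" unfolding q_eq by (intro sum_mono2) (auto simp: set_rest)
      also have "\<dots> \<le> t" using False by simp
      finally have "exp (- \<theta> * t) / 2 \<le> potential j \<theta> (rest \<iota>) x"
        unfolding potential_def using length_rest_le c v_bound by (intro pot) auto
      then have "2 * exp (\<theta> * t) * (exp (- \<theta> * t) / 2) \<le> 2 * exp (\<theta> * t) * potential j \<theta> (rest \<iota>) x"
        by (intro mult_left_mono) auto
      then show ?thesis by (simp add: exp_minus)
    qed
    have "(\<Sum>l<m. det (mat_delete (gram x) l l)) \<le> 2 * exp (\<theta> * t) * tail j \<theta> x"
      unfolding tail_def sum_distrib_left
    proof (intro sum_mono)
      fix l assume "l \<in> {..<m}"
      then have "det (mat_delete (gram x) l l) = (\<Sum>\<iota>\<in>{0..<m-1} \<rightarrow>\<^sub>E {0..<nb}. minor_sel l \<iota> x * 1)"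
        by (simp add: det_minor)
      also have "\<dots> \<le> (\<Sum>\<iota>\<in>{0..<m-1} \<rightarrow>\<^sub>E {0..<nb}. minor_sel l \<iota> x * (2 * exp (\<theta> * t) * potential j \<theta> (rest \<iota>) x))"
        by (intro sum_mono mult_left_mono pot1 minor_sel_nonneg)
      finally show "det (mat_delete (gram x) l l)
        \<le> (\<Sum>\<iota>\<in>{0..<m-1} \<rightarrow>\<^sub>E {0..<nb}. 2 * exp (\<theta> * t) * (minor_sel l \<iota> x * potential j \<theta> (rest \<iota>) x))"
        by (simp add: mult_ac)
    qed
    then have le: "q * (\<Sum>l<m. det (mat_delete (gram x) l l)) \<le> q * (2 * exp (\<theta> * t) * tail j \<theta> x)"
      using q0 by (rule mult_left_mono)
    have "nrm2 m c * (det (gram x))\<^sup>2 \<le> q * det (gram x) * (\<Sum>l<m. det (mat_delete (gram x) l l))"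
      unfolding q_def
      by (rule nrm2_det_bound[OF gram_carrier]) (simp_all add: gram_def gram_mat_sym mat_qf_gram_mat_nonneg)
    then have "det (gram x) * det (gram x) \<le> det (gram x) * (q * (\<Sum>l<m. det (mat_delete (gram x) l l)))"
      using c by (simp add: power2_eq_square mult_ac)
    then have "det (gram x) \<le> q * (2 * exp (\<theta> * t) * tail j \<theta> x)"
      using le det_gram_nonneg[of x] tail0
      by (cases "det (gram x) = 0") (auto simp: mult_ac)
    moreover have "0 \<le> det (gram x) / t * q" using det_gram_nonneg q0 t by simp
    ultimately show ?thesis by (simp add: algebra_simps)
  qed
qed

lemma measurable_det_gram: "(\<lambda>x. det (gram x)) \<in> borel_measurable (PiM {..<nb} (\<lambda>_. \<nu>))"
  using measurable_det_gram_mat[of "\<lambda>i. i" m nb] by (simp add: gram_def lessThan_atLeast0)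

lemma nn_integral_det_gram:
  "(\<integral>\<^sup>+x. ennreal (det (gram x)) \<partial>PiM {..<nb} (\<lambda>_. \<nu>)) = ennreal (fact nb / fact (nb - m))"
  using nn_integral_det_gram_mat[of m nb "\<lambda>i. i"] m_less by (simp add: gram_def lessThan_atLeast0)

lemma insert_index_image: "l < m \<Longrightarrow> insert_index l ` {0..<m-1} \<subseteq> {..<m}"
  by (auto simp: insert_index_def)

lemma measurable_minor_sel:
  assumes "l < m" "\<iota> \<in> {0..<m-1} \<rightarrow>\<^sub>E {0..<nb}"
  shows "minor_sel l \<iota> \<in> borel_measurable (PiM {..<nb} (\<lambda>_. \<nu>))"
proof -
  have "\<iota> ` {0..<m-1} \<subseteq> {..<nb}" using assms(2) by auto
  from measurable_det_row_sel[OF this insert_index_image[OF assms(1)]]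
  show ?thesis unfolding minor_sel_def by measurable
qed

lemma measurable_potential_rest:
  "potential j \<theta> (rest \<iota>) \<in> borel_measurable (PiM {..<nb} (\<lambda>_. \<nu>))"
  unfolding potential_def by (rule measurable_potential) (auto simp: set_rest)

lemma measurable_tail: "tail j \<theta> \<in> borel_measurable (PiM {..<nb} (\<lambda>_. \<nu>))"
  unfolding tail_def[abs_def]
  using measurable_minor_sel measurable_potential_rest
  by (intro borel_measurable_sum borel_measurable_times) auto

text \<open>One factor m counts the principal minors, the other is the trace of the identity from
  the potential. The factorials are the mean of a minor of order m - 1.\<close>

lemma nn_integral_tail_le:
  assumes j: "0 < j" and th: "0 < \<theta>" "\<theta> * K \<le> 2 ^ Suc j"
  defines "\<kappa> \<equiv> (1 - exp (- \<theta> * K)) / K"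
  shows "(\<integral>\<^sup>+x. ennreal (tail j \<theta> x) \<partial>PiM {..<nb} (\<lambda>_. \<nu>))
    \<le> ennreal ((real m)\<^sup>2 * exp (- \<kappa> * real (nb - m)) * (fact nb / fact (nb - m + 1)))"
proof -
  have \<kappa>0: "0 \<le> \<kappa>" unfolding \<kappa>_def using K_pos th by simp
  let ?Idx = "{0..<m-1} \<rightarrow>\<^sub>E {0..<nb}"
  let ?P = "PiM {..<nb} (\<lambda>_. \<nu>)"
  have fin: "finite ?Idx" by (simp add: finite_PiE)
  have one: "(\<integral>\<^sup>+x. ennreal (minor_sel l \<iota> x) * ennreal (potential j \<theta> (rest \<iota>) x) \<partial>?P)
     \<le> ennreal (real m * exp (- \<kappa> * real (nb - m))) * (\<integral>\<^sup>+x. ennreal (minor_sel l \<iota> x) \<partial>?P)"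
    if "l < m" "\<iota> \<in> ?Idx" for l \<iota>
  proof -
    have "(\<integral>\<^sup>+x. ennreal (minor_sel l \<iota> x) * ennreal (potential j \<theta> (rest \<iota>) x) \<partial>?P)
       \<le> ennreal (real m * exp (- \<kappa>) ^ length (rest \<iota>)) * (\<integral>\<^sup>+x. ennreal (minor_sel l \<iota> x) \<partial>?P)"
      unfolding potential_def \<kappa>_def
    proof (rule nn_integral_potential_le)
      show "(\<lambda>x. ennreal (minor_sel l \<iota> x)) \<in> borel_measurable ?P"
        using measurable_minor_sel[OF that] by measurable
      fix x y :: "nat \<Rightarrow> 'a" assume eq: "\<And>i. i \<notin> set (rest \<iota>) \<Longrightarrow> x i = y i"
      have "row_sel (m - 1) (\<lambda>i q. v (x i) (insert_index l q)) \<iota> = row_sel (m - 1) (\<lambda>i q. v (y i) (insert_index l q)) \<iota>"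
        using eq by (intro eq_matI) (auto simp: row_sel_def set_rest)
      then show "ennreal (minor_sel l \<iota> x) = ennreal (minor_sel l \<iota> y)"
        by (simp add: minor_sel_def)
    qed (use j th in \<open>auto simp: set_rest distinct_rest\<close>)
    also have "\<dots> \<le> ennreal (real m * exp (- \<kappa> * real (nb - m))) * (\<integral>\<^sup>+x. ennreal (minor_sel l \<iota> x) \<partial>?P)"
    proof (intro mult_right_mono ennreal_leI mult_left_mono)
      have "exp (- \<kappa>) ^ length (rest \<iota>) \<le> exp (- \<kappa>) ^ (nb - m)"
        using \<kappa>0 length_rest_ge by (intro power_decreasing) auto
      also have "\<dots> = exp (- \<kappa> * real (nb - m))"
        by (simp add: exp_of_nat_mult[symmetric] mult.commute)
      finally show "exp (- \<kappa>) ^ length (rest \<iota>) \<le> exp (- \<kappa> * real (nb - m))" .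
    qed auto
    finally show ?thesis .
  qed
  have minors: "(\<Sum>\<iota>\<in>?Idx. \<integral>\<^sup>+x. ennreal (minor_sel l \<iota> x) \<partial>?P) = ennreal (fact nb / fact (nb - m + 1))"
    if l: "l < m" for l
  proof -
    have "(\<Sum>\<iota>\<in>?Idx. \<integral>\<^sup>+x. ennreal (minor_sel l \<iota> x) \<partial>?P) = (\<integral>\<^sup>+x. (\<Sum>\<iota>\<in>?Idx. ennreal (minor_sel l \<iota> x)) \<partial>?P)"
      using measurable_minor_sel[OF l] by (intro nn_integral_sum[symmetric]) simp
    also have "\<dots> = (\<integral>\<^sup>+x. ennreal (det (gram_mat (m - 1) nb (\<lambda>i q. v (x i) (insert_index l q)))) \<partial>?P)"
      by (simp add: cauchy_binet minor_sel_def sum_divide_distrib sum_ennreal)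
    also have "\<dots> = ennreal (fact nb / fact (nb - (m - 1)))"
      using l m_less insert_index_inj_on[of l "{0..<m-1}"]
      by (intro nn_integral_det_gram_mat insert_index_image) auto
    finally show ?thesis using m_pos m_less by (simp add: Suc_diff_le flip: Suc_diff_Suc)
  qed
  have "(\<integral>\<^sup>+x. ennreal (tail j \<theta> x) \<partial>?P)
    = (\<integral>\<^sup>+x. (\<Sum>l<m. \<Sum>\<iota>\<in>?Idx. ennreal (minor_sel l \<iota> x) * ennreal (potential j \<theta> (rest \<iota>) x)) \<partial>?P)"
    unfolding tail_def
    by (intro nn_integral_cong)
       (simp add: sum_ennreal minor_sel_nonneg potential_nonneg j sum_nonneg flip: ennreal_mult)
  also have "\<dots> = (\<Sum>l<m. \<Sum>\<iota>\<in>?Idx. \<integral>\<^sup>+x. ennreal (minor_sel l \<iota> x) * ennreal (potential j \<theta> (rest \<iota>) x) \<partial>?P)"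
  proof -
    have meas: "(\<lambda>x. ennreal (minor_sel l \<iota> x) * ennreal (potential j \<theta> (rest \<iota>) x)) \<in> borel_measurable ?P"
      if "l < m" "\<iota> \<in> ?Idx" for l \<iota>
      using measurable_minor_sel[OF that] measurable_potential_rest[of j \<theta> \<iota>] by measurable
    then have "(\<lambda>x. \<Sum>\<iota>\<in>?Idx. ennreal (minor_sel l \<iota> x) * ennreal (potential j \<theta> (rest \<iota>) x)) \<in> borel_measurable ?P"
      if "l < m" for l
      using that by (intro borel_measurable_sum)
    then have "(\<integral>\<^sup>+x. (\<Sum>l<m. \<Sum>\<iota>\<in>?Idx. ennreal (minor_sel l \<iota> x) * ennreal (potential j \<theta> (rest \<iota>) x)) \<partial>?P)
      = (\<Sum>l<m. \<integral>\<^sup>+x. (\<Sum>\<iota>\<in>?Idx. ennreal (minor_sel l \<iota> x) * ennreal (potential j \<theta> (rest \<iota>) x)) \<partial>?P)"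
      by (intro nn_integral_sum) auto
    also have "\<dots> = (\<Sum>l<m. \<Sum>\<iota>\<in>?Idx. \<integral>\<^sup>+x. ennreal (minor_sel l \<iota> x) * ennreal (potential j \<theta> (rest \<iota>) x) \<partial>?P)"
      by (intro sum.cong refl nn_integral_sum meas) auto
    finally show ?thesis .
  qed
  also have "\<dots> \<le> (\<Sum>l<m. \<Sum>\<iota>\<in>?Idx. ennreal (real m * exp (- \<kappa> * real (nb - m))) * (\<integral>\<^sup>+x. ennreal (minor_sel l \<iota> x) \<partial>?P))"
    using one by (intro sum_mono) auto
  also have "\<dots> = (\<Sum>l<m. ennreal (real m * exp (- \<kappa> * real (nb - m))) * ennreal (fact nb / fact (nb - m + 1)))"
    using minors by (intro sum.cong) (auto simp: sum_distrib_left[symmetric])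
  also have "\<dots> = ennreal ((real m)\<^sup>2 * exp (- \<kappa> * real (nb - m)) * (fact nb / fact (nb - m + 1)))"
    by (simp add: ennreal_of_nat_eq_real_of_nat power2_eq_square mult_ac flip: ennreal_mult)
  finally show ?thesis .
qed

text \<open>\<open>b\<close> bounds the inverse of the Gram matrix and may blow up near singular
  samples, but only like 1 / det, which the density compensates. The second summand of the mean is
  the Chernoff tail.\<close>

theorem inverse_gram_bound:
  assumes \<delta>: "0 < \<delta>" "\<delta> < 1"
  obtains b where "b \<in> borel_measurable (PiM {..<nb} (\<lambda>_. \<nu>))" "\<And>x. 0 \<le> b x"
    "\<And>x c. 0 < det (gram x) \<Longrightarrow> nrm2 m c \<le> b x * mat_qf m (gram x) c"
    "(\<integral>\<^sup>+x. ennreal (fact (nb - m) / fact nb * det (gram x)) * ennreal (b x) \<partial>PiM {..<nb} (\<lambda>_. \<nu>))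
      \<le> ennreal (1 / (real (nb - m) * (1 - \<delta>))
          + 2 * (real m)\<^sup>2 / real (nb - m + 1) * exp (- (c_delta \<delta> * real (nb - m) / K)))"
proof -
  define N where "N = real (nb - m)"
  define \<theta> where "\<theta> = - ln (1 - \<delta>) / K"
  \<comment> \<open>A unit vector has mean energy \<open>N\<close> over \<open>N\<close> points;
    \<open>t\<close> is the fraction 1 - \<delta> of it.\<close>
  define t where "t = N * (1 - \<delta>)"
  let ?P = "PiM {..<nb} (\<lambda>_. \<nu>)"
  have N: "0 < N" using m_less by (simp add: N_def)
  have \<theta>: "0 < \<theta>" unfolding \<theta>_def using \<delta> K_pos by (intro divide_pos_pos) auto
  have t: "0 < t" using \<delta> N by (simp add: t_def)
  obtain j where j: "0 < j" "\<theta> * K \<le> 2 ^ Suc j"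
    and pot: "\<And>vs c. \<lbrakk>length vs \<le> nb; \<And>v. v \<in> set vs \<Longrightarrow> nrm2 m v \<le> K; nrm2 m c = 1;
        (\<Sum>v\<leftarrow>vs. (ip m v c)\<^sup>2) \<le> t\<rbrakk>
      \<Longrightarrow> exp (- \<theta> * t) / 2 \<le> mtr m (msq m j (cprod m (\<theta> / 2 ^ Suc j) vs))"
    using chernoff_potential_ge[OF K_pos \<theta>, of t nb m] t by (metis less_imp_le)
  \<comment> \<open>\<open>nrm2_gram_bound\<close> divided by the determinant. Where that is 0,
    division by zero leaves \<open>b x = 1 / t\<close>.\<close>
  define b where "b x = 1 / t + 2 * exp (\<theta> * t) * tail j \<theta> x / det (gram x)" for x
  define C where "C = (fact (nb - m) / fact nb :: real)"
  have C: "0 < C" by (simp add: C_def)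
  show thesis
  proof (rule that)
    show bm: "b \<in> borel_measurable ?P"
      unfolding b_def[abs_def] using measurable_tail measurable_det_gram by measurable
    show b0: "0 \<le> b x" for x
      unfolding b_def using t tail_nonneg[OF j(1)] det_gram_nonneg by simp
    fix x c assume d: "0 < det (gram x)"
    have "det (gram x) * nrm2 m c \<le> (det (gram x) / t + 2 * exp (\<theta> * t) * tail j \<theta> x) * mat_qf m (gram x) c"
      using j(1) t pot by (rule nrm2_gram_bound)
    also have "\<dots> = det (gram x) * (b x * mat_qf m (gram x) c)"
      using d by (simp add: b_def field_simps)
    finally show "nrm2 m c \<le> b x * mat_qf m (gram x) c" using d by simp
  next
    have "(\<integral>\<^sup>+x. ennreal (C * det (gram x)) * ennreal (b x) \<partial>?P)
      \<le> (\<integral>\<^sup>+x. ennreal (C / t) * ennreal (det (gram x)) + ennreal (C * (2 * exp (\<theta> * t))) * ennreal (tail j \<theta> x) \<partial>?P)"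
    proof (rule nn_integral_mono)
      fix x
      have "C * det (gram x) * b x \<le> C / t * det (gram x) + C * (2 * exp (\<theta> * t)) * tail j \<theta> x"
      proof (cases "det (gram x) = 0")
        case True
        then show ?thesis using C tail_nonneg[OF j(1), of \<theta> x] by simp
      next
        case False
        then show ?thesis unfolding b_def distrib_left by simp
      qed
      then show "ennreal (C * det (gram x)) * ennreal (b x)
         \<le> ennreal (C / t) * ennreal (det (gram x)) + ennreal (C * (2 * exp (\<theta> * t))) * ennreal (tail j \<theta> x)"
        using C t tail_nonneg[OF j(1), of \<theta> x] det_gram_nonneg[of x]
        by (subst (1 2 3) ennreal_mult[symmetric]) (auto simp: b_def simp flip: ennreal_plus intro!: ennreal_leI)
    qed
    also have "\<dots> = ennreal (C / t) * (\<integral>\<^sup>+x. ennreal (det (gram x)) \<partial>?P)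
        + ennreal (C * (2 * exp (\<theta> * t))) * (\<integral>\<^sup>+x. ennreal (tail j \<theta> x) \<partial>?P)"
      using measurable_tail measurable_det_gram by (simp add: nn_integral_add nn_integral_cmult)
    also have "\<dots> \<le> ennreal (C / t) * ennreal (1 / C)
        + ennreal (C * (2 * exp (\<theta> * t))) *
          ennreal ((real m)\<^sup>2 * exp (- ((1 - exp (- \<theta> * K)) / K) * N) * (fact nb / fact (nb - m + 1)))"
      unfolding N_def using nn_integral_tail_le[OF j(1) \<theta> j(2)]
      by (intro add_mono mult_left_mono) (auto simp: nn_integral_det_gram C_def)
    also have "\<dots> = ennreal (1 / t + C * (2 * exp (\<theta> * t)) *
          ((real m)\<^sup>2 * exp (- ((1 - exp (- \<theta> * K)) / K) * N) * (fact nb / fact (nb - m + 1))))"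
      using C t by (simp add: ennreal_mult'[symmetric] ennreal_plus[symmetric] del: ennreal_plus)
    also have "C * (2 * exp (\<theta> * t)) *
          ((real m)\<^sup>2 * exp (- ((1 - exp (- \<theta> * K)) / K) * N) * (fact nb / fact (nb - m + 1)))
       = 2 * (real m)\<^sup>2 * (C * (fact nb / fact (nb - m + 1))) * exp (\<theta> * t + - ((1 - exp (- \<theta> * K)) / K) * N)"
      unfolding exp_add by simp
    also have "C * (fact nb / fact (nb - m + 1)) = 1 / real (nb - m + 1)"
    proof -
      have "fact (nb - m + 1) = real (nb - m + 1) * fact (nb - m)" by simp
      moreover have "(fact (nb - m) :: real) \<noteq> 0" "(fact nb :: real) \<noteq> 0" by simp_all
      moreover have "a / b * (b / (s * a)) = 1 / s" if "a \<noteq> 0" "b \<noteq> 0" for a b s :: real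
        using that by simp
      ultimately show ?thesis unfolding C_def by metis
    qed
    also have "\<theta> * t + - ((1 - exp (- \<theta> * K)) / K) * N = - (c_delta \<delta> * N / K)"
      unfolding \<theta>_def t_def using K_pos \<delta>(2) by (rule chernoff_exponent)
    finally show "(\<integral>\<^sup>+x. ennreal (fact (nb - m) / fact nb * det (gram x)) * ennreal (b x) \<partial>?P)
      \<le> ennreal (1 / (real (nb - m) * (1 - \<delta>))
          + 2 * (real m)\<^sup>2 / real (nb - m + 1) * exp (- (c_delta \<delta> * real (nb - m) / K)))"
      by (simp add: C_def t_def N_def)
  qed
qed

end

section \<open>Weighted least squares\<close>

text \<open>Cramer's rule, with the adjugate as inverse up to the determinant.\<close>

lemma gram_mat_solve:
  assumes "det (gram_mat m n a) \<noteq> 0"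
  obtains c where "\<And>p. p < m \<Longrightarrow> (\<Sum>i<n. a i p * ip m (a i) c) = s p"
proof -
  define A where "A = gram_mat m n a"
  have A: "A \<in> carrier_mat m m" by (simp add: A_def)
  define c where "c q = (\<Sum>l<m. adj_mat A $$ (q, l) * s l) / det A" for q
  have prod: "(\<Sum>q<m. A $$ (p, q) * adj_mat A $$ (q, l)) = (if p = l then det A else 0)"
    if "p < m" "l < m" for p l
  proof -
    have "(\<Sum>q<m. A $$ (p, q) * adj_mat A $$ (q, l)) = (A * adj_mat A) $$ (p, l)"
      using A adj_mat(1)[OF A] that by (simp add: scalar_prod_def lessThan_atLeast0)
    then show ?thesis using adj_mat(2)[OF A] that by simp
  qed
  show thesis
  proof (rule that)
    fix p assume p: "p < m"
    have "(\<Sum>i<n. a i p * ip m (a i) c) = (\<Sum>i<n. \<Sum>q<m. a i p * a i q * c q)"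
      by (simp add: ip_def sum_distrib_left mult.assoc)
    also have "\<dots> = (\<Sum>q<m. \<Sum>i<n. a i p * a i q * c q)"
      by (rule sum.swap)
    also have "\<dots> = (\<Sum>q<m. A $$ (p, q) * c q)"
      using p by (simp add: A_def gram_mat_def sum_distrib_right)
    also have "\<dots> = (\<Sum>q<m. \<Sum>l<m. A $$ (p, q) * adj_mat A $$ (q, l) * s l) / det A"
      by (simp add: c_def sum_distrib_left sum_divide_distrib mult.assoc)
    also have "(\<Sum>q<m. \<Sum>l<m. A $$ (p, q) * adj_mat A $$ (q, l) * s l)
      = (\<Sum>l<m. (\<Sum>q<m. A $$ (p, q) * adj_mat A $$ (q, l)) * s l)"
      unfolding sum_distrib_right by (rule sum.swap)
    also have "\<dots> = (\<Sum>l<m. if l = p then det A * s l else 0)"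
      using p prod by (intro sum.cong) auto
    also have "\<dots> / det A = s p"
      using p assms by (simp add: A_def)
    finally show "(\<Sum>i<n. a i p * ip m (a i) c) = s p" .
  qed
qed

lemma det_gram_mat_nonzero:
  assumes "\<And>c. nrm2 m c \<le> b * (\<Sum>i<n. (ip m (a i) c)\<^sup>2)"
  shows "det (gram_mat m n a) \<noteq> 0"
proof
  assume "det (gram_mat m n a) = 0"
  then obtain u where u: "u \<in> carrier_vec m" "u \<noteq> 0\<^sub>v m" "gram_mat m n a *\<^sub>v u = 0\<^sub>v m"
    using det_0_iff_vec_prod_zero_field[OF gram_mat_carrier] by blast
  define c where "c i = u $ i" for i
  have "(\<Sum>j<m. gram_mat m n a $$ (i, j) * c j) = 0" if "i < m" for i
  proof -
    have "(\<Sum>j<m. gram_mat m n a $$ (i, j) * c j) = (gram_mat m n a *\<^sub>v u) $ i"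
      using that u(1) carrier_matD[OF gram_mat_carrier[of m n a]]
      by (simp add: scalar_prod_def c_def lessThan_atLeast0)
    then show ?thesis using u(3) that by simp
  qed
  then have "mat_qf m (gram_mat m n a) c = 0"
    unfolding qform_def by (simp add: mult.assoc sum_distrib_left[symmetric])
  then have "nrm2 m c \<le> 0" using assms[of c] by (simp add: mat_qf_gram_mat)
  then have "(\<Sum>i<m. (c i)\<^sup>2) = 0" using nrm2_nonneg[of m c] by (simp add: nrm2_def)
  then have "\<forall>i<m. c i = 0" by (simp add: sum_nonneg_eq_0_iff)
  then have "u = 0\<^sub>v m" using u(1) by (intro eq_vecI) (auto simp: c_def)
  with u(2) show False by simp
qed

lemma ip_diff: "ip m a (\<lambda>j. c j - d j) = ip m a c - ip m a d"
  by (simp add: ip_def algebra_simps sum_subtractf)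

text \<open>\<open>c\<close> solves the normal equations, so its residual is orthogonal to the
  column space. The resulting Pythagoras identity yields minimality, uniqueness and the contraction
  property at once.\<close>

lemma least_squares_solution:
  fixes a :: "nat \<Rightarrow> nat \<Rightarrow> real" and n :: nat
  assumes "\<And>c. nrm2 m c \<le> b * (\<Sum>i<n. (ip m (a i) c)\<^sup>2)"
  obtains c where "\<And>d. (\<Sum>i<n. (y i - ip m (a i) d)\<^sup>2)
    = (\<Sum>i<n. (y i - ip m (a i) c)\<^sup>2) + (\<Sum>i<n. (ip m (a i) (\<lambda>j. c j - d j))\<^sup>2)"
proof -
  obtain c where c: "\<And>p. p < m \<Longrightarrow> (\<Sum>i<n. a i p * ip m (a i) c) = (\<Sum>i<n. a i p * y i)"
  proof -
    have "det (gram_mat m n a) \<noteq> 0" using assms by (rule det_gram_mat_nonzero)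
    then show thesis by (rule gram_mat_solve[of m n a "\<lambda>p. \<Sum>i<n. a i p * y i"]) (rule that)
  qed
  have orth: "(\<Sum>i<n. (y i - ip m (a i) c) * ip m (a i) e) = 0" for e
  proof -
    have "(\<Sum>i<n. (y i - ip m (a i) c) * ip m (a i) e)
      = (\<Sum>i<n. \<Sum>p<m. (a i p * y i - a i p * ip m (a i) c) * e p)"
      unfolding ip_def[of m "a i" e for i] sum_distrib_left
      by (intro sum.cong refl) (simp add: algebra_simps)
    also have "\<dots> = (\<Sum>p<m. (\<Sum>i<n. a i p * y i - a i p * ip m (a i) c) * e p)"
      unfolding sum_distrib_right by (rule sum.swap)
    also have "\<dots> = 0"
      using c by (simp add: sum_subtractf)
    finally show ?thesis .
  qed
  show thesis
  proof (rule that)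
    fix d
    let ?e = "\<lambda>j. c j - d j"
    have "(\<Sum>i<n. (y i - ip m (a i) d)\<^sup>2)
      = (\<Sum>i<n. (y i - ip m (a i) c)\<^sup>2 + 2 * ((y i - ip m (a i) c) * ip m (a i) ?e) + (ip m (a i) ?e)\<^sup>2)"
      by (intro sum.cong refl) (simp add: ip_diff power2_eq_square algebra_simps)
    then show "(\<Sum>i<n. (y i - ip m (a i) d)\<^sup>2)
      = (\<Sum>i<n. (y i - ip m (a i) c)\<^sup>2) + (\<Sum>i<n. (ip m (a i) ?e)\<^sup>2)"
      using orth[of ?e] by (simp add: sum.distrib sum_distrib_left[symmetric])
  qed
qed

definition lincomb :: "nat \<Rightarrow> (nat \<Rightarrow> 'a \<Rightarrow> real) \<Rightarrow> (nat \<Rightarrow> real) \<Rightarrow> 'a \<Rightarrow> real" where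
  "lincomb m \<phi> c = (\<lambda>x. \<Sum>j<m. c j * \<phi> j x)"

lemma Vm_eq: "Vm \<phi> m = range (lincomb m \<phi>)"
  by (auto simp: Vm_def lincomb_def)

text \<open>The definite description in \<open>wls\<close> needs uniqueness of the minimizing
  function, which fixes the coefficients below \<open>m\<close>. The second conclusion is
  contraction: projecting f - g does not increase its empirical norm.\<close>

lemma wls_eq_lincomb:
  fixes \<phi> :: "nat \<Rightarrow> 'a \<Rightarrow> real" and x :: "nat \<Rightarrow> 'a"
  assumes n: "0 < n" and w: "\<And>x. 0 < w x"
  defines "a \<equiv> \<lambda>i j. \<phi> j (x i) / sqrt (w (x i))"
  assumes inj: "\<And>c. nrm2 m c \<le> b * (\<Sum>i<n. (ip m (a i) c)\<^sup>2)"
  obtains c where "wls \<phi> m w n x f = lincomb m \<phi> c"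
    "\<And>d. (\<Sum>i<n. (ip m (a i) (\<lambda>j. c j - d j))\<^sup>2) \<le> (\<Sum>i<n. (f (x i) - lincomb m \<phi> d (x i))\<^sup>2 / w (x i))"
proof -
  define y where "y i = f (x i) / sqrt (w (x i))" for i
  have res: "(f (x i) - lincomb m \<phi> d (x i))\<^sup>2 / w (x i) = (y i - ip m (a i) d)\<^sup>2" for i d
  proof -
    have "y i - ip m (a i) d = (f (x i) - lincomb m \<phi> d (x i)) / sqrt (w (x i))"
      by (simp add: y_def ip_def a_def lincomb_def diff_divide_distrib sum_divide_distrib mult.commute)
    then show ?thesis using w[of "x i"] by (simp add: power_divide)
  qed
  obtain c where c: "\<And>d. (\<Sum>i<n. (y i - ip m (a i) d)\<^sup>2)
    = (\<Sum>i<n. (y i - ip m (a i) c)\<^sup>2) + (\<Sum>i<n. (ip m (a i) (\<lambda>j. c j - d j))\<^sup>2)"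
    using inj by (rule least_squares_solution[where m = m and b = b and n = n and a = a and y = y]) (rule that)
  have norm_le: "normn w n x (\<lambda>z. f z - lincomb m \<phi> d z) \<le> normn w n x (\<lambda>z. f z - lincomb m \<phi> e z)
    \<longleftrightarrow> (\<Sum>i<n. (y i - ip m (a i) d)\<^sup>2) \<le> (\<Sum>i<n. (y i - ip m (a i) e)\<^sup>2)" for d e
    using n by (simp add: normn_def res divide_le_cancel)
  have "wls \<phi> m w n x f = lincomb m \<phi> c"
    unfolding wls_def
  proof (rule the_equality)
    show "lincomb m \<phi> c \<in> Vm \<phi> m \<and> (\<forall>g'\<in>Vm \<phi> m. normn w n x (\<lambda>y. f y - lincomb m \<phi> c y) \<le> normn w n x (\<lambda>y. f y - g' y))"
    proof -
      have "normn w n x (\<lambda>y. f y - lincomb m \<phi> c y) \<le> normn w n x (\<lambda>y. f y - lincomb m \<phi> d y)" for d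
        unfolding norm_le c[of d] by (simp add: sum_nonneg)
      then show ?thesis by (auto simp: Vm_eq)
    qed
  next
    fix g assume g: "g \<in> Vm \<phi> m \<and> (\<forall>g'\<in>Vm \<phi> m. normn w n x (\<lambda>y. f y - g y) \<le> normn w n x (\<lambda>y. f y - g' y))"
    then obtain d where d: "g = lincomb m \<phi> d" by (auto simp: Vm_eq)
    have "(\<Sum>i<n. (y i - ip m (a i) d)\<^sup>2) \<le> (\<Sum>i<n. (y i - ip m (a i) c)\<^sup>2)"
      using g unfolding d norm_le[symmetric] by (auto simp: Vm_eq)
    then have "(\<Sum>i<n. (ip m (a i) (\<lambda>j. c j - d j))\<^sup>2) = 0"
      using c[of d] sum_nonneg[of "{..<n}" "\<lambda>i. (ip m (a i) (\<lambda>j. c j - d j))\<^sup>2"] by simp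
    then have "nrm2 m (\<lambda>j. c j - d j) = 0"
      using inj[of "\<lambda>j. c j - d j"] nrm2_nonneg[of m "\<lambda>j. c j - d j"] by simp
    then have "\<forall>j<m. c j = d j" by (simp add: nrm2_def sum_nonneg_eq_0_iff)
    then show "g = lincomb m \<phi> c" by (simp add: d lincomb_def)
  qed
  moreover have "(\<Sum>i<n. (ip m (a i) (\<lambda>j. c j - d j))\<^sup>2) \<le> (\<Sum>i<n. (f (x i) - lincomb m \<phi> d (x i))\<^sup>2 / w (x i))" for d
    unfolding res c[of d] by (simp add: sum_nonneg)
  ultimately show thesis by (rule that)
qed

section \<open>The triangle inequality for \<open>L2norm\<close>\<close>

lemma L2norm_nonneg [simp]: "0 \<le> L2norm M f"
  by (simp add: L2norm_def)

lemma L2norm_sq: "(L2norm M f)\<^sup>2 = (\<integral>x. (f x)\<^sup>2 \<partial>M)"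
  by (simp add: L2norm_def)

text \<open>For positive \<open>p\<close>, \<open>q\<close> take s = q / p. If q = 0 a small
  \<open>s\<close>, and if p = 0 a large one, contradicts I > 0. This gives Cauchy--Schwarz for
  integrals without dividing by a norm that may vanish.\<close>

lemma le_mult_of_weighted_squares:
  fixes I p q :: real
  assumes "0 \<le> p" "0 \<le> q" and le: "\<And>s. 0 < s \<Longrightarrow> 2 * I \<le> s * p\<^sup>2 + q\<^sup>2 / s"
  shows "I \<le> p * q"
proof (cases "p = 0 \<or> q = 0")
  case False
  then show ?thesis using le[of "q / p"] assms by (simp add: power2_eq_square field_simps)
next
  case True
  show ?thesis
  proof (rule ccontr)
    assume "\<not> ?thesis"
    then have I: "0 < I" using True by auto
    have pos: "0 < z\<^sup>2 + 1" for z :: real by (simp add: add_nonneg_pos)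
    have frac: "I * z\<^sup>2 / (z\<^sup>2 + 1) \<le> I" for z
      unfolding pos_divide_le_eq[OF pos] using I by (simp add: algebra_simps)
    show False
    proof (cases "q = 0")
      case True
      have "2 * I \<le> I / (p\<^sup>2 + 1) * p\<^sup>2 + q\<^sup>2 / (I / (p\<^sup>2 + 1))"
        using I pos by (intro le divide_pos_pos)
      then show False using True frac[of p] I by simp
    next
      case False
      have "2 * I \<le> (q\<^sup>2 + 1) / I * p\<^sup>2 + q\<^sup>2 / ((q\<^sup>2 + 1) / I)"
        using I pos by (intro le divide_pos_pos)
      then show False using False True frac[of q] I by (simp add: mult.commute)
    qed
  qed
qed

lemma L2norm_add_le:
  assumes [measurable]: "u \<in> borel_measurable M" "g \<in> borel_measurable M"
    and int: "integrable M (\<lambda>x. (u x)\<^sup>2)" "integrable M (\<lambda>x. (g x)\<^sup>2)"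
  shows "L2norm M (\<lambda>x. u x + g x) \<le> L2norm M u + L2norm M g"
proof -
  define p where "p = L2norm M u"
  define q where "q = L2norm M g"
  have p: "0 \<le> p" "(\<integral>x. (u x)\<^sup>2 \<partial>M) = p\<^sup>2" and q: "0 \<le> q" "(\<integral>x. (g x)\<^sup>2 \<partial>M) = q\<^sup>2"
    by (simp_all add: p_def q_def L2norm_sq)
  have amgm: "2 * (u x * g x) \<le> s * (u x)\<^sup>2 + (1 / s) * (g x)\<^sup>2" if "0 < s" for s x
  proof -
    have "0 \<le> (s * u x - g x)\<^sup>2 / s" using that by simp
    then show ?thesis using that by (simp add: power2_eq_square field_simps)
  qed
  have int_ug: "integrable M (\<lambda>x. u x * g x)"
  proof (rule Bochner_Integration.integrable_bound)
    show "integrable M (\<lambda>x. (u x)\<^sup>2 + (g x)\<^sup>2)" using int by simp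
    show "AE x in M. norm (u x * g x) \<le> norm ((u x)\<^sup>2 + (g x)\<^sup>2)"
    proof (rule AE_I2)
      fix x
      have "2 * \<bar>u x * g x\<bar> \<le> \<bar>u x\<bar>\<^sup>2 + \<bar>g x\<bar>\<^sup>2"
        using sum_squares_bound[of "\<bar>u x\<bar>" "\<bar>g x\<bar>"] by (simp add: abs_mult)
      then show "norm (u x * g x) \<le> norm ((u x)\<^sup>2 + (g x)\<^sup>2)"
        using abs_ge_zero[of "u x * g x"] by (simp del: abs_ge_zero)
    qed
  qed measurable
  have cs: "2 * (\<integral>x. u x * g x \<partial>M) \<le> s * p\<^sup>2 + q\<^sup>2 / s" if "0 < s" for s
  proof -
    have "(\<integral>x. 2 * (u x * g x) \<partial>M) \<le> (\<integral>x. s * (u x)\<^sup>2 + (1 / s) * (g x)\<^sup>2 \<partial>M)"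
      using amgm[OF that] int int_ug by (intro integral_mono) auto
    then show ?thesis using int by (simp add: p q)
  qed
  have "(\<integral>x. u x * g x \<partial>M) \<le> p * q"
    using p(1) q(1) cs by (rule le_mult_of_weighted_squares)
  then have "(L2norm M (\<lambda>x. u x + g x))\<^sup>2 \<le> (p + q)\<^sup>2"
    unfolding L2norm_sq power2_sum using int int_ug p q
    by (simp add: mult.assoc)
  then show ?thesis
    using p q power2_le_imp_le unfolding p_def[symmetric] q_def[symmetric] by (meson add_nonneg_nonneg)
qed

lemma transpose_PhiMat_mult:
  "transpose_mat (PhiMat \<phi> m w n x) * PhiMat \<phi> m w n x = gram_mat m n (\<lambda>i j. \<phi> j (x i) / sqrt (w (x i)))"
  by (intro eq_matI) (auto simp: PhiMat_def gram_mat_def scalar_prod_def lessThan_atLeast0)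

lemma mat_qf_GramMat:
  "mat_qf m (GramMat \<phi> m w n x) c = (1 / real n) * (\<Sum>i<n. (ip m (\<lambda>j. \<phi> j (x i) / sqrt (w (x i))) c)\<^sup>2)"
proof -
  have "mat_qf m (GramMat \<phi> m w n x) c
    = (1 / real n) * mat_qf m (gram_mat m n (\<lambda>i j. \<phi> j (x i) / sqrt (w (x i)))) c"
    unfolding qform_def GramMat_def transpose_PhiMat_mult sum_distrib_left
    by (intro sum.cong refl) (simp add: gram_mat_def)
  then show ?thesis by (simp add: mat_qf_gram_mat)
qed

lemma lambda_min_GramMat_le:
  assumes "0 < m"
  shows "lambda_min (GramMat \<phi> m w n x) * nrm2 m c
    \<le> (1 / real n) * (\<Sum>i<n. (ip m (\<lambda>j. \<phi> j (x i) / sqrt (w (x i))) c)\<^sup>2)"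
  unfolding mat_qf_GramMat[symmetric] using assms
  by (intro lambda_min_le_qform) (auto simp: GramMat_def transpose_PhiMat_mult gram_mat_def mult.commute)

section \<open>The sampling law and its first block\<close>

locale weighted_sampling = prob_space \<mu>
  for \<mu> :: "'a measure" +
  fixes \<phi> :: "nat \<Rightarrow> 'a \<Rightarrow> real" and m nb r :: nat and h w :: "'a \<Rightarrow> real" and \<alpha> :: real
  assumes m_pos: "0 < m" and m_less: "m < nb" and r_pos: "1 \<le> r"
    and phi_meas: "j < m \<Longrightarrow> \<phi> j \<in> borel_measurable \<mu>"
    and phi_int: "i < m \<Longrightarrow> j < m \<Longrightarrow> integrable \<mu> (\<lambda>x. \<phi> i x * \<phi> j x)"
    and phi_orth: "i < m \<Longrightarrow> j < m \<Longrightarrow> (\<integral>x. \<phi> i x * \<phi> j x \<partial>\<mu>) = (if i = j then 1 else 0)"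
    and h_meas [measurable]: "h \<in> borel_measurable \<mu>" and h_pos: "0 < h x"
    and h_prob: "integrable \<mu> h" "(\<integral>x. h x \<partial>\<mu>) = 1"
    and alpha: "0 < \<alpha>" "\<alpha> < 1"
    and w_def: "w x = \<alpha> * wm \<phi> m x + (1 - \<alpha>) * h x"
begin

abbreviation "\<nu> \<equiv> density \<mu> (\<lambda>x. ennreal (w x))"

definition vec :: "'a \<Rightarrow> nat \<Rightarrow> real" where
  "vec x j = \<phi> j x / sqrt (w x)"

abbreviation "\<gamma> \<equiv> gammaDPP \<mu> \<phi> m w nb"
abbreviation "P \<equiv> gammaProd \<mu> \<phi> m w nb r"
abbreviation "n \<equiv> nb * r"

lemma n_pos: "0 < n"
  using m_pos m_less r_pos by simp

lemma wm_nonneg: "0 \<le> wm \<phi> m x"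
  by (simp add: wm_def sum_nonneg)

lemma w_ge: "(1 - \<alpha>) * h x \<le> w x" "\<alpha> * wm \<phi> m x \<le> w x"
  using alpha wm_nonneg[of x] h_pos[of x] by (simp_all add: w_def)

lemma w_pos: "0 < w x"
  using w_ge(1)[of x] alpha h_pos[of x] by (smt (verit) mult_pos_pos)

lemma wm_integral: "integrable \<mu> (wm \<phi> m)" "(\<integral>x. wm \<phi> m x \<partial>\<mu>) = 1"
proof -
  have eq: "wm \<phi> m = (\<lambda>x. (1 / real m) * (\<Sum>j<m. \<phi> j x * \<phi> j x))"
    by (simp add: wm_def fun_eq_iff power2_eq_square)
  have int: "integrable \<mu> (\<lambda>x. \<Sum>j<m. \<phi> j x * \<phi> j x)"
    by (rule Bochner_Integration.integrable_sum) (simp add: phi_int)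
  show "integrable \<mu> (wm \<phi> m)" unfolding eq using int by (rule integrable_mult_right)
  have "(\<integral>x. (\<Sum>j<m. \<phi> j x * \<phi> j x) \<partial>\<mu>) = (\<Sum>j<m. \<integral>x. \<phi> j x * \<phi> j x \<partial>\<mu>)"
    by (rule Bochner_Integration.integral_sum) (simp add: phi_int)
  also have "\<dots> = real m" by (simp add: phi_orth)
  finally show "(\<integral>x. wm \<phi> m x \<partial>\<mu>) = 1" unfolding eq using m_pos by simp
qed

lemma w_integral: "integrable \<mu> w" "(\<integral>x. w x \<partial>\<mu>) = 1"
  using wm_integral h_prob by (simp_all add: w_def[abs_def] wm_integral h_prob)

lemma w_meas [measurable]: "w \<in> borel_measurable \<mu>"
  using w_integral(1) by (rule borel_measurable_integrable)

lemma vec_meas: "j < m \<Longrightarrow> (\<lambda>x. vec x j) \<in> borel_measurable \<mu>"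
  unfolding vec_def using phi_meas[of j] w_meas by measurable

lemma vec_mult: "vec x i * vec x j = \<phi> i x * \<phi> j x / w x"
  using w_pos[of x] by (simp add: vec_def)

lemma prob_space_nu: "prob_space \<nu>"
proof
  have "emeasure \<nu> (space \<nu>) = (\<integral>\<^sup>+x. ennreal (w x) \<partial>\<mu>)"
    by (simp add: emeasure_density)
  also have "\<dots> = ennreal (\<integral>x. w x \<partial>\<mu>)"
    using w_pos w_integral(1) by (intro nn_integral_eq_integral AE_I2) (auto intro: less_imp_le)
  finally show "emeasure \<nu> (space \<nu>) = 1" by (simp add: w_integral)
qed

text \<open>The factor 1 / w from \<open>vec\<close> cancels the density of \<nu>, which gives
  isotropy; the squared norm is m wm / w <= m / \<alpha>.\<close>

sublocale vs: volume_sample \<nu> vec m "real m / \<alpha>" nb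
proof -
  interpret nu: prob_space \<nu> by (rule prob_space_nu)
  show "volume_sample \<nu> vec m (real m / \<alpha>) nb"
  proof
    fix i j assume ij: "i < m" "j < m"
    have m: "(\<lambda>x. vec x i * vec x j) \<in> borel_measurable \<mu>" using vec_meas ij by simp
    have eq: "(\<lambda>x. w x * (vec x i * vec x j)) = (\<lambda>x. \<phi> i x * \<phi> j x)"
      using w_pos by (simp add: vec_mult fun_eq_iff) (metis less_irrefl)
    show "integrable \<nu> (\<lambda>x. vec x i * vec x j)"
      using m w_pos phi_int[OF ij] by (subst integrable_density) (auto simp: eq less_imp_le)
    show "(\<integral>x. vec x i * vec x j \<partial>\<nu>) = (if i = j then 1 else 0)"
      using m w_pos phi_orth[OF ij] by (subst integral_density) (auto simp: eq less_imp_le)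
  next
    fix x
    have "nrm2 m (vec x) = (real m * wm \<phi> m x) / w x"
      using w_pos[of x] m_pos by (simp add: nrm2_def vec_def wm_def power_divide sum_divide_distrib[symmetric])
    also have "\<dots> \<le> real m / \<alpha>"
      using w_ge(2)[of x] w_pos[of x] alpha mult_left_mono[OF w_ge(2)[of x], of "real m"]
      by (simp add: field_simps)
    finally show "nrm2 m (vec x) \<le> real m / \<alpha>" .
  qed (use vec_meas m_pos m_less alpha in auto)
qed

lemma gammaDPP_eq: "\<gamma> = density (PiM {..<nb} (\<lambda>_. \<nu>)) (\<lambda>x. ennreal (fact (nb - m) / fact nb * det (vs.gram x)))"
  unfolding gammaDPP_def transpose_PhiMat_mult vs.gram_def vec_def ..

lemma gamma_density_meas: "(\<lambda>x. ennreal (fact (nb - m) / fact nb * det (vs.gram x))) \<in> borel_measurable (PiM {..<nb} (\<lambda>_. \<nu>))"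
  using vs.measurable_det_gram by measurable

lemma prob_space_gamma: "prob_space \<gamma>"
proof
  let ?C = "fact (nb - m) / fact nb :: real"
  have "emeasure \<gamma> (space \<gamma>) = (\<integral>\<^sup>+x. ennreal (?C * det (vs.gram x)) \<partial>PiM {..<nb} (\<lambda>_. \<nu>))"
    unfolding gammaDPP_eq using gamma_density_meas
    by (subst emeasure_density) (auto intro!: nn_integral_cong)
  also have "\<dots> = (\<integral>\<^sup>+x. ennreal ?C * ennreal (det (vs.gram x)) \<partial>PiM {..<nb} (\<lambda>_. \<nu>))"
    by (intro nn_integral_cong ennreal_mult vs.det_gram_nonneg) simp
  also have "\<dots> = ennreal ?C * ennreal (fact nb / fact (nb - m))"
    using vs.measurable_det_gram by (simp add: nn_integral_cmult vs.nn_integral_det_gram)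
  also have "\<dots> = 1"
    by (simp flip: ennreal_mult)
  finally show "emeasure \<gamma> (space \<gamma>) = 1" .
qed

lemma sets_gamma: "sets \<gamma> = sets (PiM {..<nb} (\<lambda>_. \<mu>))"
  unfolding gammaDPP_eq sets_density by (intro sets_PiM_cong) auto

lemma space_gamma: "space \<gamma> = space (PiM {..<nb} (\<lambda>_. \<mu>))"
  by (rule sets_eq_imp_space_eq[OF sets_gamma])

definition blocks :: "(nat \<Rightarrow> nat \<Rightarrow> 'a) \<Rightarrow> nat \<Rightarrow> 'a" where
  "blocks y = restrict (\<lambda>i. y (i div nb) (i mod nb)) {..<n}"

lemma P_eq: "P = distr (PiM {..<r} (\<lambda>_. \<gamma>)) (PiM {..<n} (\<lambda>_. \<mu>)) blocks"
  by (simp add: gammaProd_def blocks_def[abs_def])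

lemma div_mod_less: "i < n \<Longrightarrow> i div nb < r" "i < n \<Longrightarrow> i mod nb < nb"
  using m_less by (auto simp: less_mult_imp_div_less mult.commute)

lemma measurable_blocks: "blocks \<in> measurable (PiM {..<r} (\<lambda>_. \<gamma>)) (PiM {..<n} (\<lambda>_. \<mu>))"
  unfolding blocks_def[abs_def]
proof (rule measurable_restrict)
  fix i assume "i \<in> {..<n}"
  then have i: "i div nb \<in> {..<r}" "i mod nb \<in> {..<nb}" using div_mod_less by auto
  have "(\<lambda>x. x (i mod nb)) \<in> measurable \<gamma> \<mu>"
    using measurable_component_singleton[OF i(2), of "\<lambda>_. \<mu>"] sets_gamma by (simp cong: measurable_cong_sets)
  from measurable_compose[OF measurable_component_singleton[OF i(1), of "\<lambda>_. \<gamma>"] this]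
  show "(\<lambda>x. x (i div nb) (i mod nb)) \<in> measurable (PiM {..<r} (\<lambda>_. \<gamma>)) \<mu>" .
qed

lemma prob_space_P: "prob_space P"
proof -
  have "prob_space (PiM {..<r} (\<lambda>_. \<gamma>))"
    by (intro prob_space_PiM prob_space_gamma)
  then show ?thesis unfolding P_eq using measurable_blocks by (rule prob_space.prob_space_distr)
qed

text \<open>Each point of \<open>P\<close> is one coordinate of one block, and the block law has a
  density with respect to a power of \<nu>, which in turn has a density with respect to
  \<mu>.\<close>

lemma AE_P_component:
  assumes i: "i < n" and Q [measurable]: "Measurable.pred \<mu> Q" and ae: "AE x in \<mu>. Q x"
  shows "AE x in P. Q (x i)"
proof -
  have "AE x in \<nu>. Q x"
    using ae by (subst AE_density) auto
  then have "AE x in PiM {..<nb} (\<lambda>_. \<nu>). Q (x (i mod nb))"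
    using div_mod_less[OF i] by (intro AE_PiM_component) (auto intro: prob_space_nu)
  then have "AE x in \<gamma>. Q (x (i mod nb))"
    unfolding gammaDPP_eq using gamma_density_meas by (subst AE_density) auto
  then have "AE y in PiM {..<r} (\<lambda>_. \<gamma>). Q (y (i div nb) (i mod nb))"
    using div_mod_less[OF i] by (intro AE_PiM_component prob_space_gamma) auto
  then have "AE y in PiM {..<r} (\<lambda>_. \<gamma>). Q (blocks y i)"
    using i by (simp add: blocks_def)
  moreover have "{x \<in> space (PiM {..<n} (\<lambda>_. \<mu>)). Q (x i)} \<in> sets (PiM {..<n} (\<lambda>_. \<mu>))"
  proof -
    have [measurable]: "(\<lambda>x. x i) \<in> measurable (PiM {..<n} (\<lambda>_. \<mu>)) \<mu>"
      using i by (intro measurable_component_singleton) simp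
    show ?thesis by measurable
  qed
  ultimately show ?thesis
    unfolding P_eq by (subst AE_distr_iff[OF measurable_blocks])
qed

lemma first_block:
  assumes "y \<in> space (PiM {..<r} (\<lambda>_. \<gamma>))"
  shows "restrict (blocks y) {..<nb} = y 0"
proof -
  have "y 0 \<in> space \<gamma>" using assms r_pos by (auto simp: space_PiM PiE_def Pi_def)
  then have "y 0 \<in> extensional {..<nb}" by (auto simp: space_gamma space_PiM PiE_def)
  moreover have "i < n" if "i < nb" for i using that r_pos by (metis less_le_trans mult.right_neutral mult_le_mono2)
  ultimately show ?thesis
    by (intro ext) (auto simp: blocks_def restrict_def extensional_def)
qed

lemma measurable_first_block: "(\<lambda>x. restrict x {..<nb}) \<in> measurable P \<gamma>"
proof -
  have "nb \<le> n" using r_pos by simp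
  then have "(\<lambda>x. restrict x {..<nb}) \<in> measurable (PiM {..<n} (\<lambda>_. \<mu>)) (PiM {..<nb} (\<lambda>_. \<mu>))"
    by (intro measurable_restrict_subset) auto
  then show ?thesis
    unfolding P_eq using sets_gamma by (simp cong: measurable_cong_sets)
qed

lemma distr_first_block: "distr P \<gamma> (\<lambda>x. restrict x {..<nb}) = \<gamma>"
proof -
  have "distr P \<gamma> (\<lambda>x. restrict x {..<nb})
     = distr (PiM {..<r} (\<lambda>_. \<gamma>)) \<gamma> ((\<lambda>x. restrict x {..<nb}) \<circ> blocks)"
    using measurable_first_block measurable_blocks unfolding P_eq
    by (subst distr_distr) (simp_all cong: measurable_cong_sets)
  also have "\<dots> = distr (PiM {..<r} (\<lambda>_. \<gamma>)) \<gamma> (\<lambda>y. y 0)"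
    by (intro distr_cong refl) (simp add: first_block)
  also have "\<dots> = \<gamma>"
    using distr_PiM_component[of "{..<r}" "\<lambda>_. \<gamma>" 0] prob_space_gamma r_pos by simp
  finally show ?thesis .
qed

text \<open>The density of \<open>\<gamma>\<close> vanishes where the determinant does.
  \<open>gram\<close> reads only the first \<open>nb\<close> points, so it can be evaluated on the
  whole sample.\<close>

lemma AE_P_det_gram_pos: "AE x in P. 0 < det (vs.gram x)"
proof -
  have "AE x in \<gamma>. 0 < det (vs.gram x)"
    unfolding gammaDPP_eq
  proof (subst AE_density[OF gamma_density_meas], rule AE_I2, rule impI)
    fix x assume "0 < ennreal (fact (nb - m) / fact nb * det (vs.gram x))"
    then show "0 < det (vs.gram x)" by (simp add: zero_less_mult_iff zero_less_divide_iff)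
  qed
  then have "AE x in distr P \<gamma> (\<lambda>x. restrict x {..<nb}). 0 < det (vs.gram x)"
    by (subst distr_first_block)
  then have "AE x in P. 0 < det (vs.gram (restrict x {..<nb}))"
    by (rule AE_distrD[OF measurable_first_block])
  moreover have "vs.gram (restrict x {..<nb}) = vs.gram x" for x
    by (auto simp: vs.gram_def gram_mat_def)
  ultimately show ?thesis by simp
qed

lemma nn_integral_first_block:
  assumes b: "b \<in> borel_measurable (PiM {..<nb} (\<lambda>_. \<nu>))"
  shows "(\<integral>\<^sup>+x. ennreal (b (restrict x {..<nb})) \<partial>P)
    = (\<integral>\<^sup>+x. ennreal (fact (nb - m) / fact nb * det (vs.gram x)) * ennreal (b x) \<partial>PiM {..<nb} (\<lambda>_. \<nu>))"
proof -
  have b': "(\<lambda>x. ennreal (b x)) \<in> borel_measurable (PiM {..<nb} (\<lambda>_. \<nu>))" using b by measurable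
  have b'': "(\<lambda>x. ennreal (b x)) \<in> borel_measurable \<gamma>"
    unfolding gammaDPP_eq using b' by simp
  have "(\<integral>\<^sup>+x. ennreal (b (restrict x {..<nb})) \<partial>P) = (\<integral>\<^sup>+x. ennreal (b x) \<partial>distr P \<gamma> (\<lambda>x. restrict x {..<nb}))"
    using b'' by (intro nn_integral_distr[symmetric] measurable_first_block) simp
  also have "\<dots> = (\<integral>\<^sup>+x. ennreal (b x) \<partial>\<gamma>)" by (simp only: distr_first_block)
  also have "\<dots> = (\<integral>\<^sup>+x. ennreal (fact (nb - m) / fact nb * det (vs.gram x)) * ennreal (b x) \<partial>PiM {..<nb} (\<lambda>_. \<nu>))"
    unfolding gammaDPP_eq by (rule nn_integral_density[OF gamma_density_meas b'])
  finally show ?thesis .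
qed

section \<open>From a bound on the inverse Gram matrix to the projection error\<close>

lemma lincomb_meas: "lincomb m \<phi> c \<in> borel_measurable \<mu>"
  unfolding lincomb_def
  by (intro borel_measurable_sum borel_measurable_times borel_measurable_const phi_meas) simp

lemma lincomb_integral:
  "integrable \<mu> (\<lambda>x. (lincomb m \<phi> c x)\<^sup>2)" "L2norm \<mu> (lincomb m \<phi> c) = sqrt (nrm2 m c)"
proof -
  have eq: "(lincomb m \<phi> c x)\<^sup>2 = (\<Sum>i<m. \<Sum>j<m. (c i * c j) * (\<phi> i x * \<phi> j x))" for x
    by (simp add: lincomb_def power2_eq_square sum_product mult_ac)
  show "integrable \<mu> (\<lambda>x. (lincomb m \<phi> c x)\<^sup>2)"
    unfolding eq using phi_int by (intro integral_double_sum) auto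
  have "(\<integral>x. (lincomb m \<phi> c x)\<^sup>2 \<partial>\<mu>) = (\<Sum>i<m. \<Sum>j<m. (c i * c j) * (\<integral>x. \<phi> i x * \<phi> j x \<partial>\<mu>))"
    unfolding eq using phi_int by (intro integral_double_sum) auto
  also have "\<dots> = (\<Sum>i<m. \<Sum>j<m. if j = i then (c i)\<^sup>2 else 0)"
    by (intro sum.cong refl) (auto simp: phi_orth power2_eq_square)
  finally show "L2norm \<mu> (lincomb m \<phi> c) = sqrt (nrm2 m c)"
    by (simp add: L2norm_def nrm2_def)
qed

text \<open>The fitted function minus g is the projection of u = f - g. Its squared coefficient norm
  is at most \<open>b\<close> times the weighted sum of squares of u, in which each point
  contributes at most A^2 / (1 - \<alpha>).\<close>

lemma wls_error_le:
  assumes "\<And>c. nrm2 m c \<le> b * (\<Sum>i<n. (ip m (vec (x i)) c)\<^sup>2)" and b: "0 \<le> b"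
    and u_def: "u = (\<lambda>y. f y - lincomb m \<phi> d y)"
    and u: "u \<in> borel_measurable \<mu>" "integrable \<mu> (\<lambda>x. (u x)\<^sup>2)"
    and sup: "\<And>i. i < n \<Longrightarrow> \<bar>u (x i)\<bar> / sqrt (h (x i)) \<le> A"
  shows "L2norm \<mu> (\<lambda>y. f y - wls \<phi> m w n x f y) \<le> L2norm \<mu> u + sqrt (b * (real n * (A\<^sup>2 / (1 - \<alpha>))))"
proof -
  have v: "vec (x i) = (\<lambda>j. \<phi> j (x i) / sqrt (w (x i)))" for i
    by (simp add: vec_def fun_eq_iff)
  obtain c where c: "wls \<phi> m w n x f = lincomb m \<phi> c"
    "\<And>d. (\<Sum>i<n. (ip m (vec (x i)) (\<lambda>j. c j - d j))\<^sup>2) \<le> (\<Sum>i<n. (f (x i) - lincomb m \<phi> d (x i))\<^sup>2 / w (x i))"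
    using n_pos w_pos assms(1) unfolding v by (rule wls_eq_lincomb[where n = n and w = w and m = m and \<phi> = \<phi> and x = x and b = b and f = f])
       (rule that[unfolded v])
  have "(u z)\<^sup>2 / w z \<le> A\<^sup>2 / (1 - \<alpha>)" if "\<bar>u z\<bar> / sqrt (h z) \<le> A" for z
  proof -
    have "(u z)\<^sup>2 / w z \<le> (u z)\<^sup>2 / ((1 - \<alpha>) * h z)"
      using w_ge(1)[of z] w_pos[of z] h_pos[of z] alpha by (intro divide_left_mono) auto
    also have "\<dots> = (\<bar>u z\<bar> / sqrt (h z))\<^sup>2 / (1 - \<alpha>)"
      using h_pos[of z] by (simp add: power_divide mult.commute less_imp_le)
    also have "\<dots> \<le> A\<^sup>2 / (1 - \<alpha>)"
      using that alpha h_pos[of z] by (intro divide_right_mono power_mono) (auto simp: less_imp_le)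
    finally show ?thesis .
  qed
  then have "(\<Sum>i<n. (u (x i))\<^sup>2 / w (x i)) \<le> (\<Sum>i<n. A\<^sup>2 / (1 - \<alpha>))"
    using sup by (intro sum_mono) auto
  then have "(\<Sum>i<n. (ip m (vec (x i)) (\<lambda>j. c j - d j))\<^sup>2) \<le> real n * (A\<^sup>2 / (1 - \<alpha>))"
    using c(2)[of d] by (simp add: u_def)
  then have nrm: "nrm2 m (\<lambda>j. c j - d j) \<le> b * (real n * (A\<^sup>2 / (1 - \<alpha>)))"
    using assms(1) b by (meson mult_left_mono order_trans)
  have nrm': "nrm2 m (\<lambda>j. d j - c j) = nrm2 m (\<lambda>j. c j - d j)"
    by (simp add: nrm2_def power2_commute)
  have "(\<lambda>y. f y - wls \<phi> m w n x f y) = (\<lambda>y. u y + lincomb m \<phi> (\<lambda>j. d j - c j) y)"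
    by (simp add: c(1) u_def lincomb_def fun_eq_iff algebra_simps sum_subtractf)
  then have "L2norm \<mu> (\<lambda>y. f y - wls \<phi> m w n x f y) \<le> L2norm \<mu> u + L2norm \<mu> (lincomb m \<phi> (\<lambda>j. d j - c j))"
    using L2norm_add_le[OF u(1) lincomb_meas u(2) lincomb_integral(1)] by simp
  also have "L2norm \<mu> (lincomb m \<phi> (\<lambda>j. d j - c j)) \<le> sqrt (b * (real n * (A\<^sup>2 / (1 - \<alpha>))))"
    unfolding lincomb_integral nrm' using nrm by (rule real_sqrt_le_mono)
  finally show ?thesis by simp
qed

end

section \<open>The error bounds\<close>

text \<open>This is ln y < y - 1 at y = 1 / (1 - \<delta>).\<close>

lemma c_delta_pos:
  assumes "0 < \<delta>" "\<delta> < 1"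
  shows "0 < c_delta \<delta>"
proof -
  have "ln (1 + (1 / (1 - \<delta>) - 1)) < 1 / (1 - \<delta>) - 1"
    using assms by (intro ln_add_one_self_less_self) (simp add: field_simps)
  then have "ln (1 / (1 - \<delta>)) < 1 / (1 - \<delta>) - 1" by simp
  then have "(1 - \<delta>) * ln (1 / (1 - \<delta>)) < (1 - \<delta>) * (1 / (1 - \<delta>) - 1)"
    using assms by simp
  moreover have "(1 - \<delta>) * (1 / (1 - \<delta>) - 1) = \<delta>"
    using assms by (simp add: field_simps)
  ultimately show ?thesis
    using assms by (simp add: c_delta_def ln_div)
qed

text \<open>The infimum need not be attained, and only countably many g can share a null set; hence
  a minimizing sequence. Taking g = 0 shows that the infimum is finite, as \<open>f\<close> lies in
  \<open>H\<close>.\<close>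

lemma INF_normHe_sequence:
  assumes "f \<in> H" and nonneg: "\<forall>u\<in>H. 0 \<le> nH u"
  obtains a :: "nat \<Rightarrow> real" and c :: "nat \<Rightarrow> nat \<Rightarrow> real" and A :: real where
    "\<And>k. (\<lambda>y. f y - lincomb m \<phi> (c k) y) \<in> H"
    "\<And>k. nH (\<lambda>y. f y - lincomb m \<phi> (c k) y) = a k"
    "a \<longlonglongrightarrow> A" "0 \<le> A" "(INF g\<in>Vm \<phi> m. normHe H nH (\<lambda>y. f y - g y)) = ennreal A"
proof -
  define X where "X = {nH (\<lambda>y. f y - lincomb m \<phi> c y) | c. (\<lambda>y. f y - lincomb m \<phi> c y) \<in> H}"
  define A where "A = Inf X"
  have f0: "(\<lambda>y. f y - lincomb m \<phi> (\<lambda>_. 0) y) = f" by (simp add: lincomb_def)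
  have "nH f \<in> X"
    unfolding X_def using assms(1) f0 by (intro CollectI exI[of _ "\<lambda>_. 0"]) simp
  then have ne: "X \<noteq> {}" by auto
  have X0: "0 \<le> x" if "x \<in> X" for x using that nonneg by (auto simp: X_def)
  then have bdd: "bdd_below X" by (intro bdd_belowI[of _ 0])
  have A0: "0 \<le> A" unfolding A_def using ne X0 by (intro cInf_greatest)
  have "\<exists>c. (\<lambda>y. f y - lincomb m \<phi> c y) \<in> H \<and> nH (\<lambda>y. f y - lincomb m \<phi> c y) < A + 1 / real (Suc k)" for k
  proof -
    have "Inf X < A + 1 / real (Suc k)" by (simp add: A_def)
    then obtain x where "x \<in> X" "x < A + 1 / real (Suc k)"
      using cInf_lessD[OF ne] by blast
    then show ?thesis by (auto simp: X_def)
  qed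
  then obtain c where cH: "\<And>k. (\<lambda>y. f y - lincomb m \<phi> (c k) y) \<in> H"
    and c: "\<And>k. nH (\<lambda>y. f y - lincomb m \<phi> (c k) y) < A + 1 / real (Suc k)"
    by metis
  define a where "a k = nH (\<lambda>y. f y - lincomb m \<phi> (c k) y)" for k
  have aX: "a k \<in> X" for k using cH by (auto simp: X_def a_def)
  have low: "A \<le> a k" for k unfolding A_def using aX bdd by (rule cInf_lower)
  have lim: "a \<longlonglongrightarrow> A"
  proof (rule real_tendsto_sandwich[of "\<lambda>_. A" a _ "\<lambda>k. A + 1 / real (Suc k)"])
    show "(\<lambda>k. A + 1 / real (Suc k)) \<longlonglongrightarrow> A" by real_asymp
  qed (use low less_imp_le[OF c] in \<open>auto simp: a_def\<close>)
  let ?D = "INF g\<in>Vm \<phi> m. normHe H nH (\<lambda>y. f y - g y)"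
  have "ennreal A \<le> ?D"
  proof (rule INF_greatest)
    fix g assume "g \<in> Vm \<phi> m"
    then obtain d where d: "g = lincomb m \<phi> d" by (auto simp: Vm_eq)
    show "ennreal A \<le> normHe H nH (\<lambda>y. f y - g y)"
    proof (cases "(\<lambda>y. f y - g y) \<in> H")
      case True
      then have "nH (\<lambda>y. f y - g y) \<in> X" by (auto simp: X_def d)
      then have "A \<le> nH (\<lambda>y. f y - g y)" unfolding A_def using bdd by (rule cInf_lower)
      then show ?thesis using True by (simp add: normHe_def ennreal_leI)
    qed (simp add: normHe_def)
  qed
  moreover have "?D \<le> ennreal (a k)" for k
    using cH[of k] by (intro INF_lower2[of "lincomb m \<phi> (c k)"]) (auto simp: Vm_eq normHe_def a_def)
  then have "?D \<le> ennreal A"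
    using tendsto_ennrealI[OF lim] by (intro LIMSEQ_le_const[of "\<lambda>k. ennreal (a k)"]) auto
  ultimately have "?D = ennreal A" by (intro antisym)
  with cH a_def lim A0 show thesis by (intro that) auto
qed

theorem mainTheorem18:
  fixes \<mu> :: "'a::polish_space measure"
    and \<phi> :: "nat \<Rightarrow> 'a \<Rightarrow> real" and m :: nat
    and H :: "('a \<Rightarrow> real) set" and nH :: "('a \<Rightarrow> real) \<Rightarrow> real" and C_H :: real
    and h :: "'a \<Rightarrow> real" and f :: "'a \<Rightarrow> real"
    and \<alpha> \<delta> :: real and r nbar n :: nat
    and w :: "'a \<Rightarrow> real" and P :: "(nat \<Rightarrow> 'a) measure" and S :: "(nat \<Rightarrow> 'a) set"
  assumes mu: "prob_space \<mu>" "sets \<mu> = sets borel"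
    and m_pos: "0 < m"
    and phi_meas: "\<forall>j<m. \<phi> j \<in> borel_measurable \<mu>"
    and phi_orth: "\<forall>i<m. \<forall>j<m. integrable \<mu> (\<lambda>x. \<phi> i x * \<phi> j x) \<and>
                     (\<integral>x. \<phi> i x * \<phi> j x \<partial>\<mu>) = (if i = j then 1 else 0)"
    and H_zero: "(\<lambda>x. 0) \<in> H"
    and H_add: "\<forall>u\<in>H. \<forall>v\<in>H. (\<lambda>x. u x + v x) \<in> H"
    and H_scale: "\<forall>c. \<forall>u\<in>H. (\<lambda>x. c * u x) \<in> H"
    and nH_nonneg: "\<forall>u\<in>H. 0 \<le> nH u"
    and nH_scale: "\<forall>c. \<forall>u\<in>H. nH (\<lambda>x. c * u x) = \<bar>c\<bar> * nH u"
    and nH_triangle: "\<forall>u\<in>H. \<forall>v\<in>H. nH (\<lambda>x. u x + v x) \<le> nH u + nH v"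
    and nH_definite: "\<forall>u\<in>H. nH u = 0 \<longrightarrow> u = (\<lambda>x. 0)"
    and H_L2: "\<forall>u\<in>H. u \<in> borel_measurable \<mu> \<and> integrable \<mu> (\<lambda>x. (u x)^2) \<and>
                  L2norm \<mu> u \<le> C_H * nH u"
    and H_sup: "\<forall>u\<in>H. (AE x in \<mu>. \<bar>u x\<bar> / sqrt (h x) \<le> nH u)"
    and h_meas: "h \<in> borel_measurable \<mu>"
    and h_pos: "\<forall>x. 0 < h x"
    and h_prob: "integrable \<mu> h" "(\<integral>x. h x \<partial>\<mu>) = 1"
    and f_in: "f \<in> H"
    and alpha: "0 < \<alpha>" "\<alpha> < 1"
    and r_pos: "1 \<le> r"
    and nbar_gt: "m < nbar"
    and delta: "0 < \<delta>" "\<delta> < 1"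
    and w_def: "w = (\<lambda>x. \<alpha> * wm \<phi> m x + (1 - \<alpha>) * h x)"
    and n_def: "n = nbar * r"
    and P_def: "P = gammaProd \<mu> \<phi> m w nbar r"
    and S_def: "S = {x \<in> space P. 1 - \<delta> \<le> lambda_min (GramMat \<phi> m w n x)}"
  shows "(\<exists>A\<in>sets P. A \<subseteq> {x \<in> space P.
            ennreal (L2norm \<mu> (\<lambda>y. f y - wls \<phi> m w n x f y))
              \<le> ennreal (C_H + 1 / sqrt (1 - \<delta>) * (1 / sqrt (1 - \<alpha>)))
                 * (INF g\<in>Vm \<phi> m. normHe H nH (\<lambda>y. f y - g y))}
          \<and> measure P S \<le> measure P A)
       \<and> (real nbar \<ge> real m + 1 / c_delta \<delta> * (1 / \<alpha>) * real m * ln (real n * (real m)^2) \<longrightarrow>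
          (\<integral>\<^sup>+ x. ennreal ((L2norm \<mu> (\<lambda>y. f y - wls \<phi> m w n x f y))^2) \<partial>P)
            \<le> ennreal (2 * C_H^2 + 2 * (1 / (1 - \<alpha>)) * real r *
                       (1 + 1 / (1 - real m / real nbar) * (1 / (1 - \<delta>))))
               * (INF g\<in>Vm \<phi> m. normHe H nH (\<lambda>y. f y - g y))^2)"
proof -
  interpret prob_space \<mu> by (rule mu)
  interpret ws: weighted_sampling \<mu> \<phi> m nbar r h w \<alpha>
    using m_pos nbar_gt r_pos phi_meas phi_orth h_meas h_pos h_prob alpha w_def
    by unfold_locales auto
  have n_pos: "0 < n" using ws.n_pos by (simp add: n_def)
  interpret P: prob_space P unfolding P_def by (rule ws.prob_space_P)
  have sets_P: "sets P = sets (PiM {..<n} (\<lambda>_. \<mu>))"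
    unfolding P_def ws.P_eq n_def by simp
  obtain a c A where cH: "\<And>k. (\<lambda>y. f y - lincomb m \<phi> (c k) y) \<in> H"
    and a: "\<And>k. nH (\<lambda>y. f y - lincomb m \<phi> (c k) y) = a k"
    and lim: "a \<longlonglongrightarrow> A" and A0: "0 \<le> A"
    and INF_eq: "(INF g\<in>Vm \<phi> m. normHe H nH (\<lambda>y. f y - g y)) = ennreal A"
    by (rule INF_normHe_sequence[OF f_in nH_nonneg, where m = m and \<phi> = \<phi>]) (rule that)
  define u where "u k = (\<lambda>y. f y - lincomb m \<phi> (c k) y)" for k
  have uH: "u k \<in> H" and ua: "nH (u k) = a k" for k
    using cH a by (simp_all add: u_def)
  have u_meas: "u k \<in> borel_measurable \<mu>" and u_int: "integrable \<mu> (\<lambda>x. (u k x)\<^sup>2)"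
    and u_L2: "L2norm \<mu> (u k) \<le> C_H * a k" for k
    using H_L2 uH[of k] ua[of k] by auto
  have a0: "0 \<le> a k" for k using nH_nonneg uH[of k] ua[of k] by metis
  have ratio_meas: "(\<lambda>x. \<bar>u k x\<bar> / sqrt (h x)) \<in> borel_measurable \<mu>" for k
  proof -
    note [measurable] = u_meas[of k] h_meas
    show ?thesis by measurable
  qed
  \<comment> \<open>At a fixed sample the limit in \<open>k\<close> is taken, so one null set has to
    serve all \<open>k\<close>.\<close>
  define good where "good x \<longleftrightarrow> (\<forall>k. \<forall>i<n. \<bar>u k (x i)\<bar> / sqrt (h (x i)) \<le> a k)" for x
  have good_AE: "AE x in P. good x"
    unfolding good_def AE_all_countable
  proof (intro allI)
    fix k i
    show "AE x in P. i < n \<longrightarrow> \<bar>u k (x i)\<bar> / sqrt (h (x i)) \<le> a k"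
    proof (cases "i < n")
      case True
      have "AE x in \<mu>. \<bar>u k x\<bar> / sqrt (h x) \<le> a k"
        using H_sup uH[of k] ua[of k] by auto
      moreover have "Measurable.pred \<mu> (\<lambda>x. \<bar>u k x\<bar> / sqrt (h x) \<le> a k)"
        using borel_measurable_le[OF ratio_meas borel_measurable_const] by (simp only: pred_def)
      ultimately have "AE x in P. \<bar>u k (x i)\<bar> / sqrt (h (x i)) \<le> a k"
        using True unfolding P_def n_def by (intro ws.AE_P_component)
      then show ?thesis by simp
    qed simp
  qed
  have good_sets: "{x \<in> space P. good x} \<in> sets P"
  proof -
    have comp: "(\<lambda>x. x i) \<in> measurable P \<mu>" if "i < n" for i
      unfolding measurable_cong_sets[OF sets_P refl] using that
      by (intro measurable_component_singleton) simp
    have "{x \<in> space P. \<bar>u k (x i)\<bar> / sqrt (h (x i)) \<le> a k} \<in> sets P" if "i < n" for k i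
    proof -
      from measurable_compose[OF comp[OF that] ratio_meas]
      show ?thesis by (intro borel_measurable_le borel_measurable_const)
    qed
    then have "{x \<in> space P. \<forall>k. \<forall>i\<in>{..<n}. \<bar>u k (x i)\<bar> / sqrt (h (x i)) \<le> a k} \<in> sets P"
      by (intro sets.sets_Collect_countable_All sets.sets_Collect_finite_All) auto
    then show ?thesis unfolding good_def by (simp only: Ball_def lessThan_iff)
  qed
  \<comment> \<open>Used twice: with a deterministic \<open>b\<close> on \<open>S\<close>, and with
    the random bound \<open>\<beta>\<close> for the mean.\<close>
  have error: "L2norm \<mu> (\<lambda>y. f y - wls \<phi> m w n x f y) \<le> C_H * a k + sqrt (b * (real n * ((a k)\<^sup>2 / (1 - \<alpha>))))"
    if "\<And>c. nrm2 m c \<le> b * (\<Sum>i<n. (ip m (ws.vec (x i)) c)\<^sup>2)" "0 \<le> b" "good x" for x b k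
  proof -
    have "L2norm \<mu> (\<lambda>y. f y - wls \<phi> m w n x f y) \<le> L2norm \<mu> (u k) + sqrt (b * (real n * ((a k)\<^sup>2 / (1 - \<alpha>))))"
      unfolding n_def
    proof (rule ws.wls_error_le[where d = "c k"])
      show "nrm2 m d \<le> b * (\<Sum>i<nbar * r. (ip m (ws.vec (x i)) d)\<^sup>2)" for d
        using that(1)[of d] by (simp add: n_def)
      show "\<bar>u k (x i)\<bar> / sqrt (h (x i)) \<le> a k" if "i < nbar * r" for i
        using \<open>good x\<close> that by (simp add: good_def n_def)
    qed (use that(2) u_meas u_int in \<open>simp_all add: u_def\<close>)
    then show ?thesis using u_L2[of k] by linarith
  qed

  define C where "C = C_H + 1 / sqrt (1 - \<delta>) * (1 / sqrt (1 - \<alpha>))"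
  have part1_pointwise: "ennreal (L2norm \<mu> (\<lambda>y. f y - wls \<phi> m w n x f y)) \<le> ennreal C * ennreal A"
    if "x \<in> S" "good x" for x
  proof -
    define b where "b = 1 / ((1 - \<delta>) * real n)"
    have "nrm2 m d \<le> b * (\<Sum>i<n. (ip m (ws.vec (x i)) d)\<^sup>2)" for d
    proof -
      have "(1 - \<delta>) * nrm2 m d \<le> lambda_min (GramMat \<phi> m w n x) * nrm2 m d"
        using that by (intro mult_right_mono) (auto simp: S_def)
      also have "\<dots> \<le> (1 / real n) * (\<Sum>i<n. (ip m (ws.vec (x i)) d)\<^sup>2)"
        unfolding ws.vec_def[abs_def] by (rule lambda_min_GramMat_le[OF m_pos])
      finally show ?thesis using delta n_pos by (simp add: b_def field_simps)
    qed
    then have le: "L2norm \<mu> (\<lambda>y. f y - wls \<phi> m w n x f y) \<le> C_H * a k + sqrt (b * (real n * ((a k)\<^sup>2 / (1 - \<alpha>))))" for k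
      using that delta by (intro error) (auto simp: b_def)
    have "sqrt (b * (real n * ((a k)\<^sup>2 / (1 - \<alpha>)))) = 1 / sqrt (1 - \<delta>) * (1 / sqrt (1 - \<alpha>)) * a k" for k
    proof -
      have "b * (real n * ((a k)\<^sup>2 / (1 - \<alpha>))) = (a k)\<^sup>2 / ((1 - \<delta>) * (1 - \<alpha>))"
        using n_pos by (simp add: b_def)
      then show ?thesis using a0[of k] by (simp add: real_sqrt_divide real_sqrt_mult)
    qed
    then have "L2norm \<mu> (\<lambda>y. f y - wls \<phi> m w n x f y) \<le> C * a k" for k
      using le[of k] by (simp add: C_def algebra_simps)
    moreover have "(\<lambda>k. C * a k) \<longlonglongrightarrow> C * A" using lim by (intro tendsto_intros)
    ultimately have "L2norm \<mu> (\<lambda>y. f y - wls \<phi> m w n x f y) \<le> C * A"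
      by (intro LIMSEQ_le_const) auto
    \<comment> \<open>\<open>C_H\<close> is an arbitrary real, so the sign of \<open>C\<close> is
      open; splitting the product relies on \<open>A\<close> being nonnegative.\<close>
    then have "ennreal (L2norm \<mu> (\<lambda>y. f y - wls \<phi> m w n x f y)) \<le> ennreal (C * A)"
      by (rule ennreal_leI)
    then show ?thesis using A0 by (simp add: ennreal_mult'')
  qed
  have part1: "\<exists>B\<in>sets P. B \<subseteq> {x \<in> space P.
      ennreal (L2norm \<mu> (\<lambda>y. f y - wls \<phi> m w n x f y)) \<le> ennreal C * ennreal A} \<and> measure P S \<le> measure P B"
  proof (cases "S \<in> sets P")
    case True
    define B where "B = S \<inter> {x \<in> space P. good x}"
    have B: "B \<in> sets P" using True good_sets by (simp add: B_def)
    have "measure P S = measure P B"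
      using good_AE True B by (intro measure_eq_AE) (auto simp: B_def S_def)
    moreover have "B \<subseteq> {x \<in> space P. ennreal (L2norm \<mu> (\<lambda>y. f y - wls \<phi> m w n x f y)) \<le> ennreal C * ennreal A}"
      using part1_pointwise by (auto simp: B_def)
    ultimately show ?thesis using B by auto
  next
    case False
    \<comment> \<open>A non-measurable set has measure 0 by convention, so \<open>S\<close> need not be shown measurable.\<close>
    then have "measure P S = 0" by (rule measure_notin_sets)
    then show ?thesis by (intro bexI[of _ "{}"]) auto
  qed

  \<comment> \<open>\<open>R\<close> will bound n times the mean of \<open>\<beta>\<close>: the
    summand 1 covers the Chernoff tail, the other one the well-conditioned case.\<close>
  define R where "R = real r * (1 + 1 / (1 - real m / real nbar) * (1 / (1 - \<delta>)))"
  define C2 where "C2 = 2 * C_H^2 + 2 * (1 / (1 - \<alpha>)) * R"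
  have R0: "0 \<le> R" using nbar_gt delta by (simp add: R_def)
  have C20: "0 \<le> C2" using R0 alpha by (simp add: C2_def)
  have part2: "(\<integral>\<^sup>+ x. ennreal ((L2norm \<mu> (\<lambda>y. f y - wls \<phi> m w n x f y))^2) \<partial>P) \<le> ennreal C2 * (ennreal A)\<^sup>2"
    if nbar_ge: "real nbar \<ge> real m + 1 / c_delta \<delta> * (1 / \<alpha>) * real m * ln (real n * (real m)^2)"
  proof -
    define N where "N = real (nbar - m)"
    have N: "0 < N" "N = real nbar - real m" using nbar_gt by (auto simp: N_def)
    define tailp where "tailp = exp (- (c_delta \<delta> * N / (real m / \<alpha>)))"
    obtain b where b_meas: "b \<in> borel_measurable (PiM {..<nbar} (\<lambda>_. ws.\<nu>))" and b0: "\<And>x. 0 \<le> b x"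
      and b_bound: "\<And>x c. 0 < det (ws.vs.gram x) \<Longrightarrow> nrm2 m c \<le> b x * mat_qf m (ws.vs.gram x) c"
      and b_int: "(\<integral>\<^sup>+x. ennreal (fact (nbar - m) / fact nbar * det (ws.vs.gram x)) * ennreal (b x) \<partial>PiM {..<nbar} (\<lambda>_. ws.\<nu>))
        \<le> ennreal (1 / (N * (1 - \<delta>)) + 2 * (real m)\<^sup>2 / real (nbar - m + 1) * tailp)"
      by (rule ws.vs.inverse_gram_bound[OF delta, folded N_def, folded tailp_def]) (rule that)
    define \<beta> where "\<beta> x = b (restrict x {..<nbar})" for x
    have \<beta>0: "0 \<le> \<beta> x" for x by (simp add: \<beta>_def b0)
    have tail_le: "real n * (1 / (N * (1 - \<delta>)) + 2 * (real m)\<^sup>2 / real (nbar - m + 1) * tailp) \<le> R"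
    proof -
      have "1 / c_delta \<delta> * (1 / \<alpha>) * real m * ln (real n * (real m)\<^sup>2) \<le> N"
        using nbar_ge N(2) by linarith
      then have "ln (real n * (real m)\<^sup>2) \<le> c_delta \<delta> * N / (real m / \<alpha>)"
        using c_delta_pos[OF delta] alpha m_pos by (simp add: field_simps)
      then have "tailp \<le> exp (- ln (real n * (real m)\<^sup>2))" by (simp add: tailp_def)
      also have "\<dots> = 1 / (real n * (real m)\<^sup>2)"
        using n_pos m_pos by (simp add: exp_minus field_simps)
      finally have "2 * (real n * (real m)\<^sup>2 * tailp) \<le> 2 * 1"
        using n_pos m_pos by (simp add: field_simps)
      \<comment> \<open>The factor 2 lost in the Chernoff step is absorbed here, because nbar >
        m.\<close>
      also have "\<dots> \<le> real (nbar - m + 1)" using nbar_gt by simp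
      also have "\<dots> \<le> real r * real (nbar - m + 1)" using r_pos by simp
      finally have "2 * (real n * (real m)\<^sup>2 * tailp) / real (nbar - m + 1) \<le> real r"
        by (subst pos_divide_le_eq) auto
      moreover have "real n * (1 / (N * (1 - \<delta>))) = real r * (1 / (1 - real m / real nbar) * (1 / (1 - \<delta>)))"
      proof -
        have "1 / (1 - real m / real nbar) = real nbar / N"
          using N(2) nbar_gt by (simp add: diff_divide_eq_iff)
        then show ?thesis by (simp add: n_def)
      qed
      ultimately show ?thesis by (simp add: R_def algebra_simps)
    qed
    have int_\<beta>: "ennreal (real n) * (\<integral>\<^sup>+x. ennreal (\<beta> x) \<partial>P) \<le> ennreal R"
    proof -
      have "(\<integral>\<^sup>+x. ennreal (\<beta> x) \<partial>P) \<le> ennreal (1 / (N * (1 - \<delta>)) + 2 * (real m)\<^sup>2 / real (nbar - m + 1) * tailp)"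
        using b_int unfolding \<beta>_def P_def ws.nn_integral_first_block[OF b_meas] .
      then have "ennreal (real n) * (\<integral>\<^sup>+x. ennreal (\<beta> x) \<partial>P)
         \<le> ennreal (real n) * ennreal (1 / (N * (1 - \<delta>)) + 2 * (real m)\<^sup>2 / real (nbar - m + 1) * tailp)"
        by (rule mult_left_mono) simp
      also have "\<dots> \<le> ennreal R"
        using tail_le by (subst ennreal_mult'[symmetric]) (auto intro: ennreal_leI)
      finally show ?thesis .
    qed
    have \<beta>_meas: "(\<lambda>x. ennreal (\<beta> x)) \<in> borel_measurable P"
    proof -
      have "b \<in> borel_measurable (gammaDPP \<mu> \<phi> m w nbar)"
        unfolding ws.gammaDPP_eq using b_meas by simp
      from measurable_compose[OF ws.measurable_first_block this]
      show ?thesis unfolding \<beta>_def P_def by measurable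
    qed
    have AE_bound: "AE x in P. (L2norm \<mu> (\<lambda>y. f y - wls \<phi> m w n x f y))\<^sup>2
        \<le> 2 * C_H\<^sup>2 * (a k)\<^sup>2 + 2 * (a k)\<^sup>2 / (1 - \<alpha>) * (real n * \<beta> x)" for k
    proof -
      have "AE x in P. 0 < det (ws.vs.gram x)" unfolding P_def by (rule ws.AE_P_det_gram_pos)
      with good_AE show ?thesis
      proof eventually_elim
        case (elim x)
        have gr: "ws.vs.gram (restrict x {..<nbar}) = ws.vs.gram x"
          by (auto simp: ws.vs.gram_def gram_mat_def)
        have "nrm2 m d \<le> \<beta> x * (\<Sum>i<n. (ip m (ws.vec (x i)) d)\<^sup>2)" for d
        proof -
          have "nrm2 m d \<le> \<beta> x * mat_qf m (ws.vs.gram x) d"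
            using b_bound[of "restrict x {..<nbar}" d] elim(2) unfolding gr \<beta>_def by simp
          \<comment> \<open>The remaining blocks only enlarge the sum of squares.\<close>
          also have "\<dots> \<le> \<beta> x * (\<Sum>i<n. (ip m (ws.vec (x i)) d)\<^sup>2)"
            unfolding ws.vs.gram_def mat_qf_gram_mat using r_pos
            by (intro mult_left_mono \<beta>0 sum_mono2) (auto simp: n_def intro: less_le_trans)
          finally show ?thesis .
        qed
        then have le: "L2norm \<mu> (\<lambda>y. f y - wls \<phi> m w n x f y) \<le> C_H * a k + sqrt (\<beta> x * (real n * ((a k)\<^sup>2 / (1 - \<alpha>))))"
          using \<beta>0 elim(1) by (rule error)
        define s where "s = sqrt (\<beta> x * (real n * ((a k)\<^sup>2 / (1 - \<alpha>))))"
        have s: "s\<^sup>2 = \<beta> x * (real n * ((a k)\<^sup>2 / (1 - \<alpha>)))"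
          unfolding s_def using \<beta>0 alpha by (intro real_sqrt_pow2) simp
        have "(L2norm \<mu> (\<lambda>y. f y - wls \<phi> m w n x f y))\<^sup>2 \<le> (C_H * a k + s)\<^sup>2"
          using le by (intro power_mono) (auto simp: s_def)
        \<comment> \<open>Origin of the two factors 2 in the claim.\<close>
        also have "\<dots> \<le> 2 * (C_H * a k)\<^sup>2 + 2 * s\<^sup>2"
          using sum_squares_bound[of "C_H * a k" s] by (simp add: power2_sum)
        finally show ?case unfolding s by (simp add: power_mult_distrib mult_ac)
      qed
    qed
    have "(\<integral>\<^sup>+ x. ennreal ((L2norm \<mu> (\<lambda>y. f y - wls \<phi> m w n x f y))^2) \<partial>P) \<le> ennreal (C2 * (a k)\<^sup>2)" for k
    proof -
      define p where "p = 2 * C_H\<^sup>2 * (a k)\<^sup>2"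
      define q where "q = 2 * (a k)\<^sup>2 / (1 - \<alpha>)"
      have p0: "0 \<le> p" and q0: "0 \<le> q" using alpha by (simp_all add: p_def q_def)
      have "(\<integral>\<^sup>+ x. ennreal ((L2norm \<mu> (\<lambda>y. f y - wls \<phi> m w n x f y))^2) \<partial>P)
        \<le> (\<integral>\<^sup>+ x. ennreal p + ennreal q * (ennreal (real n) * ennreal (\<beta> x)) \<partial>P)"
      \<comment> \<open>The error is not shown to be measurable in the sample; monotonicity of the
        nonnegative integral holds for arbitrary functions.\<close>
      proof (rule nn_integral_mono_AE)
        show "AE x in P. ennreal ((L2norm \<mu> (\<lambda>y. f y - wls \<phi> m w n x f y))^2)
          \<le> ennreal p + ennreal q * (ennreal (real n) * ennreal (\<beta> x))"
          using AE_bound[of k]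
        proof eventually_elim
          case (elim x)
          have "ennreal p + ennreal q * (ennreal (real n) * ennreal (\<beta> x)) = ennreal (p + q * (real n * \<beta> x))"
            using p0 q0 \<beta>0[of x] by (simp add: ennreal_mult)
          then show ?case using ennreal_leI[OF elim] by (simp only: p_def q_def)
        qed
      qed
      also have "\<dots> = ennreal p + ennreal q * (ennreal (real n) * (\<integral>\<^sup>+x. ennreal (\<beta> x) \<partial>P))"
        using \<beta>_meas by (simp add: nn_integral_add nn_integral_cmult P.emeasure_space_1)
      also have "\<dots> \<le> ennreal p + ennreal q * ennreal R"
        using int_\<beta> by (intro add_left_mono mult_left_mono) auto
      also have "\<dots> = ennreal (p + q * R)"
        using p0 q0 R0 by (simp add: ennreal_mult)
      also have "p + q * R = C2 * (a k)\<^sup>2"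
        by (simp add: C2_def p_def q_def algebra_simps)
      finally show ?thesis .
    qed
    moreover have "(\<lambda>k. ennreal (C2 * (a k)\<^sup>2)) \<longlonglongrightarrow> ennreal (C2 * A\<^sup>2)"
      using lim by (intro tendsto_ennrealI tendsto_intros)
    ultimately have "(\<integral>\<^sup>+ x. ennreal ((L2norm \<mu> (\<lambda>y. f y - wls \<phi> m w n x f y))^2) \<partial>P) \<le> ennreal (C2 * A\<^sup>2)"
      by (intro LIMSEQ_le_const) auto
    then show ?thesis using A0 C20 by (simp add: ennreal_mult ennreal_power)
  qed
  have C2_eq: "2 * C_H^2 + 2 * (1 / (1 - \<alpha>)) * real r * (1 + 1 / (1 - real m / real nbar) * (1 / (1 - \<delta>))) = C2"
    by (simp add: C2_def R_def mult.assoc)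
  show ?thesis
    unfolding INF_eq C2_eq C_def[symmetric] using part1 part2 by blast
qed

end
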